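(* Let $S$ be a locally compact space with a countable base. Let $X=(\Omega,\mathcal F_t,X_t,\theta_t,P^x)$ be a transient symmetric Borel right process with state space $S$ and continuous strictly positive potential densities $u(x,y)$ with respect to some $\sigma$-finite measure $m$ on $S$. Then for any excessive function $f$ of $X$ and any $\alpha>0$, $$\widetilde u(x,y)=u(x,y)+f(y),\qquad x,y\in S,$$ is the kernel of an $\alpha$-permanental process.
   Context: For $\alpha>0$, a random vector $(X_1,\dots,X_n)$ with nonnegative components is $\alpha$-permanental with kernel $U$ (a real $n\times n$ matrix) if $E\big(e^{-\sum_{i=1}^n s_iX_i}\big)=|I+US|^{-\alpha}$ for every diagonal matrix $S$ with positive diagonal entries $s_1,\dots,s_n$, where $|\cdot|$ denotes the determinant. A function $\{k(s,t),s,t\in\mathcal T\}$ is the kernel of an $\alpha$-permanental process if there is a stochastic process $\{Z_\alpha(t),t\in\mathcal T\}$ such that for all $t_1,\dots,t_n\in\mathcal T$ the vector $(Z_\alpha(t_1),\dots,Z_\alpha(t_n))$ is $\alpha$-permanental with kernel $\{k(t_i,t_j)\}_{i,j=1}^n$. Potential densities: $E^x\int_0^\infty g(X_t)\,dt=\int_S u(x,y)g(y)\,dm(y)$ for nonnegative measurable $g$; symmetric means $u(x,y)=u(y,x)$. A (nonnegative, real-valued) function $f$ on $S$ is excessive for $X$ if $E^x(f(X_t))\uparrow f(x)$ as $t\to0$ for all $x\in S$. *)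

theory Defs
  imports "HOL-Probability.Probability" "Jordan_Normal_Form.Determinant"
begin

section \<open>Borel right processes\<close>

text \<open>
  The state space \<open>S\<close> is the type \<open>'a\<close>. The cemetery \<open>\<Delta>\<close> is \<^term>\<open>None\<close>, and
  \<open>S \<union> {\<Delta>}\<close> carries the topology of the library's Alexandroff compactification: for a locally
  compact Hausdorff \<open>S\<close>, \<open>\<Delta>\<close> is the point at infinity if \<open>S\<close> is not compact and an isolated
  point if \<open>S\<close> is compact.
\<close>

definition cemetery_borel :: "'a::topological_space option measure"
  where "cemetery_borel = sigma UNIV {U. openin (Alexandroff_compactification euclidean) U}"

text \<open>Functions on \<open>S\<close> are extended to \<open>S \<union> {\<Delta>}\<close> by the value 0 at \<open>\<Delta>\<close>.\<close>

definition ext_cemetery :: "('a \<Rightarrow> ennreal) \<Rightarrow> 'a option \<Rightarrow> ennreal"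
  where "ext_cemetery g y = (case y of None \<Rightarrow> 0 | Some x \<Rightarrow> g x)"

text \<open>
  Time runs through \<open>[0, \<infinity>]\<close> with the convention \<open>X\<^sub>\<infinity> = \<Delta>\<close>, and \<open>F \<infinity>\<close> stands for the
  \<open>\<sigma>\<close>-algebra on \<open>\<Omega>\<close> on which all the laws \<open>P\<^sup>x\<close> live. The filtration may be any
  right-continuous one for which \<open>X\<close> is strong Markov; the augmented natural filtration is the
  usual choice. The transition function is \<open>P\<^sub>t(y, B) = P\<^sup>y(X\<^sub>t \<in> B)\<close>, so the strong Markov
  property \<open>P\<^sup>y(X\<^bsub>T+s\<^esub> \<in> B | F\<^sub>T) = P\<^sub>s(X\<^sub>T, B)\<close> is written in terms of \<open>P\<close>.
  Constant \<open>T\<close> give the simple Markov property.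
\<close>

locale borel_right_process = filtration \<Omega> F
  for \<Omega> :: "'w set"
    and F :: "ennreal \<Rightarrow> 'w measure"
    and X :: "ennreal \<Rightarrow> 'w \<Rightarrow> 'a::{t2_space, second_countable_topology} option"
    and \<theta> :: "ennreal \<Rightarrow> 'w \<Rightarrow> 'w"
    and P :: "'a option \<Rightarrow> 'w measure" +
  assumes filtration_right_continuous:
      "\<And>t. t < \<infinity> \<Longrightarrow> sets (F t) = (\<Inter>s\<in>{t<..}. sets (F s))"
    and prob_P: "\<And>y. prob_space (P y)"
    and sets_P: "\<And>y. sets (P y) = sets (F \<infinity>)"
    and adapted: "\<And>t. X t \<in> F t \<rightarrow>\<^sub>M cemetery_borel"
    and X_infinity: "\<And>\<omega>. \<omega> \<in> \<Omega> \<Longrightarrow> X \<infinity> \<omega> = None"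
    and absorbing: "\<And>s t \<omega>. \<omega> \<in> \<Omega> \<Longrightarrow> s \<le> t \<Longrightarrow> X s \<omega> = None \<Longrightarrow> X t \<omega> = None"
    and paths_right_continuous: "\<And>t \<omega>. \<omega> \<in> \<Omega> \<Longrightarrow> t < \<infinity> \<Longrightarrow>
      limitin (Alexandroff_compactification euclidean) (\<lambda>s. X s \<omega>) (X t \<omega>) (at_right t)"
    and shift: "\<And>s t \<omega>. \<omega> \<in> \<Omega> \<Longrightarrow> s < \<infinity> \<Longrightarrow> t < \<infinity> \<Longrightarrow>
      \<theta> t \<omega> \<in> \<Omega> \<and> X s (\<theta> t \<omega>) = X (s + t) \<omega>"
    and normal: "\<And>y. AE \<omega> in P y. X 0 \<omega> = y"
    and borel_semigroup: "\<And>t B. t < \<infinity> \<Longrightarrow> B \<in> sets cemetery_borel \<Longrightarrow>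
      (\<lambda>y. emeasure (P y) {\<omega> \<in> \<Omega>. X t \<omega> \<in> B}) \<in> borel_measurable cemetery_borel"
    and strong_markov: "\<And>y T s A B. stopping_time F T \<Longrightarrow> A \<in> sets (pre_sigma T) \<Longrightarrow>
      s < \<infinity> \<Longrightarrow> B \<in> sets cemetery_borel \<Longrightarrow>
      emeasure (P y) {\<omega> \<in> A. X (T \<omega> + s) \<omega> \<in> B} =
        (\<integral>\<^sup>+\<omega>\<in>A. emeasure (P (X (T \<omega>) \<omega>)) {\<omega>' \<in> \<Omega>. X s \<omega>' \<in> B} \<partial>P y)"

section \<open>Potentials and excessive functions\<close>

definition potential ::
  "(ennreal \<Rightarrow> 'w \<Rightarrow> 'a option) \<Rightarrow> ('a option \<Rightarrow> 'w measure) \<Rightarrow> ('a \<Rightarrow> ennreal) \<Rightarrow> 'a \<Rightarrow> ennreal"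
  where "potential X P g x =
    (\<integral>\<^sup>+\<omega>. (\<integral>\<^sup>+t\<in>{0..}. ext_cemetery g (X (ennreal t) \<omega>) \<partial>lborel) \<partial>P (Some x))"

text \<open>Transience in the sense of Getoor: some nonnegative \<open>h\<close> has \<open>0 < Uh < \<infinity>\<close> everywhere.\<close>

definition transient_process ::
  "(ennreal \<Rightarrow> 'w \<Rightarrow> 'a::topological_space option) \<Rightarrow> ('a option \<Rightarrow> 'w measure) \<Rightarrow> bool"
  where "transient_process X P \<longleftrightarrow>
    (\<exists>h\<in>borel_measurable borel. \<forall>x. 0 < potential X P h x \<and> potential X P h x < \<infinity>)"

definition potential_densities ::
  "(ennreal \<Rightarrow> 'w \<Rightarrow> 'a::topological_space option) \<Rightarrow> ('a option \<Rightarrow> 'w measure) \<Rightarrow>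
    'a measure \<Rightarrow> ('a \<Rightarrow> 'a \<Rightarrow> real) \<Rightarrow> bool"
  where "potential_densities X P m u \<longleftrightarrow>
    (\<forall>g\<in>borel_measurable borel. \<forall>x.
      potential X P g x = (\<integral>\<^sup>+y. ennreal (u x y) * g y \<partial>m))"

definition universally_measurable :: "('a::topological_space \<Rightarrow> real) \<Rightarrow> bool"
  where "universally_measurable f \<longleftrightarrow>
    (\<forall>\<mu>. finite_measure \<mu> \<and> sets \<mu> = sets borel \<longrightarrow> f \<in> borel_measurable (completion \<mu>))"

text \<open>
  Excessive functions are only required to be universally measurable. The integral below is then
  over a function measurable for the completion of \<open>P\<^sup>x\<close>, and agrees with the integral
  over that completion by \<open>nn_integral_completion\<close>.
\<close>

definition excessive ::
  "(ennreal \<Rightarrow> 'w \<Rightarrow> 'a::topological_space option) \<Rightarrow> ('a option \<Rightarrow> 'w measure) \<Rightarrow> ('a \<Rightarrow> real) \<Rightarrow> bool"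
  where "excessive X P f \<longleftrightarrow>
    universally_measurable f \<and> (\<forall>x. 0 \<le> f x) \<and>
    (\<forall>x. let Ef = (\<lambda>t::real. \<integral>\<^sup>+\<omega>. ext_cemetery (\<lambda>y. ennreal (f y)) (X (ennreal t) \<omega>) \<partial>P (Some x))
      in antimono_on {0<..} Ef \<and> (Ef \<longlongrightarrow> ennreal (f x)) (at_right 0))"

section \<open>Permanental vectors and processes\<close>

text \<open>
  Although \<open>powr\<close> is total (with \<open>(- a) powr b = a powr b\<close> and \<open>0 powr b = 0\<close>), the equation
  below forces the determinant to be positive: its left-hand side is positive, so the determinant
  has no zero, and it tends to 1 as \<open>s\<close> shrinks to 0 along a ray.
\<close>

definition permanental_vector ::
  "real \<Rightarrow> 'w measure \<Rightarrow> nat \<Rightarrow> (nat \<Rightarrow> 'w \<Rightarrow> real) \<Rightarrow> real mat \<Rightarrow> bool"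
  where "permanental_vector \<alpha> M n Y U \<longleftrightarrow>
    prob_space M \<and> U \<in> carrier_mat n n \<and>
    (\<forall>i<n. Y i \<in> borel_measurable M \<and> (\<forall>\<omega>\<in>space M. 0 \<le> Y i \<omega>)) \<and>
    (\<forall>s. (\<forall>i<n. 0 < s i) \<longrightarrow>
      (\<integral>\<omega>. exp (- (\<Sum>i<n. s i * Y i \<omega>)) \<partial>M) =
        Determinant.det (1\<^sub>m n + U * mat_diag n s) powr (- \<alpha>))"

text \<open>
  The sample space is taken to be path space: any process indexed by \<open>'t\<close> has a version there
  (the image of its law under the path map), so this is no loss of generality.
\<close>

definition permanental_process_kernel :: "real \<Rightarrow> ('t \<Rightarrow> 't \<Rightarrow> real) \<Rightarrow> bool"
  where "permanental_process_kernel \<alpha> k \<longleftrightarrow>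
    (\<exists>(M :: ('t \<Rightarrow> real) measure) (Z :: 't \<Rightarrow> ('t \<Rightarrow> real) \<Rightarrow> real).
      \<forall>n t. permanental_vector \<alpha> M n (\<lambda>i. Z (t i)) (Matrix.mat n n (\<lambda>(i, j). k (t i) (t j))))"

end

theory Submission
  imports Defs "HOL-Real_Asymp.Real_Asymp"
begin

text \<open>
  Why the theorem holds. Fix points \<open>x\<^sub>1, \<dots>, x\<^sub>n\<close>. The potential of a transient Markov process
  obeys the domination principle: if a potential is at most an excessive function on the set
  charged by its density, then it is so everywhere (\<open>domination_principle\<close>). Concentrating
  densities near the points \<open>x\<^sub>i\<close> carries this over to the matrix \<open>W = (u(x\<^sub>i, x\<^sub>j))\<close>
  (\<open>point_domination\<close>), and linear algebra turns it into a statement about inverses: for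
  \<open>\<epsilon> > 0\<close> the matrix \<open>A = (W + \<epsilon>I)\<^sup>-\<^sup>1\<close> has nonpositive off-diagonal entries, \<open>A1 \<ge> 0\<close>, and
  \<open>Av \<ge> 0\<close> whenever \<open>v\<close> is the vector of values of a potential. Since \<open>A\<close> is symmetric, the
  rank-one formula
    \<open>(W + \<epsilon>I + 1v\<^sup>T)\<^sup>-\<^sup>1 = A - (A1)(Av)\<^sup>T / (1 + v\<^sup>TA1)\<close>
  shows that adding \<open>v(x\<^sub>j)\<close> to the \<open>j\<close>-th column only decreases the off-diagonal entries of the
  inverse, so \<open>W + \<epsilon>I + 1v\<^sup>T\<close> is again an inverse M-matrix (\<open>perturbed_inverse_M_matrix\<close>).

  Such a matrix \<open>K = B\<^sup>-\<^sup>1\<close> is the kernel of an \<open>\<alpha>\<close>-permanental vector for every \<open>\<alpha> > 0\<close>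
  (\<open>inverse_M_matrix_permanental\<close>): \<open>|I + KS|\<^sup>-\<^sup>\<alpha>\<close> is a constant times \<open>|B + S|\<^sup>-\<^sup>\<alpha>\<close>, and Gaussian
  elimination expands the latter into a power series with nonnegative coefficients in the numbers
  \<open>1 / (b\<^sub>i\<^sub>i + s\<^sub>i)\<close>, each term being the Laplace transform of independent gamma variables.

  An excessive function is a limit of potentials on any finite set
  (\<open>excessive_approx_by_potentials\<close>; transience enters here), so the restrictions of \<open>u + f\<close> to
  finite sets are limits of permanental kernels. The passage to the limit and the construction of
  the whole process are done in one step (\<open>permanental_process_of_approximations\<close>): write
  \<open>1 - exp(-Z\<^sub>t)\<close> in binary, take a cluster point of the probabilities of all cylinder events for
  the digits, and apply Kolmogorov's extension theorem to it.
\<close>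

section \<open>Resolvents of sub-Markov semigroups\<close>

text \<open>
  The semigroup is given by subprobability kernels on the state space alone; the missing mass is
  the mass at the cemetery. The kernels are jointly measurable in time and starting point, so
  that integrals over time commute with them.
\<close>

locale submarkov_semigroup =
  fixes \<kappa> :: "real \<Rightarrow> 'a::second_countable_topology \<Rightarrow> 'a measure"
  assumes kernel_measurable: "(\<lambda>(t, x). \<kappa> t x) \<in> borel \<Otimes>\<^sub>M borel \<rightarrow>\<^sub>M subprob_algebra borel"
    and semigroup: "0 \<le> s \<Longrightarrow> 0 \<le> t \<Longrightarrow> \<kappa> (s + t) x = \<kappa> s x \<bind> \<kappa> t"
begin

lemma kernel_measurable_comp [measurable (raw)]:
  assumes "a \<in> M \<rightarrow>\<^sub>M borel" and "b \<in> M \<rightarrow>\<^sub>M borel"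
  shows "(\<lambda>z. \<kappa> (a z) (b z)) \<in> M \<rightarrow>\<^sub>M subprob_algebra borel"
  using measurable_compose[OF measurable_Pair[OF assms] kernel_measurable] by simp

lemma subprob_kernel: "subprob_space (\<kappa> t x)"
  and sets_\<kappa> [measurable_cong, simp]: "sets (\<kappa> t x) = sets borel"
  and space_\<kappa> [simp]: "space (\<kappa> t x) = UNIV"
proof -
  have *: "\<kappa> t \<in> borel \<rightarrow>\<^sub>M subprob_algebra borel"
    using kernel_measurable_comp[of "\<lambda>_. t" borel "\<lambda>x. x"] by simp
  show "subprob_space (\<kappa> t x)" "sets (\<kappa> t x) = sets borel"
    using subprob_space_kernel[OF *, of x] sets_kernel[OF *, of x] by (simp_all only: space_borel UNIV_I)
  then show "space (\<kappa> t x) = UNIV"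
    by (metis sets_eq_imp_space_eq space_borel)
qed

definition transition :: "real \<Rightarrow> ('a \<Rightarrow> ennreal) \<Rightarrow> 'a \<Rightarrow> ennreal"
  where "transition t g x = (\<integral>\<^sup>+y. g y \<partial>\<kappa> t x)"

text \<open>
  The case \<open>l = 0\<close> is the potential operator.
\<close>

definition resolvent :: "real \<Rightarrow> ('a \<Rightarrow> ennreal) \<Rightarrow> 'a \<Rightarrow> ennreal"
  where "resolvent l g x = (\<integral>\<^sup>+t. ennreal (exp (- l * t) * indicator {0..} t) * transition t g x \<partial>lborel)"

lemma transition_measurable [measurable (raw)]:
  assumes [measurable]: "(\<lambda>(z, y). g z y) \<in> borel_measurable (M \<Otimes>\<^sub>M borel)"
    "a \<in> M \<rightarrow>\<^sub>M borel" "b \<in> M \<rightarrow>\<^sub>M borel"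
  shows "(\<lambda>z. transition (a z) (g z) (b z)) \<in> borel_measurable M"
  unfolding transition_def
  by (rule nn_integral_measurable_subprob_algebra2[where N = borel]) measurable

lemma resolvent_measurable [measurable (raw)]:
  assumes [measurable]: "g \<in> borel_measurable borel" "b \<in> M \<rightarrow>\<^sub>M borel"
  shows "(\<lambda>z. resolvent l g (b z)) \<in> borel_measurable M"
  unfolding resolvent_def by measurable

lemma transition_add:
  assumes [measurable]: "g \<in> borel_measurable borel" "h \<in> borel_measurable borel"
  shows "transition t (\<lambda>y. g y + h y) x = transition t g x + transition t h x"
  unfolding transition_def by (rule nn_integral_add) auto

lemma transition_cmult:
  assumes [measurable]: "g \<in> borel_measurable borel"
  shows "transition t (\<lambda>y. c * g y) x = c * transition t g x"
  unfolding transition_def by (rule nn_integral_cmult) auto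

lemma transition_mono: "(\<And>y. g y \<le> h y) \<Longrightarrow> transition t g x \<le> transition t h x"
  unfolding transition_def by (rule nn_integral_mono) auto

lemma transition_const_le: "transition t (\<lambda>_. c) x \<le> c"
proof -
  have "emeasure (\<kappa> t x) UNIV \<le> 1"
    using subprob_space.subprob_emeasure_le_1[OF subprob_kernel, of t x UNIV] by simp
  then show ?thesis
    unfolding transition_def using mult_left_mono[of "emeasure (\<kappa> t x) UNIV" 1 c] by simp
qed

lemma resolvent_add:
  assumes [measurable]: "g \<in> borel_measurable borel" "h \<in> borel_measurable borel"
  shows "resolvent l (\<lambda>y. g y + h y) x = resolvent l g x + resolvent l h x"
  unfolding resolvent_def by (simp add: transition_add distrib_left nn_integral_add)

lemma resolvent_cmult:
  assumes [measurable]: "g \<in> borel_measurable borel"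
  shows "resolvent l (\<lambda>y. c * g y) x = c * resolvent l g x"
  unfolding resolvent_def
  by (subst nn_integral_cmult[symmetric])
    (auto simp: transition_cmult mult_ac intro!: nn_integral_cong)

lemma resolvent_mono: "(\<And>y. g y \<le> h y) \<Longrightarrow> resolvent l g x \<le> resolvent l h x"
  unfolding resolvent_def by (intro nn_integral_mono mult_left_mono transition_mono) auto

lemma resolvent_antimono: "m \<le> l \<Longrightarrow> resolvent l g x \<le> resolvent m g x"
  unfolding resolvent_def
  by (intro nn_integral_mono mult_right_mono) (auto simp: indicator_def mult_right_mono)

lemma resolvent_sum:
  assumes "\<And>j. j < n \<Longrightarrow> \<psi> j \<in> borel_measurable borel"
  shows "resolvent l (\<lambda>y. \<Sum>j<n. c j * \<psi> j y) x = (\<Sum>j<(n::nat). c j * resolvent l (\<psi> j) x)"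
  using assms
proof (induction n)
  case 0
  show ?case by (simp add: resolvent_def transition_def)
next
  case (Suc n)
  have [measurable]: "\<psi> n \<in> borel_measurable borel" using Suc.prems by auto
  have [measurable]: "(\<lambda>y. \<Sum>j<n. c j * \<psi> j y) \<in> borel_measurable borel"
    using Suc.prems by (intro borel_measurable_sum borel_measurable_times_ennreal borel_measurable_const) auto
  show ?case using Suc by (simp add: resolvent_add resolvent_cmult)
qed

lemma resolvent_SUP:
  assumes [measurable]: "\<And>n. g n \<in> borel_measurable borel" and "incseq g"
  shows "resolvent l (\<lambda>y. SUP n. g n y) x = (SUP n. resolvent l (g n) x)"
proof -
  have mono: "incseq (\<lambda>n. transition t (g n) x)" for t
    using \<open>incseq g\<close> by (auto simp: incseq_def le_fun_def intro!: transition_mono)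
  have "transition t (\<lambda>y. SUP n. g n y) x = (SUP n. transition t (g n) x)" for t
    unfolding transition_def using \<open>incseq g\<close>
    by (intro nn_integral_monotone_convergence_SUP) auto
  then have "resolvent l (\<lambda>y. SUP n. g n y) x =
    (\<integral>\<^sup>+t. (SUP n. ennreal (exp (- l * t) * indicator {0..} t) * transition t (g n) x) \<partial>lborel)"
    unfolding resolvent_def by (simp add: SUP_mult_left_ennreal)
  also have "\<dots> = (SUP n. resolvent l (g n) x)"
    unfolding resolvent_def using mono
    by (intro nn_integral_monotone_convergence_SUP)
      (auto simp: incseq_def le_fun_def intro!: mult_left_mono)
  finally show ?thesis .
qed

lemma nn_integral_exponential:
  assumes "0 < l"
  shows "(\<integral>\<^sup>+t. ennreal (exp (- l * t) * indicator {0..} t) \<partial>lborel) = ennreal (1 / l)"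
proof -
  have "(\<integral>\<^sup>+t. ennreal (exp (- l * t)) * indicator {0..} t \<partial>lborel)
      = ennreal (0 - (- exp (- l * 0) / l))"
  proof (rule nn_integral_FTC_atLeast)
    show "((\<lambda>t. - exp (- l * t) / l) \<longlongrightarrow> 0) at_top"
      using assms by real_asymp
    show "\<And>t. 0 \<le> t \<Longrightarrow> DERIV (\<lambda>t. - exp (- l * t) / l) t :> exp (- l * t)"
      using assms by (auto intro!: derivative_eq_intros)
  qed auto
  then show ?thesis
    by (simp add: ennreal_mult ennreal_indicator[symmetric])
qed

lemma resolvent_const_le:
  assumes "0 < l" shows "ennreal l * resolvent l (\<lambda>_. c) x \<le> c"
proof -
  have "resolvent l (\<lambda>_. c) x \<le> (\<integral>\<^sup>+t. ennreal (exp (- l * t) * indicator {0..} t) * c \<partial>lborel)"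
    unfolding resolvent_def by (intro nn_integral_mono mult_left_mono transition_const_le) auto
  also have "\<dots> = ennreal (1 / l) * c"
    using nn_integral_exponential[OF assms] by (subst nn_integral_multc) auto
  finally have "ennreal l * resolvent l (\<lambda>_. c) x \<le> ennreal l * (ennreal (1 / l) * c)"
    by (rule mult_left_mono) auto
  also have "\<dots> = c"
    using assms by (simp add: mult.assoc[symmetric] ennreal_mult'[symmetric])
  finally show ?thesis .
qed

lemma transition_transition:
  assumes [measurable]: "g \<in> borel_measurable borel" and "0 \<le> s" "0 \<le> t"
  shows "transition s (transition t g) x = transition (s + t) g x"
  unfolding transition_def semigroup[OF assms(2,3)]
  by (rule nn_integral_bind[symmetric, where B = borel]) measurable

text \<open>
  Fubini and the semigroup property: starting the integral over time after a delay \<open>s\<close>.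
\<close>

lemma transition_resolvent:
  assumes [measurable]: "g \<in> borel_measurable borel" and "0 \<le> s"
  shows "transition s (resolvent l g) x =
    (\<integral>\<^sup>+t. ennreal (exp (- l * t) * indicator {0..} t) * transition (s + t) g x \<partial>lborel)"
proof -
  interpret \<kappa>: subprob_space "\<kappa> s x" by (rule subprob_kernel)
  interpret pair_sigma_finite "\<kappa> s x" lborel ..
  have "transition s (resolvent l g) x =
     (\<integral>\<^sup>+t. (\<integral>\<^sup>+y. ennreal (exp (- l * t) * indicator {0..} t) * transition t g y \<partial>\<kappa> s x) \<partial>lborel)"
    unfolding transition_def[of s] resolvent_def
    by (rule Fubini'[symmetric]) measurable
  also have "\<dots> = (\<integral>\<^sup>+t. ennreal (exp (- l * t) * indicator {0..} t) * transition s (transition t g) x \<partial>lborel)"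
    unfolding transition_def[of s]
    by (intro nn_integral_cong nn_integral_cmult) auto
  also have "\<dots> = (\<integral>\<^sup>+t. ennreal (exp (- l * t) * indicator {0..} t) * transition (s + t) g x \<partial>lborel)"
    by (intro nn_integral_cong) (auto simp: transition_transition assms split: split_indicator)
  finally show ?thesis .
qed

lemma resolvent_resolvent:
  assumes [measurable]: "g \<in> borel_measurable borel"
  shows "resolvent m (resolvent l g) x =
    (\<integral>\<^sup>+s. (\<integral>\<^sup>+t. ennreal (exp (- m * s) * indicator {0..} s) * (ennreal (exp (- l * t) * indicator {0..} t)
       * transition (s + t) g x) \<partial>lborel) \<partial>lborel)"
  unfolding resolvent_def[of m]
  by (intro nn_integral_cong, subst nn_integral_cmult)
    (auto simp: transition_resolvent split: split_indicator)

text \<open>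
  Both orders of composition integrate \<open>exp(-ms - lt) P\<^bsub>s+t\<^esub> g\<close> over \<open>s, t \<ge> 0\<close>, up to the names
  of \<open>s\<close> and \<open>t\<close>.
\<close>

lemma resolvent_commute:
  assumes [measurable]: "g \<in> borel_measurable borel"
  shows "resolvent m (resolvent l g) x = resolvent l (resolvent m g) x"
  unfolding resolvent_resolvent[OF assms]
  by (subst lborel_pair.Fubini', measurable)
    (auto simp: mult_ac add_ac intro!: nn_integral_cong)

text \<open>
  The resolvent equation, arranged so that no term is subtracted. Substituting \<open>r = s + t\<close> in the
  double integral leaves
  \<open>(l - m) \<integral> exp(-ms - l(r - s)) ds = exp(-mr) - exp(-lr)\<close> over \<open>0 \<le> s \<le> r\<close>.
\<close>

lemma resolvent_equation:
  assumes [measurable]: "g \<in> borel_measurable borel" and ml: "m \<le> l"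
  shows "resolvent m g x = resolvent l g x + ennreal (l - m) * resolvent m (resolvent l g) x"
proof (cases "m = l")
  case False
  then have "m < l" using ml by simp
  have deriv: "((\<lambda>s. exp (a * s) / a) has_real_derivative exp (a * s)) (at s within A)"
    if "a \<noteq> 0" for a s :: real and A
    by (rule derivative_eq_intros refl | use that in simp)+
  let ?T = "\<lambda>r. transition r g x"
  have "resolvent m (resolvent l g) x =
    (\<integral>\<^sup>+s. (\<integral>\<^sup>+r. ennreal (exp (- m * s) * indicator {0..} s) *
        (ennreal (exp (- l * (r - s)) * indicator {0..} (r - s)) * ?T r) \<partial>lborel) \<partial>lborel)"
    unfolding resolvent_resolvent[OF assms(1)]
  proof (rule nn_integral_cong)
    fix s :: real
    let ?F = "\<lambda>t. ennreal (exp (- m * s) * indicator {0..} s) *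
       (ennreal (exp (- l * t) * indicator {0..} t) * transition (s + t) g x)"
    show "(\<integral>\<^sup>+t. ?F t \<partial>lborel) = (\<integral>\<^sup>+r. ennreal (exp (- m * s) * indicator {0..} s) *
        (ennreal (exp (- l * (r - s)) * indicator {0..} (r - s)) * ?T r) \<partial>lborel)"
      using nn_integral_real_affine[of ?F 1 "- s"] by simp
  qed
  also have "\<dots> = (\<integral>\<^sup>+r. (\<integral>\<^sup>+s. ennreal (exp (- m * s) * indicator {0..} s) *
        (ennreal (exp (- l * (r - s)) * indicator {0..} (r - s)) * ?T r) \<partial>lborel) \<partial>lborel)"
    by (subst lborel_pair.Fubini') auto
  also have "\<dots> = (\<integral>\<^sup>+r. ennreal (exp (- l * r)) * ?T r * 
       (\<integral>\<^sup>+s. ennreal (exp ((l - m) * s)) * indicator {0..r} s \<partial>lborel) \<partial>lborel)"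
  proof (rule nn_integral_cong)
    fix r :: real
    have "(\<integral>\<^sup>+s. ennreal (exp (- m * s) * indicator {0..} s) *
        (ennreal (exp (- l * (r - s)) * indicator {0..} (r - s)) * ?T r) \<partial>lborel) =
      (\<integral>\<^sup>+s. ennreal (exp (- l * r)) * ?T r * (ennreal (exp ((l - m) * s)) * indicator {0..r} s) \<partial>lborel)"
    proof (rule nn_integral_cong)
      fix s :: real
      have "exp (- m * s) * exp (- l * (r - s)) = exp (- l * r) * exp ((l - m) * s)"
        by (simp add: mult_exp_exp algebra_simps)
      then have "ennreal (exp (- m * s)) * ennreal (exp (- l * (r - s))) =
          ennreal (exp (- l * r)) * ennreal (exp ((l - m) * s))"
        by (metis ennreal_mult' exp_ge_zero)
      then have "ennreal (exp (- m * s)) * (ennreal (exp (- l * (r - s))) * ?T r) =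
          ennreal (exp (- l * r)) * ?T r * ennreal (exp ((l - m) * s))"
        by (metis mult.assoc mult.commute)
      then show "ennreal (exp (- m * s) * indicator {0..} s) *
          (ennreal (exp (- l * (r - s)) * indicator {0..} (r - s)) * ?T r) =
        ennreal (exp (- l * r)) * ?T r * (ennreal (exp ((l - m) * s)) * indicator {0..r} s)"
        by (cases "0 \<le> s \<and> s \<le> r") (auto simp: indicator_def)
    qed
    then show "(\<integral>\<^sup>+s. ennreal (exp (- m * s) * indicator {0..} s) *
        (ennreal (exp (- l * (r - s)) * indicator {0..} (r - s)) * ?T r) \<partial>lborel) =
      ennreal (exp (- l * r)) * ?T r * (\<integral>\<^sup>+s. ennreal (exp ((l - m) * s)) * indicator {0..r} s \<partial>lborel)"
      by (simp add: nn_integral_cmult)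
  qed
  also have "\<dots> = (\<integral>\<^sup>+r. ennreal (exp (- l * r)) * ?T r * 
       ennreal ((exp ((l - m) * r) - 1) / (l - m) * indicator {0..} r) \<partial>lborel)"
  proof (intro nn_integral_cong)
    fix r :: real
    have "(\<integral>\<^sup>+s. ennreal (exp ((l - m) * s)) * indicator {0..r} s \<partial>lborel) = 
      ennreal ((exp ((l - m) * r) - 1) / (l - m) * indicator {0..} r)"
    proof (cases "0 \<le> r")
      case True
      have "(\<integral>\<^sup>+s. ennreal (exp ((l - m) * s)) * indicator {0..r} s \<partial>lborel) = 
          ennreal (exp ((l - m) * r) / (l - m) - exp ((l - m) * 0) / (l - m))"
        using \<open>m < l\<close> True deriv[of "l - m"] by (intro nn_integral_FTC_Icc) auto
      then show ?thesis using True by (simp add: diff_divide_distrib)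
    qed simp
    then show "ennreal (exp (- l * r)) * ?T r * 
       (\<integral>\<^sup>+s. ennreal (exp ((l - m) * s)) * indicator {0..r} s \<partial>lborel) = 
       ennreal (exp (- l * r)) * ?T r * 
       ennreal ((exp ((l - m) * r) - 1) / (l - m) * indicator {0..} r)" by simp
  qed
  finally have "ennreal (l - m) * resolvent m (resolvent l g) x = 
     (\<integral>\<^sup>+r. ennreal (l - m) * (ennreal (exp (- l * r)) * ?T r * 
       ennreal ((exp ((l - m) * r) - 1) / (l - m) * indicator {0..} r)) \<partial>lborel)"
    by (simp add: nn_integral_cmult)
  also have "\<dots> = (\<integral>\<^sup>+r. ennreal ((exp (- m * r) - exp (- l * r)) * indicator {0..} r) * ?T r \<partial>lborel)"
  proof (intro nn_integral_cong)
    fix r :: real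
    have "(l - m) * (exp (- l * r) * ((exp ((l - m) * r) - 1) / (l - m))) 
      = exp (- m * r) - exp (- l * r)"
      using \<open>m < l\<close> by (simp add: field_simps mult_exp_exp)
    moreover have "ennreal A * (ennreal E * c * ennreal q) = ennreal (A * (E * q)) * c"
      if "0 \<le> A" "0 \<le> E" "0 \<le> q" for A E q and c :: ennreal
      using that by (simp add: ennreal_mult mult_ac)
    from this[of "l - m" "exp (- l * r)" "(exp ((l - m) * r) - 1) / (l - m)"]
    have "ennreal (l - m) * (ennreal (exp (- l * r)) * ?T r * 
       ennreal ((exp ((l - m) * r) - 1) / (l - m))) = 
       ennreal ((l - m) * (exp (- l * r) * ((exp ((l - m) * r) - 1) / (l - m)))) * ?T r" if "0 \<le> r"
      using \<open>m < l\<close> that by simp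
    ultimately show "ennreal (l - m) * (ennreal (exp (- l * r)) * ?T r * 
       ennreal ((exp ((l - m) * r) - 1) / (l - m) * indicator {0..} r)) = 
       ennreal ((exp (- m * r) - exp (- l * r)) * indicator {0..} r) * ?T r"
      by (auto split: split_indicator)
  qed
  finally have "resolvent l g x + ennreal (l - m) * resolvent m (resolvent l g) x = 
    (\<integral>\<^sup>+r. ennreal (exp (- l * r) * indicator {0..} r) * ?T r + 
      ennreal ((exp (- m * r) - exp (- l * r)) * indicator {0..} r) * ?T r \<partial>lborel)"
    unfolding resolvent_def[of l] by (subst nn_integral_add) auto
  also have "\<dots> = resolvent m g x"
    unfolding resolvent_def
  proof (intro nn_integral_cong)
    fix r :: real
    have "0 \<le> r \<Longrightarrow> exp (- l * r) \<le> exp (- m * r)"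
      using ml by (simp add: mult_right_mono)
    then show "ennreal (exp (- l * r) * indicator {0..} r) * ?T r + 
      ennreal ((exp (- m * r) - exp (- l * r)) * indicator {0..} r) * ?T r = 
      ennreal (exp (- m * r) * indicator {0..} r) * ?T r"
      by (auto split: split_indicator simp: distrib_right[symmetric] ennreal_plus[symmetric] simp del: ennreal_plus)
  qed
  finally show ?thesis by simp
qed simp

end

section \<open>The domination principle and excessive functions\<close>

text \<open>
  Exponential averages with rate \<open>n\<close> see only times of order \<open>1/n\<close>. After the substitution
  \<open>s = nt\<close> this is dominated convergence against the weight \<open>exp(-s)\<close>. It turns the continuity of
  \<open>P\<^sub>t f\<close> at \<open>t = 0\<close> into convergence of resolvents.
\<close>

lemma abelian_average_tendsto:
  fixes q :: "real \<Rightarrow> ennreal" and c :: ennreal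
  assumes [measurable]: "q \<in> borel_measurable borel"
    and le: "\<And>t. 0 < t \<Longrightarrow> q t \<le> c" and "c < \<infinity>" and lim: "(q \<longlongrightarrow> c) (at_right 0)"
  shows "(\<lambda>n. ennreal (real (Suc n)) *
    (\<integral>\<^sup>+t. ennreal (exp (- real (Suc n) * t) * indicator {0..} t) * q t \<partial>lborel)) \<longlonglongrightarrow> c"
proof -
  let ?w = "\<lambda>s::real. ennreal (exp (- s) * indicator {0<..} s)"
  have w: "(\<integral>\<^sup>+s. ?w s \<partial>lborel) = 1"
  proof -
    have "(\<integral>\<^sup>+s. ?w s \<partial>lborel) = (\<integral>\<^sup>+s. ennreal (exp (- s)) * indicator {0..} s \<partial>lborel)"
      using AE_lborel_singleton[of "0::real"] 
      by (intro nn_integral_cong_AE) (auto split: split_indicator elim: eventually_mono)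
    also have "\<dots> = ennreal (0 - (- exp (- 0)))"
    proof (rule nn_integral_FTC_atLeast)
      show "((\<lambda>t::real. - exp (- t)) \<longlongrightarrow> 0) at_top" by real_asymp
    qed (auto intro!: derivative_eq_intros)
    finally show ?thesis by simp
  qed
  have scaled: "ennreal (real (Suc n)) *
      (\<integral>\<^sup>+t. ennreal (exp (- real (Suc n) * t) * indicator {0..} t) * q t \<partial>lborel)
    = (\<integral>\<^sup>+s. ?w s * q (s / real (Suc n)) \<partial>lborel)" for n
  proof -
    let ?n = "real (Suc n)"
    have e: "(- 1 - real n) * s / (1 + real n) = - s" for s :: real
      by (simp add: field_simps)
    have "(\<integral>\<^sup>+t. ennreal (exp (- ?n * t) * indicator {0..} t) * q t \<partial>lborel)
      = ennreal (1 / ?n) * (\<integral>\<^sup>+s. ennreal (exp (- ?n * (s / ?n)) * indicator {0..} (s / ?n)) * q (s / ?n) \<partial>lborel)"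
      by (subst nn_integral_real_affine[where c = "1 / ?n" and t = 0]) (auto simp: abs_of_nonneg)
    also have "(\<integral>\<^sup>+s. ennreal (exp (- ?n * (s / ?n)) * indicator {0..} (s / ?n)) * q (s / ?n) \<partial>lborel)
      = (\<integral>\<^sup>+s. ?w s * q (s / ?n) \<partial>lborel)"
      using AE_lborel_singleton[of "0::real"]
      by (intro nn_integral_cong_AE)
        (auto split: split_indicator elim!: eventually_mono simp: zero_le_divide_iff e)
    finally have "ennreal ?n * (\<integral>\<^sup>+t. ennreal (exp (- ?n * t) * indicator {0..} t) * q t \<partial>lborel)
      = ennreal ?n * ennreal (1 / ?n) * (\<integral>\<^sup>+s. ?w s * q (s / ?n) \<partial>lborel)"
      by (simp add: mult.assoc)
    also have "ennreal ?n * ennreal (1 / ?n) = 1"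
      by (subst ennreal_mult'[symmetric]) auto
    finally show ?thesis by simp
  qed
  have "(\<lambda>n. \<integral>\<^sup>+s. ?w s * q (s / real (Suc n)) \<partial>lborel) \<longlonglongrightarrow> (\<integral>\<^sup>+s. ?w s * c \<partial>lborel)"
  proof (rule nn_integral_dominated_convergence[where w = "\<lambda>s. ?w s * c"])
    show "(\<integral>\<^sup>+s. ?w s * c \<partial>lborel) < \<infinity>"
      using w \<open>c < \<infinity>\<close> by (subst nn_integral_multc) auto
    show "AE s in lborel. ?w s * q (s / real (Suc n)) \<le> ?w s * c" for n
      by (auto intro!: AE_I2 mult_left_mono le split: split_indicator)
    show "AE s in lborel. (\<lambda>n. ?w s * q (s / real (Suc n))) \<longlonglongrightarrow> ?w s * c"
    proof (intro AE_I2)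
      fix s :: real
      show "(\<lambda>n. ?w s * q (s / real (Suc n))) \<longlonglongrightarrow> ?w s * c"
      proof (cases "0 < s")
        case True
        have "(\<lambda>n. s / real (Suc n)) \<longlonglongrightarrow> 0" by real_asymp
        then have "filterlim (\<lambda>n. s / real (Suc n)) (at_right 0) sequentially"
          using True by (auto simp: filterlim_at)
        from filterlim_compose[OF lim this] show ?thesis
          by (intro ennreal_tendsto_cmult) auto
      qed simp
    qed
  qed auto
  also have "(\<integral>\<^sup>+s. ?w s * c \<partial>lborel) = c"
    using w by (subst nn_integral_multc) auto
  finally show ?thesis unfolding scaled .
qed

context submarkov_semigroup
begin

lemma resolvent_tendsto_potential:
  assumes [measurable]: "g \<in> borel_measurable borel"
  shows "(\<lambda>n. resolvent (1 / real (Suc n)) g x) \<longlonglongrightarrow> resolvent 0 g x"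
  unfolding resolvent_def
proof (rule nn_integral_LIMSEQ)
  show "incseq (\<lambda>n t. ennreal (exp (- (1 / real (Suc n)) * t) * indicator {0..} t) * transition t g x)"
  proof (intro incseq_SucI le_funI mult_right_mono)
    fix n t
    have "1 / real (Suc (Suc n)) * t \<le> 1 / real (Suc n) * t" if "0 \<le> t"
      using that by (intro mult_right_mono frac_le) auto
    then show "ennreal (exp (- (1 / real (Suc n)) * t) * indicator {0..} t)
      \<le> ennreal (exp (- (1 / real (Suc (Suc n))) * t) * indicator {0..} t)"
      by (auto split: split_indicator)
  qed auto
  fix t :: real
  have "(\<lambda>n. exp (- (1 / real (Suc n)) * t) * indicator {0..} t) \<longlonglongrightarrow> exp (- 0 * t) * indicator {0..} t"
    by (intro tendsto_intros lim_1_over_n[THEN LIMSEQ_Suc])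
  then show "(\<lambda>n. ennreal (exp (- (1 / real (Suc n)) * t) * indicator {0..} t) * transition t g x)
     \<longlonglongrightarrow> ennreal (exp (- 0 * t) * indicator {0..} t) * transition t g x"
  proof (cases "0 \<le> t")
    case True
    show ?thesis
    proof (cases "transition t g x = \<top>")
      case False
      then have "(\<lambda>n. transition t g x * ennreal (exp (- (1 / real (Suc n)) * t) * indicator {0..} t)) \<longlonglongrightarrow>
        transition t g x * ennreal (exp (- 0 * t) * indicator {0..} t)"
        by (intro ennreal_tendsto_cmult tendsto_ennrealI tendsto_intros lim_1_over_n[THEN LIMSEQ_Suc])
          (auto simp: less_top)
      then show ?thesis by (simp add: mult.commute)
    qed (use True in \<open>simp add: ennreal_mult_top\<close>)
  qed simp
qed auto

lemma potential_eq_resolvent: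
  assumes "g \<in> borel_measurable borel" and "0 < l"
  shows "resolvent 0 g x = resolvent l g x + ennreal l * resolvent l (resolvent 0 g) x"
  using resolvent_equation[of g 0 l x] resolvent_commute[of g 0 l x] assms by simp

text \<open>
  By the resolvent equation the quantity is \<open>Ug - R\<^sub>l g\<close>, and \<open>R\<^sub>l g\<close> increases to \<open>Ug\<close> as
  \<open>l \<rightarrow> 0\<close>. Potentials thus have no invariant part.
\<close>

lemma resolvent_of_potential_vanishes:
  assumes [measurable]: "g \<in> borel_measurable borel" and fin: "resolvent 0 g x < \<infinity>"
  shows "(\<lambda>n. ennreal (1 / real (Suc n)) * resolvent (1 / real (Suc n)) (resolvent 0 g) x) \<longlonglongrightarrow> 0"
proof -
  let ?l = "\<lambda>n. 1 / real (Suc n)"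
  have fin': "resolvent (?l n) g x \<noteq> \<infinity>" for n
    using resolvent_antimono[of 0 "?l n" g x] fin by (auto simp: less_top top_unique)
  have eq: "ennreal (?l n) * resolvent (?l n) (resolvent 0 g) x = resolvent 0 g x - resolvent (?l n) g x" for n
    using potential_eq_resolvent[of g "?l n" x] fin' by (simp add: ennreal_add_diff_cancel_left)
  have "(\<lambda>n. resolvent 0 g x - resolvent (?l n) g x) \<longlonglongrightarrow> resolvent 0 g x - resolvent 0 g x"
    using fin by (intro tendsto_diff_ennreal tendsto_const resolvent_tendsto_potential) auto
  then show ?thesis
    unfolding eq using fin by (simp add: less_top)
qed

lemma potential_supermedian:
  assumes "g \<in> borel_measurable borel" and "0 < l"
  shows "ennreal l * resolvent l (resolvent 0 g) x \<le> resolvent 0 g x"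
  using potential_eq_resolvent[OF assms, of x] by (metis add.commute le_iff_add)

text \<open>
  Insert the hypothesis into both terms of the resolvent equation for \<open>R\<^sub>m p\<close>: it gives
  \<open>p + (l - m) R\<^sub>m p \<le> l R\<^sub>m p\<close>, and \<open>R\<^sub>m p\<close> is finite. The rate can therefore be sent to 0.
\<close>

lemma subinvariant_smaller_rate:
  assumes [measurable]: "p \<in> borel_measurable borel"
    and sub: "\<And>x. p x \<le> ennreal l * resolvent l p x"
    and "0 < m" "m \<le> l" and fin: "resolvent m p x < \<infinity>"
  shows "p x \<le> ennreal m * resolvent m p x"
proof -
  let ?r = "resolvent m p x"
  have "p x + ennreal (l - m) * ?r \<le>
    ennreal l * resolvent l p x + ennreal (l - m) * resolvent m (\<lambda>y. ennreal l * resolvent l p y) x"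
    by (intro add_mono mult_left_mono sub resolvent_mono) auto
  also have "\<dots> = ennreal l * (resolvent l p x + ennreal (l - m) * resolvent m (resolvent l p) x)"
    by (simp add: resolvent_cmult distrib_left mult_ac)
  also have "\<dots> = ennreal l * ?r"
    using resolvent_equation[of p m l x] \<open>m \<le> l\<close> by simp
  also have "\<dots> = ennreal m * ?r + ennreal (l - m) * ?r"
    using assms(3,4) by (simp add: distrib_right[symmetric] ennreal_plus[symmetric] del: ennreal_plus)
  finally show ?thesis
    using fin less_top[of ?r] by (simp add: ennreal_mult_less_top add.commute[of _ "ennreal (l - m) * ?r"]
        ennreal_add_left_cancel_le ennreal_mult_eq_top_iff)
qed

text \<open>
  The domination principle, with a margin \<open>\<delta>\<close> on the set charged by \<open>g\<close>. The operator
  \<open>N = l R\<^sub>l\<close> is sub-Markov, and \<open>Uk = N(Uk + k/l)\<close>. Put \<open>a = Ug + g/l\<close> and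
  \<open>b = c + Ug' + g'/l\<close>; for large \<open>l\<close> the margin absorbs \<open>g/l\<close>, so \<open>a \<le> b\<close> where \<open>g > 0\<close>. Where
  \<open>g = 0\<close> one has \<open>a = Na\<close> and \<open>Nb \<le> b\<close>, whence the positive part \<open>p\<close> of \<open>a - b\<close> satisfies
  \<open>p \<le> Np\<close> everywhere. Such a \<open>p\<close>, lying below the finite potential \<open>Ug\<close>, vanishes: by
  \<open>subinvariant_smaller_rate\<close> it lies below \<open>m R\<^sub>m Ug = Ug - R\<^sub>m g\<close> for all small \<open>m\<close>. So \<open>a \<le> b\<close>
  everywhere, and \<open>l \<rightarrow> \<infinity>\<close> gives the claim.
\<close>

lemma domination_principle:
  assumes [measurable]: "g \<in> borel_measurable borel" "g' \<in> borel_measurable borel"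
    and fin: "\<And>x. resolvent 0 g x < \<infinity>" and bdd: "\<And>x. g x \<le> ennreal C"
    and "0 < \<delta>"
    and le: "\<And>x. 0 < g x \<Longrightarrow> resolvent 0 g x + ennreal \<delta> \<le> c + resolvent 0 g' x"
    and g': "g' x < \<infinity>"
  shows "resolvent 0 g x \<le> c + resolvent 0 g' x"
proof -
  have key: "resolvent 0 g x \<le> c + resolvent 0 g' x + ennreal (1 / l) * g' x"
    if l: "0 < l" "C / l \<le> \<delta>" for l
  proof -
    define a where "a y = resolvent 0 g y + ennreal (1 / l) * g y" for y
    define b where "b y = c + (resolvent 0 g' y + ennreal (1 / l) * g' y)" for y
    define p where "p y = a y - b y" for y
    have [measurable]: "a \<in> borel_measurable borel" "b \<in> borel_measurable borel"
      and p_meas [measurable]: "p \<in> borel_measurable borel"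
      unfolding a_def b_def p_def by measurable
    have ll: "ennreal l * ennreal (1 / l) = 1"
      using l by (simp add: ennreal_mult'[symmetric])
    have inv: "ennreal l * resolvent l (\<lambda>y. resolvent 0 k y + ennreal (1 / l) * k y) y = resolvent 0 k y"
      if [measurable]: "k \<in> borel_measurable borel" for k y
      using potential_eq_resolvent[OF that l(1), of y] ll
      by (simp add: resolvent_add resolvent_cmult distrib_left mult.assoc[symmetric] add.commute)
    have la: "ennreal l * resolvent l a y = resolvent 0 g y" for y
      using inv[of g y] unfolding a_def by simp
    have lb: "ennreal l * resolvent l b y \<le> c + resolvent 0 g' y" for y
      using inv[of g' y] resolvent_const_le[OF l(1), of c y]
      unfolding b_def by (simp add: resolvent_add distrib_left add_mono)
    have a_fin: "a y < \<infinity>" for y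
      using fin[of y] order_le_less_trans[OF bdd[of y]] unfolding a_def
      by (simp add: ennreal_mult_less_top)
    have a_le: "a y \<le> b y + p y" for y
    proof (cases "a y \<le> b y")
      case False
      then have "a y - b y + b y = a y" by (intro diff_add_cancel_ennreal) auto
      then show ?thesis unfolding p_def by (metis add.commute order_refl)
    qed (simp add: add_increasing2)
    have p_on: "p y = 0" if "0 < g y" for y
    proof -
      have "ennreal (1 / l) * g y \<le> ennreal (1 / l) * ennreal C"
        by (intro mult_left_mono bdd) auto
      also have "\<dots> \<le> ennreal \<delta>"
        using l by (simp add: ennreal_mult'[symmetric] ennreal_leI)
      finally have "a y \<le> b y"
        unfolding a_def b_def using le[OF that]
        by (metis (no_types, lifting) add.assoc add_increasing2 add_left_mono order_trans zero_le)
      then show ?thesis unfolding p_def using a_fin[of y] by (simp add: diff_eq_0_iff_ennreal)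
    qed
    have p_le: "p y \<le> resolvent 0 g y" for y
      using p_on[of y] diff_le_self_ennreal[of "a y" "b y"] unfolding p_def a_def
      by (cases "g y = 0") (auto simp: zero_less_iff_neq_zero)
    have p_sub: "p y \<le> ennreal l * resolvent l p y" for y
    proof (cases "g y = 0")
      case True
      have "a y = ennreal l * resolvent l a y"
        using True la by (simp add: a_def)
      also have "\<dots> \<le> ennreal l * resolvent l (\<lambda>z. b z + p z) y"
        by (intro mult_left_mono resolvent_mono a_le) auto
      also have "\<dots> = ennreal l * resolvent l b y + ennreal l * resolvent l p y"
        by (simp add: resolvent_add distrib_left)
      also have "\<dots> \<le> b y + ennreal l * resolvent l p y"
        using lb[of y] unfolding b_def
        by (intro add_right_mono) (simp add: add.assoc[symmetric] add_increasing2)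
      finally show ?thesis
        unfolding p_def using a_fin[of y] by (auto simp: ennreal_minus_le_iff)
    qed (use p_on[of y] in \<open>auto simp: zero_less_iff_neq_zero\<close>)
    have small: "p x + resolvent (1 / real (Suc n)) g x \<le> resolvent 0 g x" if "1 / real (Suc n) \<le> l" for n
    proof -
      let ?m = "1 / real (Suc n)"
      have m: "ennreal ?m * resolvent ?m p x \<le> ennreal ?m * resolvent ?m (resolvent 0 g) x"
        by (intro mult_left_mono resolvent_mono p_le) auto
      also have le: "\<dots> \<le> resolvent 0 g x"
        by (rule potential_supermedian) auto
      finally have "ennreal ?m * resolvent ?m p x < \<infinity>"
        using fin[of x] by (rule order_le_less_trans)
      then have "resolvent ?m p x < \<infinity>"
        by (auto simp: ennreal_mult_less_top)
      then have "p x \<le> ennreal ?m * resolvent ?m p x"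
        by (intro subinvariant_smaller_rate[OF p_meas p_sub _ that]) simp_all
      with m have "p x \<le> ennreal ?m * resolvent ?m (resolvent 0 g) x" by simp
      then show ?thesis
        using potential_eq_resolvent[of g ?m x] by (simp add: add_left_mono add.commute)
    qed
    have "(\<lambda>n. 1 / real (Suc n)) \<longlonglongrightarrow> 0"
      by real_asymp
    then have "eventually (\<lambda>n. 1 / real (Suc n) < l) sequentially"
      using l(1) by (rule order_tendstoD)
    then have "eventually (\<lambda>n. p x + resolvent (1 / real (Suc n)) g x \<le> resolvent 0 g x) sequentially"
      by eventually_elim (rule small, rule less_imp_le)
    moreover have "(\<lambda>n. p x + resolvent (1 / real (Suc n)) g x) \<longlonglongrightarrow> p x + resolvent 0 g x"
      by (intro tendsto_intros resolvent_tendsto_potential) auto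
    ultimately have "p x + resolvent 0 g x \<le> resolvent 0 g x"
      by (intro tendsto_upperbound) auto
    then have "p x = 0"
      using fin[of x] by (metis add.commute add.right_neutral ennreal_add_left_cancel_le infinity_ennreal_def le_zero_eq less_irrefl)
    then have "a x \<le> b x" unfolding p_def using a_fin[of x] by (simp add: diff_eq_0_iff_ennreal)
    then have "resolvent 0 g x \<le> b x"
      unfolding a_def by (metis add.commute add_increasing2 order_trans order_refl zero_le add_increasing)
    then show ?thesis unfolding b_def by (simp add: add.assoc)
  qed
  have lim: "(\<lambda>n. 1 / real (Suc n)) \<longlonglongrightarrow> 0" "(\<lambda>n. C / real (Suc n)) \<longlonglongrightarrow> 0"
    by real_asymp+
  from order_tendstoD(2)[OF lim(2) \<open>0 < \<delta>\<close>]
  have "eventually (\<lambda>n. resolvent 0 g x \<le> c + resolvent 0 g' x + ennreal (1 / real (Suc n)) * g' x) sequentially"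
    by eventually_elim (rule key, simp_all)
  moreover have "(\<lambda>n. c + resolvent 0 g' x + g' x * ennreal (1 / real (Suc n))) \<longlonglongrightarrow> c + resolvent 0 g' x + g' x * ennreal 0"
    using g' lim by (intro tendsto_add tendsto_const ennreal_tendsto_cmult tendsto_ennrealI) auto
  ultimately have "resolvent 0 g x \<le> c + resolvent 0 g' x + g' x * ennreal 0"
    by (intro tendsto_lowerbound) (auto simp: mult.commute)
  then show ?thesis by simp
qed

text \<open>
  Formally \<open>U(l(\<phi> - l R\<^sub>l \<phi>)) = l R\<^sub>l \<phi>\<close> is the resolvent equation at rates \<open>0\<close> and \<open>l\<close>, but \<open>U\<phi>\<close>
  may be infinite. At a rate \<open>v > 0\<close> everything is finite and an extra term
  \<open>l v R\<^sub>v R\<^sub>l \<phi>\<close> appears, which tends to 0 with \<open>v\<close> because \<open>\<phi>\<close> lies below a finite potential.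
\<close>

lemma resolvent_of_dominated_is_potential:
  assumes [measurable]: "\<phi> \<in> borel_measurable borel" "h \<in> borel_measurable borel" and "0 < l"
    and sup: "\<And>x. ennreal l * resolvent l \<phi> x \<le> \<phi> x"
    and dom: "\<And>x. \<phi> x \<le> resolvent 0 h x" and fin: "\<And>x. resolvent 0 h x < \<infinity>"
  shows "resolvent 0 (\<lambda>x. ennreal l * (\<phi> x - ennreal l * resolvent l \<phi> x)) x = ennreal l * resolvent l \<phi> x"
proof -
  define g where "g y = ennreal l * (\<phi> y - ennreal l * resolvent l \<phi> y)" for y
  have [measurable]: "g \<in> borel_measurable borel" unfolding g_def by measurable
  let ?v = "\<lambda>n. 1 / real (Suc n)"
  let ?k = "\<lambda>n. ennreal l * (ennreal (?v n) * resolvent (?v n) (resolvent l \<phi>) x)"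
  have g: "g y + ennreal l * (ennreal l * resolvent l \<phi> y) = ennreal l * \<phi> y" for y
    unfolding g_def using sup[of y] by (simp add: distrib_left[symmetric] diff_add_cancel_ennreal)
  have eq: "resolvent (?v n) g x + ?k n = ennreal l * resolvent l \<phi> x" if "?v n \<le> l" for n
  proof -
    let ?q = "resolvent (?v n) (resolvent l \<phi>) x"
    have "ennreal (?v n) * (ennreal l * ?q) = ennreal (?v n) * resolvent (?v n) (\<lambda>y. ennreal l * resolvent l \<phi> y) x"
      by (simp add: resolvent_cmult)
    also have "\<dots> \<le> ennreal (?v n) * resolvent (?v n) (resolvent 0 h) x"
      by (intro mult_left_mono resolvent_mono order_trans[OF sup dom]) auto
    also have "\<dots> \<le> resolvent 0 h x"
      by (rule potential_supermedian) auto
    also have "\<dots> < \<infinity>" by (rule fin)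
    finally have q: "?q < \<infinity>"
      using \<open>0 < l\<close> by (auto simp: ennreal_mult_less_top)
    have "resolvent (?v n) g x + ennreal l * (ennreal l * ?q)
       = resolvent (?v n) (\<lambda>y. g y + ennreal l * (ennreal l * resolvent l \<phi> y)) x"
      by (simp add: resolvent_add resolvent_cmult)
    also have "\<dots> = ennreal l * resolvent (?v n) \<phi> x"
      unfolding g by (simp add: resolvent_cmult)
    also have "\<dots> = ennreal l * resolvent l \<phi> x + ennreal l * (ennreal (l - ?v n) * ?q)"
      by (subst resolvent_equation[OF _ that]) (auto simp: distrib_left)
    finally have *: "resolvent (?v n) g x + ennreal l * (ennreal l * ?q) =
      ennreal l * resolvent l \<phi> x + ennreal l * (ennreal (l - ?v n) * ?q)" .
    have "ennreal l = ennreal (?v n) + ennreal (l - ?v n)"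
      using that by (simp add: ennreal_plus[symmetric] del: ennreal_plus)
    then have "ennreal l * ?q = ennreal (?v n) * ?q + ennreal (l - ?v n) * ?q"
      by (metis distrib_right)
    then have "(resolvent (?v n) g x + ?k n) + ennreal l * (ennreal (l - ?v n) * ?q) =
      ennreal l * resolvent l \<phi> x + ennreal l * (ennreal (l - ?v n) * ?q)"
      using * by (simp add: distrib_left add.assoc)
    then show ?thesis
      using q by (metis (no_types, lifting) add.commute ennreal_add_left_cancel ennreal_mult_less_top ennreal_less_top infinity_ennreal_def less_irrefl)
  qed
  have lim0: "(\<lambda>n. ennreal (?v n) * resolvent (?v n) (resolvent 0 h) x) \<longlonglongrightarrow> 0"
    using fin by (intro resolvent_of_potential_vanishes) auto
  have k_le: "?k n \<le> ennreal (?v n) * resolvent (?v n) (resolvent 0 h) x" for n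
  proof -
    have "?k n = ennreal (?v n) * resolvent (?v n) (\<lambda>y. ennreal l * resolvent l \<phi> y) x"
      by (simp add: resolvent_cmult mult_ac)
    also have "\<dots> \<le> ennreal (?v n) * resolvent (?v n) (resolvent 0 h) x"
      by (intro mult_left_mono resolvent_mono order_trans[OF sup dom]) auto
    finally show ?thesis .
  qed
  have k0: "?k \<longlonglongrightarrow> 0"
    by (rule tendsto_sandwich[OF _ _ tendsto_const lim0]) (use k_le in auto)
  have "(\<lambda>n. resolvent (?v n) g x + ?k n) \<longlonglongrightarrow> resolvent 0 g x + 0"
    by (intro tendsto_add k0 resolvent_tendsto_potential) auto
  moreover have "eventually (\<lambda>n. resolvent (?v n) g x + ?k n = ennreal l * resolvent l \<phi> x) sequentially"
  proof -
    have "?v \<longlonglongrightarrow> 0" by real_asymp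
    from order_tendstoD(2)[OF this \<open>0 < l\<close>] show ?thesis
      by eventually_elim (rule eq, simp)
  qed
  ultimately have "(\<lambda>n::nat. ennreal l * resolvent l \<phi> x) \<longlonglongrightarrow> resolvent 0 g x + 0"
    by (rule Lim_transform_eventually)
  then have "resolvent 0 g x + 0 = ennreal l * resolvent l \<phi> x"
    by (simp only: LIMSEQ_const_iff)
  then show ?thesis unfolding g_def by simp
qed

text \<open>
  Truncate \<open>f\<close> to \<open>\<phi>\<^sub>k = min f (k Uh)\<close>, which increases to \<open>f\<close> since \<open>Uh > 0\<close>. Smoothing a
  truncation gives a potential \<open>l R\<^sub>l \<phi>\<^sub>k \<le> f\<close>, and \<open>l R\<^sub>l \<phi>\<^sub>k\<close> comes close to \<open>f\<close> on a finite set
  when first \<open>l\<close> and then \<open>k\<close> is taken large.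
\<close>

lemma excessive_approx_by_potentials:
  assumes [measurable]: "f \<in> borel_measurable borel" "h \<in> borel_measurable borel"
    and f_fin: "\<And>x. f x < \<infinity>"
    and sup: "\<And>l x. 0 < l \<Longrightarrow> ennreal l * resolvent l f x \<le> f x"
    and reg: "\<And>x. (\<lambda>n. ennreal (real (Suc n)) * resolvent (real (Suc n)) f x) \<longlonglongrightarrow> f x"
    and h: "\<And>x. 0 < resolvent 0 h x" "\<And>x. resolvent 0 h x < \<infinity>"
    and "finite T" "0 < \<eta>"
  obtains g where "g \<in> borel_measurable borel" "\<And>x. g x < \<infinity>"
    "\<And>x. resolvent 0 g x \<le> f x" "\<And>x. x \<in> T \<Longrightarrow> f x \<le> resolvent 0 g x + ennreal \<eta>"
proof -
  have "eventually (\<lambda>n. \<forall>x\<in>T. f x < ennreal (real (Suc n)) * resolvent (real (Suc n)) f x + ennreal \<eta>) sequentially"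
  proof (intro eventually_ball_finite \<open>finite T\<close> ballI)
    fix x
    have "(\<lambda>n. ennreal (real (Suc n)) * resolvent (real (Suc n)) f x + ennreal \<eta>) \<longlonglongrightarrow> f x + ennreal \<eta>"
      by (intro tendsto_intros reg)
    moreover have "f x < f x + ennreal \<eta>"
      using f_fin[of x] \<open>0 < \<eta>\<close> ennreal_add_left_cancel_less[of "f x" 0 "ennreal \<eta>"] by auto
    ultimately show "eventually (\<lambda>n. f x < ennreal (real (Suc n)) * resolvent (real (Suc n)) f x + ennreal \<eta>) sequentially"
      by (rule order_tendstoD)
  qed
  from eventually_happens'[OF sequentially_bot this] obtain n where
    n: "\<And>x. x \<in> T \<Longrightarrow> f x < ennreal (real (Suc n)) * resolvent (real (Suc n)) f x + ennreal \<eta>"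
    by blast
  define l where "l = real (Suc n)"
  have l: "0 < l" unfolding l_def by simp
  define \<phi> where "\<phi> k y = min (f y) (of_nat k * resolvent 0 h y)" for k y
  have [measurable]: "\<phi> k \<in> borel_measurable borel" for k unfolding \<phi>_def by measurable
  have inc: "incseq \<phi>"
    unfolding \<phi>_def by (intro monoI le_funI min.mono mult_right_mono) auto
  have "(SUP k. \<phi> k y) = f y" for y
  proof (rule antisym)
    show "f y \<le> (SUP k. \<phi> k y)"
    proof -
      have "(SUP k. of_nat k * resolvent 0 h y) = \<top>"
        using h(1)[of y] by (simp add: SUP_mult_right_ennreal[symmetric] ennreal_SUP_of_nat_eq_top ennreal_top_mult zero_less_iff_neq_zero)
      then obtain k where "f y < of_nat k * resolvent 0 h y"
        using f_fin[of y] by (metis infinity_ennreal_def less_SUP_iff)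
      then have "\<phi> k y = f y" unfolding \<phi>_def by simp
      then show ?thesis by (metis SUP_upper UNIV_I)
    qed
  qed (auto simp: \<phi>_def intro!: SUP_least)
  then have "resolvent l f x = (SUP k. resolvent l (\<phi> k) x)" for x
    using resolvent_SUP[of \<phi> l x] inc by simp
  moreover have "(\<lambda>k. resolvent l (\<phi> k) x) \<longlonglongrightarrow> (SUP k. resolvent l (\<phi> k) x)" for x
    using inc by (intro LIMSEQ_SUP) (auto simp: incseq_def le_fun_def intro: resolvent_mono)
  ultimately have lim: "(\<lambda>k. ennreal l * resolvent l (\<phi> k) x + ennreal \<eta>) \<longlonglongrightarrow> ennreal l * resolvent l f x + ennreal \<eta>" for x
    by (intro tendsto_intros ennreal_tendsto_cmult) auto
  have "eventually (\<lambda>k. \<forall>x\<in>T. f x < ennreal l * resolvent l (\<phi> k) x + ennreal \<eta>) sequentially"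
    using n by (intro eventually_ball_finite \<open>finite T\<close> ballI order_tendstoD(1)[OF lim]) (auto simp: l_def)
  from eventually_happens'[OF sequentially_bot this] obtain k where
    k: "\<And>x. x \<in> T \<Longrightarrow> f x < ennreal l * resolvent l (\<phi> k) x + ennreal \<eta>"
    by blast
  have nh: "resolvent 0 (\<lambda>y. of_nat k * h y) x = of_nat k * resolvent 0 h x" for x
    by (rule resolvent_cmult) auto
  have sup\<phi>: "ennreal l * resolvent l (\<phi> k) x \<le> \<phi> k x" for x
  proof -
    have "ennreal l * resolvent l (\<phi> k) x \<le> ennreal l * resolvent l f x"
      by (intro mult_left_mono resolvent_mono) (auto simp: \<phi>_def)
    moreover have "ennreal l * resolvent l (\<phi> k) x \<le> ennreal l * resolvent l (resolvent 0 (\<lambda>y. of_nat k * h y)) x"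
      by (intro mult_left_mono resolvent_mono) (auto simp: \<phi>_def nh)
    moreover have "ennreal l * resolvent l (resolvent 0 (\<lambda>y. of_nat k * h y)) x \<le> of_nat k * resolvent 0 h x"
      unfolding nh[symmetric] using l by (intro potential_supermedian) auto
    ultimately show ?thesis
      unfolding \<phi>_def using sup[OF l, of x] by auto
  qed
  have pot: "resolvent 0 (\<lambda>x. ennreal l * (\<phi> k x - ennreal l * resolvent l (\<phi> k) x)) x = ennreal l * resolvent l (\<phi> k) x" for x
  proof (rule resolvent_of_dominated_is_potential[OF _ _ l sup\<phi>])
    show "\<phi> k x \<le> resolvent 0 (\<lambda>y. of_nat k * h y) x" for x
      unfolding nh by (simp add: \<phi>_def)
    show "resolvent 0 (\<lambda>y. of_nat k * h y) x < \<infinity>" for x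
      unfolding nh using h(2)[of x] by (simp add: ennreal_mult_less_top of_nat_less_top)
  qed measurable
  show thesis
  proof (rule that[of "\<lambda>x. ennreal l * (\<phi> k x - ennreal l * resolvent l (\<phi> k) x)"])
    show "(\<lambda>x. ennreal l * (\<phi> k x - ennreal l * resolvent l (\<phi> k) x)) \<in> borel_measurable borel"
      by measurable
    show "ennreal l * (\<phi> k x - ennreal l * resolvent l (\<phi> k) x) < \<infinity>" for x
    proof -
      have "\<phi> k x - ennreal l * resolvent l (\<phi> k) x \<le> f x"
        using diff_le_self_ennreal[of "\<phi> k x"] by (rule order_trans) (simp add: \<phi>_def)
      then show ?thesis
        using f_fin[of x] by (auto simp: ennreal_mult_less_top intro: order_le_less_trans)
    qed
    show "resolvent 0 (\<lambda>x. ennreal l * (\<phi> k x - ennreal l * resolvent l (\<phi> k) x)) x \<le> f x" for x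
      unfolding pot using sup\<phi>[of x] by (simp add: \<phi>_def)
    show "f x \<le> resolvent 0 (\<lambda>x. ennreal l * (\<phi> k x - ennreal l * resolvent l (\<phi> k) x)) x + ennreal \<eta>"
      if "x \<in> T" for x
      unfolding pot using k[OF that] by simp
  qed
qed

end

section \<open>Domination at points for continuous potential densities\<close>

locale continuous_potential_density = submarkov_semigroup \<kappa>
  for \<kappa> :: "real \<Rightarrow> 'a::{t2_space, second_countable_topology} \<Rightarrow> 'a measure" +
  fixes m :: "'a measure" and u :: "'a \<Rightarrow> 'a \<Rightarrow> real"
  assumes locally_compact: "locally_compact_space (euclidean :: 'a topology)"
    and sigma_finite: "sigma_finite_measure m" and sets_m [measurable_cong]: "sets m = sets borel"
    and density: "\<And>g x. g \<in> borel_measurable borel \<Longrightarrow>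
      resolvent 0 g x = (\<integral>\<^sup>+y. ennreal (u x y) * g y \<partial>m)"
    and continuous: "continuous_on UNIV (\<lambda>(x, y). u x y)"
    and positive: "\<And>x y. 0 < u x y"
    and charges_open: "\<And>U. open U \<Longrightarrow> U \<noteq> {} \<Longrightarrow> 0 < emeasure m U"
begin

lemma density_measurable [measurable (raw)]:
  assumes [measurable]: "a \<in> M \<rightarrow>\<^sub>M borel" "b \<in> M \<rightarrow>\<^sub>M borel"
  shows "(\<lambda>z. u (a z) (b z)) \<in> borel_measurable M"
proof -
  have "(\<lambda>(x, y). u x y) \<in> borel_measurable (borel \<Otimes>\<^sub>M borel)"
    unfolding borel_prod by (rule borel_measurable_continuous_onI[OF continuous])
  from measurable_compose[OF measurable_Pair[OF assms] this] show ?thesis by simp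
qed

lemma density_tendsto:
  assumes "(a \<longlongrightarrow> x) F" "(b \<longlongrightarrow> y) F" shows "((\<lambda>z. u (a z) (b z)) \<longlongrightarrow> u x y) F"
  using continuous_on_tendsto_compose[OF continuous tendsto_Pair[OF assms]] by simp

text \<open>
  Fatou's lemma applied to \<open>u(x, y) g(y)\<close>, which is continuous in \<open>x\<close>. This is all the
  regularity of potentials that the transition from densities to points uses.
\<close>

lemma potential_lower_semicontinuous:
  assumes [measurable]: "g \<in> borel_measurable borel" and fin: "\<And>y. g y < \<infinity>"
    and less: "c < resolvent 0 g t"
  shows "eventually (\<lambda>x. c < resolvent 0 g x) (nhds t)"
unfolding eventually_nhds_iff_sequentially
proof (intro allI impI)
  fix s assume s: "s \<longlonglongrightarrow> t"
  have "(\<lambda>n. g y * ennreal (u (s n) y)) \<longlonglongrightarrow> g y * ennreal (u t y)" for y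
    using fin[of y] by (intro ennreal_tendsto_cmult tendsto_ennrealI density_tendsto s tendsto_const) auto
  then have "liminf (\<lambda>n. ennreal (u (s n) y) * g y) = ennreal (u t y) * g y" for y
    by (intro lim_imp_Liminf) (auto simp: mult.commute)
  then have "resolvent 0 g t = (\<integral>\<^sup>+y. liminf (\<lambda>n. ennreal (u (s n) y) * g y) \<partial>m)"
    by (simp add: density)
  also have "\<dots> \<le> liminf (\<lambda>n. \<integral>\<^sup>+y. ennreal (u (s n) y) * g y \<partial>m)"
    by (rule nn_integral_liminf) measurable
  also have "\<dots> = liminf (\<lambda>n. resolvent 0 g (s n))"
    by (simp add: density)
  finally show "eventually (\<lambda>n. c < resolvent 0 g (s n)) sequentially"
    using less by (intro less_LiminfD) (rule order_less_le_trans)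
qed

text \<open>
  The measure of \<open>U\<close> is positive but may be infinite, so the density is spread over a part of \<open>U\<close>
  of positive finite measure.
\<close>

lemma concentrated_density:
  assumes "open U" "t \<in> U"
  obtains \<psi> C where "\<psi> \<in> borel_measurable borel" "\<And>y. \<psi> y \<le> ennreal C" "0 \<le> C"
    "\<And>y. y \<notin> U \<Longrightarrow> \<psi> y = 0" "(\<integral>\<^sup>+y. \<psi> y \<partial>m) = 1"
proof -
  interpret sigma_finite_measure m by (rule sigma_finite)
  obtain A :: "nat \<Rightarrow> 'a set" where A: "range A \<subseteq> sets m" "(\<Union>i. A i) = space m" "\<And>i. emeasure m (A i) \<noteq> \<infinity>"
    using sigma_finite by metis
  have space: "space m = UNIV" using sets_eq_imp_space_eq[OF sets_m] by simp
  have U: "U \<in> sets m" using assms by (simp add: sets_m)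
  have "\<exists>i. 0 < emeasure m (A i \<inter> U)"
  proof (rule ccontr)
    assume "\<not> ?thesis"
    then have "A i \<inter> U \<in> null_sets m" for i
      using A(1) U by (auto simp: null_sets_def zero_less_iff_neq_zero)
    then have "(\<Union>i. A i \<inter> U) \<in> null_sets m" by blast
    moreover have "(\<Union>i. A i \<inter> U) = U" using A(2) space by auto
    ultimately have "emeasure m U = 0" by (metis null_setsD1)
    then show False using charges_open[OF assms(1)] assms(2) by auto
  qed
  then obtain i where i: "0 < emeasure m (A i \<inter> U)" by blast
  let ?B = "A i \<inter> U"
  have B: "?B \<in> sets m" using A(1) U by auto
  have "emeasure m ?B \<le> emeasure m (A i)" using A(1) by (intro emeasure_mono) auto
  then have fin: "emeasure m ?B \<noteq> \<infinity>" using A(3)[of i] by (auto simp: top_unique)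
  define r where "r = measure m ?B"
  have r: "emeasure m ?B = ennreal r" "0 < r"
    using fin i unfolding r_def by (auto simp: emeasure_eq_ennreal_measure measure_nonneg zero_less_measure_iff)
  have Bb: "?B \<in> sets borel" using B sets_m by simp
  show thesis
  proof (rule that[of "\<lambda>y. ennreal (1 / r) * indicator ?B y" "1 / r"])
    show "(\<lambda>y. ennreal (1 / r) * indicator ?B y) \<in> borel_measurable borel"
      using Bb by measurable
    show "(\<integral>\<^sup>+y. ennreal (1 / r) * indicator ?B y \<partial>m) = 1"
      using B r by (simp add: nn_integral_cmult_indicator ennreal_mult'[symmetric])
  qed (use r in \<open>auto split: split_indicator\<close>)
qed

lemma average_close:
  assumes \<psi>: "\<psi> \<in> borel_measurable borel" "(\<integral>\<^sup>+y. \<psi> y \<partial>m) = 1" "\<And>y. y \<notin> U \<Longrightarrow> \<psi> y = 0"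
    and close: "\<And>y. y \<in> U \<Longrightarrow> \<bar>u x y - v\<bar> \<le> \<eta>" and "0 \<le> v + \<eta>"
  shows "\<bar>enn2real (resolvent 0 \<psi> x) - v\<bar> \<le> \<eta>"
proof -
  note \<psi>(1)[measurable]
  have "resolvent 0 \<psi> x \<le> (\<integral>\<^sup>+y. ennreal (v + \<eta>) * \<psi> y \<partial>m)"
    unfolding density[OF \<psi>(1)]
  proof (intro nn_integral_mono)
    fix y show "ennreal (u x y) * \<psi> y \<le> ennreal (v + \<eta>) * \<psi> y"
      using close[of y] \<psi>(3)[of y] by (cases "y \<in> U") (auto intro!: mult_right_mono ennreal_leI)
  qed
  then have up: "resolvent 0 \<psi> x \<le> ennreal (v + \<eta>)"
    using \<psi>(2) by (simp add: nn_integral_cmult)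
  have "(\<integral>\<^sup>+y. ennreal (v - \<eta>) * \<psi> y \<partial>m) \<le> resolvent 0 \<psi> x"
    unfolding density[OF \<psi>(1)]
  proof (intro nn_integral_mono)
    fix y show "ennreal (v - \<eta>) * \<psi> y \<le> ennreal (u x y) * \<psi> y"
      using close[of y] \<psi>(3)[of y] by (cases "y \<in> U") (auto intro!: mult_right_mono ennreal_leI)
  qed
  then have lo: "ennreal (v - \<eta>) \<le> resolvent 0 \<psi> x"
    using \<psi>(2) by (simp add: nn_integral_cmult)
  obtain r where r: "resolvent 0 \<psi> x = ennreal r" "0 \<le> r"
    using up by (cases "resolvent 0 \<psi> x") (auto simp: top_unique)
  show ?thesis
    using up lo r assms(5) by (auto simp: ennreal_le_iff2 abs_le_iff)
qed

lemma average_finite: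
  assumes \<psi>: "\<psi> \<in> borel_measurable borel" "(\<integral>\<^sup>+y. \<psi> y \<partial>m) = 1" "\<And>y. y \<notin> U \<Longrightarrow> \<psi> y = 0"
    and U: "U \<subseteq> K" "compact K"
  shows "resolvent 0 \<psi> x < \<infinity>"
proof -
  note \<psi>(1)[measurable]
  have "continuous_on K (\<lambda>y. (x, y))"
    by (intro continuous_on_Pair continuous_on_const continuous_on_id)
  from continuous_on_compose2[OF continuous this] have "continuous_on K (u x)" by simp
  then have "bounded (u x ` K)"
    using U(2) by (intro compact_imp_bounded compact_continuous_image)
  then obtain C where C: "\<And>y. y \<in> K \<Longrightarrow> \<bar>u x y\<bar> \<le> C"
    unfolding bounded_iff by auto
  have "resolvent 0 \<psi> x \<le> (\<integral>\<^sup>+y. ennreal C * \<psi> y \<partial>m)"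
    unfolding density[OF \<psi>(1)]
  proof (intro nn_integral_mono)
    fix y show "ennreal (u x y) * \<psi> y \<le> ennreal C * \<psi> y"
      using C[of y] U(1) \<psi>(3)[of y] by (cases "y \<in> U") (auto intro!: mult_right_mono ennreal_leI)
  qed
  also have "\<dots> = ennreal C" using \<psi>(2) by (simp add: nn_integral_cmult)
  finally show ?thesis by (simp add: order_le_less_trans)
qed

text \<open>
  The neighbourhoods on which the discretization in \<open>point_domination\<close> takes place: on them \<open>u\<close>
  is almost constant and \<open>Ug\<close> almost bounded below by its values at the points \<open>t i\<close>, and the
  evaluation point \<open>x\<close> is taken into account as well. Each is contained in a compact set to keep
  the potentials of the concentrated densities finite.
\<close>

lemma controlled_neighbourhoods:
  fixes t :: "nat \<Rightarrow> 'a"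
  assumes g: "g \<in> borel_measurable borel" "\<And>y. g y < \<infinity>" "\<And>x. resolvent 0 g x < \<infinity>" and \<eta>: "0 < \<eta>"
  obtains U K where "\<And>i. i < n \<Longrightarrow> open (U i)" "\<And>i. i < n \<Longrightarrow> t i \<in> U i"
    "\<And>i. i < n \<Longrightarrow> U i \<subseteq> K i" "\<And>i. i < n \<Longrightarrow> compact (K i)"
    "\<And>i j y z. i < n \<Longrightarrow> j < n \<Longrightarrow> y \<in> U i \<Longrightarrow> z \<in> U j \<Longrightarrow> \<bar>u y z - u (t i) (t j)\<bar> \<le> \<eta>"
    "\<And>j z. j < n \<Longrightarrow> z \<in> U j \<Longrightarrow> \<bar>u x z - u x (t j)\<bar> \<le> \<eta>"
    "\<And>i y. i < n \<Longrightarrow> y \<in> U i \<Longrightarrow> enn2real (resolvent 0 g (t i)) - \<eta> \<le> enn2real (resolvent 0 g y)"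
proof -
  have "\<exists>Pi Pj. eventually Pi (nhds (t i)) \<and> eventually Pj (nhds (t j)) \<and>
      (\<forall>y z. Pi y \<longrightarrow> Pj z \<longrightarrow> \<bar>u y z - u (t i) (t j)\<bar> \<le> \<eta>)" for i j
  proof -
    have "((\<lambda>p. u (fst p) (snd p)) \<longlongrightarrow> u (t i) (t j)) (nhds (t i) \<times>\<^sub>F nhds (t j))"
      by (intro density_tendsto filterlim_fst filterlim_snd)
    from tendstoD[OF this \<eta>] show ?thesis
      unfolding eventually_prod_filter dist_real_def by (force intro: less_imp_le)
  qed
  then obtain P Q where PQ: "\<And>i j. eventually (P i j) (nhds (t i))" "\<And>i j. eventually (Q i j) (nhds (t j))"
    "\<And>i j y z. P i j y \<Longrightarrow> Q i j z \<Longrightarrow> \<bar>u y z - u (t i) (t j)\<bar> \<le> \<eta>"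
    by metis
  have ev_x: "eventually (\<lambda>z. \<bar>u x z - u x (t j)\<bar> \<le> \<eta>) (nhds (t j))" for j
  proof -
    have "((\<lambda>z. u x z) \<longlongrightarrow> u x (t j)) (nhds (t j))"
      by (intro density_tendsto tendsto_const filterlim_ident)
    from tendstoD[OF this \<eta>] show ?thesis
      unfolding dist_real_def by eventually_elim simp
  qed
  have ev_g: "eventually (\<lambda>y. enn2real (resolvent 0 g (t i)) - \<eta> \<le> enn2real (resolvent 0 g y)) (nhds (t i))" for i
  proof -
    let ?r = "enn2real (resolvent 0 g (t i))"
    show ?thesis
    proof (cases "?r - \<eta> < 0")
      case True
      have "?r - \<eta> \<le> enn2real (resolvent 0 g y)" for y
        using True enn2real_nonneg[of "resolvent 0 g y"] by linarith
      then show ?thesis by simp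
    next
      case False
      have "ennreal (?r - \<eta>) < ennreal ?r" using \<eta> False by (intro ennreal_lessI) auto
      also have "\<dots> = resolvent 0 g (t i)" using g(3)[of "t i"] by simp
      finally have "eventually (\<lambda>y. ennreal (?r - \<eta>) < resolvent 0 g y) (nhds (t i))"
        by (intro potential_lower_semicontinuous g)
      then show ?thesis
      proof eventually_elim
        case (elim y)
        then have "ennreal (?r - \<eta>) \<le> ennreal (enn2real (resolvent 0 g y))" using g(3)[of y] by simp
        then show ?case using ennreal_le_iff[OF enn2real_nonneg] by blast
      qed
    qed
  qed
  have "\<exists>K. compact K \<and> eventually (\<lambda>y. y \<in> K) (nhds (t i))" for i
  proof -
    from locally_compact obtain V K where "openin euclidean V" "compactin euclidean K" "t i \<in> V" "V \<subseteq> K"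
      unfolding locally_compact_space_def by (metis UNIV_I topspace_euclidean)
    then have "open V" "compact K" "t i \<in> V" "\<forall>y\<in>V. y \<in> K"
      by (auto simp only: open_openin compactin_euclidean_iff)
    then show ?thesis
      unfolding eventually_nhds by blast
  qed
  then obtain K where K: "\<And>i. compact (K i)" "\<And>i. eventually (\<lambda>y. y \<in> K i) (nhds (t i))" by metis
  have "eventually (\<lambda>y. y \<in> K i \<and> (\<forall>j\<in>{..<n}. P i j y) \<and> (\<forall>j\<in>{..<n}. Q j i y) \<and> \<bar>u x y - u x (t i)\<bar> \<le> \<eta> \<and>
     enn2real (resolvent 0 g (t i)) - \<eta> \<le> enn2real (resolvent 0 g y)) (nhds (t i))" for i
  proof -
    have "eventually (\<lambda>y. \<forall>j\<in>{..<n}. P i j y) (nhds (t i))"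
      by (rule eventually_ball_finite) (auto intro: PQ(1))
    moreover have "eventually (\<lambda>y. \<forall>j\<in>{..<n}. Q j i y) (nhds (t i))"
      by (rule eventually_ball_finite) (auto intro: PQ(2))
    ultimately show ?thesis
      using K(2)[of i] ev_x[of i] ev_g[of i] by eventually_elim (intro conjI)
  qed
  then have "\<forall>i. \<exists>U. open U \<and> t i \<in> U \<and> (\<forall>y\<in>U. y \<in> K i \<and> (\<forall>j\<in>{..<n}. P i j y) \<and> (\<forall>j\<in>{..<n}. Q j i y) \<and> \<bar>u x y - u x (t i)\<bar> \<le> \<eta> \<and>
     enn2real (resolvent 0 g (t i)) - \<eta> \<le> enn2real (resolvent 0 g y))"
    unfolding eventually_nhds by blast
  then obtain U where U: "\<And>i. open (U i)" "\<And>i. t i \<in> U i"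
    "\<And>i y. y \<in> U i \<Longrightarrow> y \<in> K i \<and> (\<forall>j\<in>{..<n}. P i j y) \<and> (\<forall>j\<in>{..<n}. Q j i y) \<and> \<bar>u x y - u x (t i)\<bar> \<le> \<eta> \<and>
     enn2real (resolvent 0 g (t i)) - \<eta> \<le> enn2real (resolvent 0 g y)"
    by metis
  show thesis
    by (rule that[of U K]) (use U K(1) PQ(3) in \<open>fastforce+\<close>)
qed

text \<open>
  The domination principle for signed point masses \<open>a\<^sub>i\<close> at the points \<open>t\<^sub>i\<close>: replace them by
  densities concentrated near these points, put the negative masses on the other side, and let
  the densities shrink. Continuity of \<open>u\<close> and lower semicontinuity of \<open>Ug\<close> turn the strict
  inequality at \<open>t\<^sub>i\<close> into one with a margin near \<open>t\<^sub>i\<close>.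
\<close>

lemma point_domination:
  fixes t a :: "nat \<Rightarrow> _"
  assumes g: "g \<in> borel_measurable borel" "\<And>y. g y < \<infinity>" "\<And>x. resolvent 0 g x < \<infinity>" and c: "0 \<le> c"
    and less: "\<And>i. i < n \<Longrightarrow> 0 < a i \<Longrightarrow> (\<Sum>j<n. u (t i) (t j) * a j) < c + enn2real (resolvent 0 g (t i))"
  shows "(\<Sum>j<n. u x (t j) * a j) \<le> c + enn2real (resolvent 0 g x)"
proof (rule field_le_epsilon)
  fix \<epsilon> :: real assume \<epsilon>: "0 < \<epsilon>"
  note g(1)[measurable]
  let ?G = "\<lambda>y. enn2real (resolvent 0 g y)"
  let ?I = "{i. i < n \<and> 0 < a i}"
  obtain \<gamma> where \<gamma>: "0 < \<gamma>" "\<And>i. i < n \<Longrightarrow> 0 < a i \<Longrightarrow> (\<Sum>j<n. u (t i) (t j) * a j) + \<gamma> \<le> c + ?G (t i)"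
  proof -
    define S where "S = insert 1 ((\<lambda>i. c + ?G (t i) - (\<Sum>j<n. u (t i) (t j) * a j)) ` ?I)"
    have S: "finite S" "S \<noteq> {}" unfolding S_def by auto
    show thesis
    proof (rule that[of "Min S"])
      show "0 < Min S" using S less unfolding S_def by (subst Min_gr_iff) auto
      fix i assume "i < n" "0 < a i"
      then have "Min S \<le> c + ?G (t i) - (\<Sum>j<n. u (t i) (t j) * a j)"
        using S unfolding S_def by (intro Min_le) auto
      then show "(\<Sum>j<n. u (t i) (t j) * a j) + Min S \<le> c + ?G (t i)" by simp
    qed
  qed
  define A where "A = (\<Sum>j<n. \<bar>a j\<bar>)"
  have A: "0 \<le> A" unfolding A_def by (intro sum_nonneg) auto
  \<comment> \<open>An error \<open>\<eta>\<close> in each entry of \<open>u\<close> and in \<open>Ug\<close> costs at most \<open>\<eta>(A + 1)\<close>, which must leave half of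
    the gap \<open>\<gamma>\<close> and stay below \<open>\<epsilon>\<close>.\<close>
  define \<eta> where "\<eta> = min (\<gamma> / (2 * (A + 1))) (\<epsilon> / (A + 1))"
  have \<eta>: "0 < \<eta>" "\<eta> * (A + 1) \<le> \<gamma> / 2" "\<eta> * (A + 1) \<le> \<epsilon>"
  proof -
    show "0 < \<eta>" using \<gamma>(1) \<epsilon> A unfolding \<eta>_def by simp
    have "\<eta> * (A + 1) \<le> \<gamma> / (2 * (A + 1)) * (A + 1)"
      using A unfolding \<eta>_def by (intro mult_right_mono) auto
    also have "\<dots> = \<gamma> / 2" using A by (simp add: field_simps)
    finally show "\<eta> * (A + 1) \<le> \<gamma> / 2" .
    have "\<eta> * (A + 1) \<le> \<epsilon> / (A + 1) * (A + 1)"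
      using A unfolding \<eta>_def by (intro mult_right_mono) auto
    also have "\<dots> = \<epsilon>" using A by simp
    finally show "\<eta> * (A + 1) \<le> \<epsilon>" .
  qed
  obtain U K where U: "\<And>i. i < n \<Longrightarrow> open (U i)" "\<And>i. i < n \<Longrightarrow> t i \<in> U i"
    "\<And>i. i < n \<Longrightarrow> U i \<subseteq> K i" "\<And>i. i < n \<Longrightarrow> compact (K i)"
    "\<And>i j y z. i < n \<Longrightarrow> j < n \<Longrightarrow> y \<in> U i \<Longrightarrow> z \<in> U j \<Longrightarrow> \<bar>u y z - u (t i) (t j)\<bar> \<le> \<eta>"
    "\<And>j z. j < n \<Longrightarrow> z \<in> U j \<Longrightarrow> \<bar>u x z - u x (t j)\<bar> \<le> \<eta>"
    "\<And>i y. i < n \<Longrightarrow> y \<in> U i \<Longrightarrow> ?G (t i) - \<eta> \<le> ?G y"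
    using controlled_neighbourhoods[OF g \<eta>(1), of n t x] by blast
  have "\<forall>j. \<exists>\<psi> C. j < n \<longrightarrow> \<psi> \<in> borel_measurable borel \<and> (\<forall>y. \<psi> y \<le> ennreal C) \<and> 0 \<le> C \<and>
      (\<forall>y. y \<notin> U j \<longrightarrow> \<psi> y = 0) \<and> (\<integral>\<^sup>+y. \<psi> y \<partial>m) = 1"
    by (metis concentrated_density U(1,2))
  then obtain \<psi> C where \<psi>: "\<And>j. j < n \<Longrightarrow> \<psi> j \<in> borel_measurable borel"
    "\<And>j y. j < n \<Longrightarrow> \<psi> j y \<le> ennreal (C j)" "\<And>j. j < n \<Longrightarrow> 0 \<le> C j"
    "\<And>j y. j < n \<Longrightarrow> y \<notin> U j \<Longrightarrow> \<psi> j y = 0" "\<And>j. j < n \<Longrightarrow> (\<integral>\<^sup>+y. \<psi> j y \<partial>m) = 1"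
    by metis
  define r where "r j y = enn2real (resolvent 0 (\<psi> j) y)" for j y
  have r: "resolvent 0 (\<psi> j) y = ennreal (r j y)" "0 \<le> r j y" if "j < n" for j y
    using average_finite[OF \<psi>(1,5)[OF that] \<psi>(4)[OF that] U(3,4)[OF that], of y] unfolding r_def by auto
  have r_close: "\<bar>r j y - u (t i) (t j)\<bar> \<le> \<eta>" if "i < n" "j < n" "y \<in> U i" for i j y
    unfolding r_def using that U(5) positive[of "t i" "t j"] \<eta>(1)
    by (intro average_close[OF \<psi>(1,5)[OF that(2)] \<psi>(4)[OF that(2)]]) auto
  have r_close_x: "\<bar>r j x - u x (t j)\<bar> \<le> \<eta>" if "j < n" for j
    unfolding r_def using that U(6) positive[of x "t j"] \<eta>(1)
    by (intro average_close[OF \<psi>(1,5)[OF that] \<psi>(4)[OF that]]) auto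
  have sum_close: "\<bar>(\<Sum>j<n. r' j * a j) - (\<Sum>j<n. v j * a j)\<bar> \<le> \<eta> * A"
    if "\<And>j. j < n \<Longrightarrow> \<bar>r' j - v j\<bar> \<le> \<eta>" for r' v :: "nat \<Rightarrow> real"
  proof -
    have "\<bar>(\<Sum>j<n. r' j * a j) - (\<Sum>j<n. v j * a j)\<bar> = \<bar>\<Sum>j<n. (r' j - v j) * a j\<bar>"
      by (simp add: sum_subtractf left_diff_distrib)
    also have "\<dots> \<le> (\<Sum>j<n. \<bar>r' j - v j\<bar> * \<bar>a j\<bar>)"
      by (rule order_trans[OF sum_abs]) (simp add: abs_mult)
    also have "\<dots> \<le> (\<Sum>j<n. \<eta> * \<bar>a j\<bar>)"
      using that by (intro sum_mono mult_right_mono) auto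
    finally show ?thesis unfolding A_def by (simp add: sum_distrib_left)
  qed
  define gp where "gp y = (\<Sum>j<n. ennreal (max 0 (a j)) * \<psi> j y)" for y
  define gm where "gm y = (\<Sum>j<n. ennreal (max 0 (- a j)) * \<psi> j y)" for y
  have [measurable]: "gp \<in> borel_measurable borel" "gm \<in> borel_measurable borel"
    unfolding gp_def gm_def using \<psi>(1)
    by (auto intro!: borel_measurable_sum borel_measurable_times_ennreal borel_measurable_const)
  have U_sum: "resolvent 0 (\<lambda>y. \<Sum>j<n. ennreal (b j) * \<psi> j y) y = ennreal (\<Sum>j<n. b j * r j y)"
    if b: "\<And>j. 0 \<le> b j" for b :: "nat \<Rightarrow> real" and y
  proof -
    have "resolvent 0 (\<lambda>y. \<Sum>j<n. ennreal (b j) * \<psi> j y) y = (\<Sum>j<n. ennreal (b j) * resolvent 0 (\<psi> j) y)"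
      by (rule resolvent_sum) (rule \<psi>(1))
    also have "\<dots> = (\<Sum>j<n. ennreal (b j * r j y))"
      by (intro sum.cong refl) (simp add: r ennreal_mult b)
    also have "\<dots> = ennreal (\<Sum>j<n. b j * r j y)"
      using b r by (intro sum_ennreal) auto
    finally show ?thesis .
  qed
  have Up: "resolvent 0 gp y = ennreal (\<Sum>j<n. max 0 (a j) * r j y)" for y
    unfolding gp_def by (rule U_sum) simp
  have Um: "resolvent 0 gm y = ennreal (\<Sum>j<n. max 0 (- a j) * r j y)" for y
    unfolding gm_def by (rule U_sum) simp
  have nnp: "0 \<le> (\<Sum>j<n. max 0 (a j) * r j y)" and nnm: "0 \<le> (\<Sum>j<n. max 0 (- a j) * r j y)" for y
    using r by (auto intro!: sum_nonneg mult_nonneg_nonneg)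
  have Ug: "resolvent 0 (\<lambda>y. g y + gm y) y = ennreal (?G y + (\<Sum>j<n. max 0 (- a j) * r j y))" for y
    using g(3)[of y] nnm[of y] by (simp add: resolvent_add Um)
  have split: "(\<Sum>j<n. max 0 (a j) * r j y) - (\<Sum>j<n. max 0 (- a j) * r j y) = (\<Sum>j<n. r j y * a j)" for y
    unfolding sum_subtractf[symmetric] by (intro sum.cong) (auto simp: max_def)
  have dom: "resolvent 0 gp x \<le> ennreal c + resolvent 0 (\<lambda>y. g y + gm y) x"
  proof (rule domination_principle[where C = "\<Sum>j<n. max 0 (a j) * C j" and \<delta> = "\<gamma> / 2"])
    show "resolvent 0 gp y < \<infinity>" for y unfolding Up by simp
    show "gp y \<le> ennreal (\<Sum>j<n. max 0 (a j) * C j)" for y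
    proof -
      have "gp y \<le> (\<Sum>j<n. ennreal (max 0 (a j)) * ennreal (C j))"
        unfolding gp_def using \<psi>(2) by (intro sum_mono mult_left_mono) auto
      also have "\<dots> = ennreal (\<Sum>j<n. max 0 (a j) * C j)"
        using \<psi>(3) by (subst sum_ennreal[symmetric]) (auto simp: ennreal_mult')
      finally show ?thesis .
    qed
    show "g x + gm x < \<infinity>"
    proof -
      have "gm x \<le> (\<Sum>j<n. ennreal (max 0 (- a j)) * ennreal (C j))"
        unfolding gm_def using \<psi>(2) by (intro sum_mono mult_left_mono) auto
      also have "\<dots> = ennreal (\<Sum>j<n. max 0 (- a j) * C j)"
        using \<psi>(3) by (subst sum_ennreal[symmetric]) (auto simp: ennreal_mult')
      also have "\<dots> < \<infinity>" by simp
      finally show ?thesis using g(2)[of x] by simp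
    qed
    fix y assume "0 < gp y"
    then obtain i where i: "i < n" "0 < ennreal (max 0 (a i)) * \<psi> i y"
      unfolding gp_def by (metis (no_types, lifting) lessThan_iff not_gr_zero sum.neutral)
    then have "0 < a i" by (cases "a i = 0") (auto simp: max_def split: if_splits)
    have "y \<in> U i"
      using i \<psi>(4)[of i y] by (cases "y \<in> U i") auto
    have "(\<Sum>j<n. r j y * a j) \<le> (\<Sum>j<n. u (t i) (t j) * a j) + \<eta> * A"
      using sum_close[of "\<lambda>j. r j y" "\<lambda>j. u (t i) (t j)"] r_close[OF i(1) _ \<open>y \<in> U i\<close>] by auto
    also have "\<dots> \<le> c + ?G (t i) - \<gamma> + \<eta> * A" using \<gamma>(2)[OF i(1) \<open>0 < a i\<close>] by simp
    also have "\<dots> \<le> c + ?G y - \<gamma> + \<eta> * (A + 1)" using U(7)[OF i(1) \<open>y \<in> U i\<close>] by (simp add: algebra_simps)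
    finally have "(\<Sum>j<n. r j y * a j) + \<gamma> / 2 \<le> c + ?G y" using \<eta>(2) by (simp add: field_simps)
    then have "(\<Sum>j<n. max 0 (a j) * r j y) + \<gamma> / 2 \<le> c + (?G y + (\<Sum>j<n. max 0 (- a j) * r j y))"
      using split[of y] by simp
    then have "ennreal ((\<Sum>j<n. max 0 (a j) * r j y) + \<gamma> / 2) \<le> ennreal (c + (?G y + (\<Sum>j<n. max 0 (- a j) * r j y)))"
      by (rule ennreal_leI)
    then show "resolvent 0 gp y + ennreal (\<gamma> / 2) \<le> ennreal c + resolvent 0 (\<lambda>y. g y + gm y) y"
      unfolding Up Ug using nnp[of y] nnm[of y] c \<gamma>(1) by (simp add: ennreal_plus del: sum_ennreal)
  qed (use \<gamma>(1) in auto)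
  then have "ennreal (\<Sum>j<n. max 0 (a j) * r j x) \<le> ennreal (c + (?G x + (\<Sum>j<n. max 0 (- a j) * r j x)))"
    unfolding Up Ug using nnm[of x] c by (subst ennreal_plus) auto
  then have "(\<Sum>j<n. max 0 (a j) * r j x) \<le> c + (?G x + (\<Sum>j<n. max 0 (- a j) * r j x))"
    using nnm[of x] c by (subst (asm) ennreal_le_iff) auto
  then have "(\<Sum>j<n. r j x * a j) \<le> c + ?G x" using split[of x] by simp
  moreover have "(\<Sum>j<n. u x (t j) * a j) \<le> (\<Sum>j<n. r j x * a j) + \<eta> * A"
    using sum_close[of "\<lambda>j. r j x" "\<lambda>j. u x (t j)"] r_close_x by auto
  moreover have "\<eta> * A \<le> \<epsilon>" using \<eta> by (simp add: distrib_left)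
  ultimately show "(\<Sum>j<n. u x (t j) * a j) \<le> c + ?G x + \<epsilon>" by simp
qed

end

section \<open>Domination and inverse M-matrices\<close>

lemma obtain_inverse_matrix:
  fixes M :: "nat \<Rightarrow> nat \<Rightarrow> real"
  assumes inj: "\<And>a. (\<And>i. i < n \<Longrightarrow> (\<Sum>j<n. M i j * a j) = 0) \<Longrightarrow> (\<And>i. i < n \<Longrightarrow> a i = 0)"
  obtains A where "\<And>i j. i < n \<Longrightarrow> j < n \<Longrightarrow> (\<Sum>k<n. M i k * A k j) = (if i = j then 1 else 0)"
    and "\<And>i j. i < n \<Longrightarrow> j < n \<Longrightarrow> (\<Sum>k<n. A i k * M k j) = (if i = j then 1 else (0::real))"
proof -
  define MM where "MM = Matrix.mat n n (\<lambda>(i, j). M i j)"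
  have MM: "MM \<in> carrier_mat n n" unfolding MM_def by auto
  have "Determinant.det MM \<noteq> 0"
  proof
    assume "Determinant.det MM = 0"
    then obtain v where v: "v \<in> carrier_vec n" "v \<noteq> 0\<^sub>v n" "MM *\<^sub>v v = 0\<^sub>v n"
      using det_0_iff_vec_prod_zero[OF MM] by auto
    have "(\<Sum>j<n. M i j * v $ j) = 0" if "i < n" for i
    proof -
      have "(MM *\<^sub>v v) $ i = 0" using v(3) that by simp
      then show ?thesis
        using that v(1) by (simp add: MM_def scalar_prod_def atLeast0LessThan)
    qed
    then have "v $ i = 0" if "i < n" for i
      using inj[of "\<lambda>i. v $ i"] that by auto
    then have "v = 0\<^sub>v n" using v(1) by (intro eq_vecI) auto
    with v(2) show False by simp
  qed
  from det_non_zero_imp_unit[OF MM this]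
  obtain A where A: "A \<in> carrier_mat n n" "A * MM = 1\<^sub>m n" "MM * A = 1\<^sub>m n"
    unfolding Units_def ring_mat_def by auto
  show thesis
  proof (rule that[of "\<lambda>i j. A $$ (i, j)"])
    fix i j assume ij: "i < n" "j < n"
    show "(\<Sum>k<n. M i k * A $$ (k, j)) = (if i = j then 1 else 0)"
      using arg_cong[OF A(3), of "\<lambda>B. B $$ (i, j)"] A(1) ij
      by (simp add: MM_def scalar_prod_def atLeast0LessThan)
    show "(\<Sum>k<n. A $$ (i, k) * M k j) = (if i = j then 1 else 0)"
      using arg_cong[OF A(2), of "\<lambda>B. B $$ (i, j)"] A(1) ij
      by (simp add: MM_def scalar_prod_def atLeast0LessThan)
  qed
qed

text \<open>
  The matrix form of the domination principle, relative to one vector \<open>v\<close>. Strict inequality in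
  the premise makes it stable under approximation and is no loss for the matrices \<open>W + \<epsilon>I\<close>, where
  \<open>\<epsilon>a\<^sub>i\<close> provides the strictness.
\<close>

definition dominates :: "nat \<Rightarrow> (nat \<Rightarrow> nat \<Rightarrow> real) \<Rightarrow> (nat \<Rightarrow> real) \<Rightarrow> bool"
  where "dominates n W v \<longleftrightarrow> (\<forall>a. (\<forall>i<n. 0 < a i \<longrightarrow> (\<Sum>j<n. W i j * a j) < v i) \<longrightarrow>
    (\<forall>i<n. (\<Sum>j<n. W i j * a j) \<le> v i))"

lemma dominatesD:
  assumes "dominates n W v" and "\<And>i. i < n \<Longrightarrow> 0 < a i \<Longrightarrow> (\<Sum>j<n. W i j * a j) < v i" and "i < n"
  shows "(\<Sum>j<n. W i j * a j) \<le> v i"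
  using assms unfolding dominates_def by blast

text \<open>
  With \<open>M = W + \<epsilon>I\<close>, a solution of \<open>Ma = v\<close> satisfies \<open>Wa = v - \<epsilon>a < v\<close> where \<open>a > 0\<close>; domination
  extends \<open>Wa \<le> v\<close> to all indices, and then \<open>\<epsilon>a = v - Wa \<ge> 0\<close>. For \<open>v = 0\<close> this gives
  invertibility, for \<open>v = 1\<close> and \<open>v = g\<close> the nonnegativity of \<open>e = A1\<close> and \<open>h = Ag\<close>. Applied to a
  negated column of \<open>A\<close>, the same argument gives the sign of the off-diagonal entries.
\<close>

lemma perturbed_inverse_M_matrix:
  fixes W :: "nat \<Rightarrow> nat \<Rightarrow> real" and g :: "nat \<Rightarrow> real"
  assumes sym: "\<And>i j. W i j = W j i" and \<epsilon>: "0 < \<epsilon>" and g_nonneg: "\<And>i. i < n \<Longrightarrow> 0 \<le> g i"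
    and dom0: "dominates n W (\<lambda>_. 0)" and dom1: "dominates n W (\<lambda>_. 1)" and domg: "dominates n W g"
  obtains B where
    "\<And>i j. i < n \<Longrightarrow> j < n \<Longrightarrow>
      (\<Sum>k<n. B i k * (W k j + (if k = j then \<epsilon> else 0) + g j)) = (if i = j then 1 else 0)"
    "\<And>i j. i < n \<Longrightarrow> j < n \<Longrightarrow> i \<noteq> j \<Longrightarrow> B i j \<le> (0::real)"
proof -
  define M where "M i j = W i j + (if i = j then \<epsilon> else 0)" for i j
  have M_sym: "M i j = M j i" for i j unfolding M_def using sym by auto
  have M_mult: "(\<Sum>j<n. M i j * a j) = (\<Sum>j<n. W i j * a j) + \<epsilon> * a i" if "i < n" for i a
  proof -
    have "(\<Sum>j<n. M i j * a j) = (\<Sum>j<n. W i j * a j + (if j = i then \<epsilon> * a i else 0))"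
      unfolding M_def by (intro sum.cong) (auto simp: distrib_right)
    then show ?thesis using that by (simp add: sum.distrib)
  qed
  have solve_nonneg: "0 \<le> a i" if dom: "dominates n W v" and eq: "\<And>i. i < n \<Longrightarrow> (\<Sum>j<n. M i j * a j) = v i" and "i < n" for a v i
  proof -
    have "(\<Sum>j<n. W i j * a j) = v i - \<epsilon> * a i" if "i < n" for i
      using eq[OF that] M_mult[OF that, of a] by simp
    then have "(\<Sum>j<n. W i j * a j) \<le> v i"
      using \<epsilon> by (intro dominatesD[OF dom _ \<open>i < n\<close>]) auto
    then have "0 \<le> \<epsilon> * a i"
      using eq[OF \<open>i < n\<close>] M_mult[OF \<open>i < n\<close>, of a] by linarith
    then show ?thesis using \<epsilon> by (simp add: zero_le_mult_iff)
  qed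
  have "a i = 0" if "\<And>i. i < n \<Longrightarrow> (\<Sum>j<n. M i j * a j) = 0" and "i < n" for a i
  proof (rule antisym)
    show "0 \<le> a i" using solve_nonneg[OF dom0, of a] that by auto
    have "0 \<le> - a i"
      using that by (intro solve_nonneg[OF dom0, of "\<lambda>i. - a i"]) (auto simp: sum_negf)
    then show "a i \<le> 0" by simp
  qed
  then obtain A where MA: "\<And>i j. i < n \<Longrightarrow> j < n \<Longrightarrow> (\<Sum>k<n. M i k * A k j) = (if i = j then 1 else 0)"
    and AM: "\<And>i j. i < n \<Longrightarrow> j < n \<Longrightarrow> (\<Sum>k<n. A i k * M k j) = (if i = j then 1 else (0::real))"
    by (rule obtain_inverse_matrix[of n M]) blast+
  \<comment> \<open>The ingredients \<open>A1\<close>, \<open>Ag\<close> and \<open>g\<^sup>TA1\<close> of the rank-one formula.\<close>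
  define e where "e i = (\<Sum>j<n. A i j)" for i
  define h where "h i = (\<Sum>j<n. A i j * g j)" for i
  define q where "q = (\<Sum>k<n. g k * e k)"
  have Mh: "(\<Sum>k<n. M i k * (\<Sum>j<n. A k j * v j)) = v i" if "i < n" for i v
  proof -
    have "(\<Sum>k<n. M i k * (\<Sum>j<n. A k j * v j)) = (\<Sum>k<n. \<Sum>j<n. M i k * A k j * v j)"
      by (simp add: sum_distrib_left mult.assoc)
    also have "\<dots> = (\<Sum>j<n. \<Sum>k<n. M i k * A k j * v j)" by (rule sum.swap)
    also have "\<dots> = (\<Sum>j<n. (if i = j then 1 else 0) * v j)"
      using MA that by (simp add: sum_distrib_right[symmetric])
    also have "\<dots> = v i" using that by (simp add: if_distrib[where f = "\<lambda>x. x * _"] sum.delta cong: if_cong)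
    finally show ?thesis .
  qed
  have e: "0 \<le> e i" if "i < n" for i
    using solve_nonneg[OF dom1, of e i] Mh[of _ "\<lambda>_. 1"] that unfolding e_def by simp
  have h: "0 \<le> h i" if "i < n" for i
    using solve_nonneg[OF domg, of h i] Mh[of _ g] that unfolding h_def by simp
  have q: "0 \<le> q" unfolding q_def using e g_nonneg by (intro sum_nonneg) auto
  have A_off: "A i k \<le> 0" if "i < n" "k < n" "i \<noteq> k" for i k
  proof -
    have *: "(\<Sum>j<n. W i j * - A j k) = \<epsilon> * A i k - (if i = k then 1 else 0)" if "i < n" for i
      using M_mult[OF that, of "\<lambda>j. A j k"] MA[OF that \<open>k < n\<close>] by (simp add: sum_negf)
    have "(\<Sum>j<n. W i j * - A j k) \<le> 0"
    proof (rule dominatesD[OF dom0 _ \<open>i < n\<close>])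
      fix l assume "l < n" "0 < - A l k"
      then show "(\<Sum>j<n. W l j * - A j k) < 0"
        unfolding *[OF \<open>l < n\<close>] using \<epsilon> mult_pos_neg[of \<epsilon> "A l k"] by (auto)
    qed
    then show ?thesis unfolding *[OF \<open>i < n\<close>] using that \<epsilon> by (simp add: mult_le_0_iff)
  qed
  have A_sym: "A i j = A j i" if "i < n" "j < n" for i j
  proof -
    have "A i j = (\<Sum>k<n. A i k * (if k = j then 1 else 0))"
      using that by (simp add: if_distrib[where f = "\<lambda>x. _ * x"] sum.delta cong: if_cong)
    also have "\<dots> = (\<Sum>k<n. A i k * (\<Sum>l<n. A j l * M l k))"
      using AM[OF \<open>j < n\<close>] by (intro sum.cong) auto
    also have "\<dots> = (\<Sum>k<n. \<Sum>l<n. A j l * (A i k * M k l))"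
      by (simp add: sum_distrib_left mult_ac M_sym)
    also have "\<dots> = (\<Sum>l<n. A j l * (\<Sum>k<n. A i k * M k l))"
      by (subst sum.swap) (simp add: sum_distrib_left)
    also have "\<dots> = (\<Sum>l<n. A j l * (if i = l then 1 else 0))"
      using AM[OF \<open>i < n\<close>] by (intro sum.cong) auto
    also have "\<dots> = A j i"
      using that by (simp add: if_distrib[where f = "\<lambda>x. _ * x"] sum.delta cong: if_cong)
    finally show ?thesis .
  qed
  have hM: "(\<Sum>k<n. h k * M k j) = g j" if "j < n" for j
    using Mh[OF that, of g] unfolding h_def by (simp add: mult.commute M_sym)
  have h_sum: "(\<Sum>k<n. h k) = q"
  proof -
    have "(\<Sum>k<n. h k) = (\<Sum>k<n. \<Sum>j<n. A j k * g j)"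
      unfolding h_def using A_sym by (intro sum.cong) auto
    also have "\<dots> = (\<Sum>j<n. \<Sum>k<n. A j k * g j)" by (rule sum.swap)
    also have "\<dots> = q" unfolding q_def e_def by (simp add: sum_distrib_left mult.commute)
    finally show ?thesis .
  qed
  show thesis
  proof (rule that[of "\<lambda>i j. A i j - e i * h j / (1 + q)"])
    fix i j assume ij: "i < n" "j < n"
    define r where "r = e i / (1 + q)"
    have "r * (1 + q) = e i" unfolding r_def using q by simp
    then have r: "e i = r + q * r" by (simp add: algebra_simps)
    have "(\<Sum>k<n. (A i k - e i * h k / (1 + q)) * (W k j + (if k = j then \<epsilon> else 0) + g j))
      = (\<Sum>k<n. A i k * M k j + A i k * g j - r * (h k * M k j) - (r * g j) * h k)"
      unfolding M_def r_def by (intro sum.cong) (auto simp: algebra_simps add_divide_distrib)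
    also have "\<dots> = (\<Sum>k<n. A i k * M k j) + (\<Sum>k<n. A i k) * g j - r * (\<Sum>k<n. h k * M k j) - r * g j * (\<Sum>k<n. h k)"
      by (simp only: sum.distrib sum_subtractf sum_distrib_left sum_distrib_right)
    also have "\<dots> = (if i = j then 1 else 0) + e i * g j - r * g j - r * g j * q"
      using AM[OF ij] hM[OF ij(2)] h_sum by (simp add: e_def)
    also have "\<dots> = (if i = j then 1 else 0)"
      unfolding r by (simp add: algebra_simps)
    finally show "(\<Sum>k<n. (A i k - e i * h k / (1 + q)) * (W k j + (if k = j then \<epsilon> else 0) + g j))
      = (if i = j then 1 else 0)" .
    assume "i \<noteq> j"
    moreover have "0 \<le> e i * h j / (1 + q)" using e h q ij by simp
    ultimately show "A i j - e i * h j / (1 + q) \<le> 0" using A_off[OF ij] by simp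
  qed
qed

section \<open>Laplace transforms of gamma mixtures\<close>

text \<open>
  One step of Gaussian elimination.
\<close>

lemma det_schur_pivot:
  fixes h :: "nat \<Rightarrow> nat \<Rightarrow> real"
  assumes "h 0 0 \<noteq> 0"
  shows "Determinant.det (Matrix.mat (Suc n) (Suc n) (\<lambda>(i, j). h i j)) =
    h 0 0 * Determinant.det (Matrix.mat n n (\<lambda>(i, j). h (Suc i) (Suc j) - h (Suc i) 0 * h 0 (Suc j) / h 0 0))"
proof -
  define C where "C = Matrix.mat n (Suc 0) (\<lambda>(i, j::nat). h (Suc i) 0 / h 0 0)"
  define P where "P = Matrix.mat (Suc 0) (Suc 0) (\<lambda>(i::nat, j::nat). h 0 0)"
  define R where "R = Matrix.mat (Suc 0) n (\<lambda>(i::nat, j). h 0 (Suc j))"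
  define S where "S = Matrix.mat n n (\<lambda>(i, j). h (Suc i) (Suc j) - h (Suc i) 0 * h 0 (Suc j) / h 0 0)"
  have carriers [simp]: "C \<in> carrier_mat n (Suc 0)" "P \<in> carrier_mat (Suc 0) (Suc 0)" "R \<in> carrier_mat (Suc 0) n" "S \<in> carrier_mat n n"
    unfolding C_def P_def R_def S_def by auto
  have "Matrix.mat (Suc n) (Suc n) (\<lambda>(i, j). h i j) = four_block_mat P R (C * P) (C * R + S)"
  proof (rule eq_matI)
    fix i j assume "i < dim_row (four_block_mat P R (C * P) (C * R + S))"
      and "j < dim_col (four_block_mat P R (C * P) (C * R + S))"
    then show "Matrix.mat (Suc n) (Suc n) (\<lambda>(i, j). h i j) $$ (i, j) = 
      four_block_mat P R (C * P) (C * R + S) $$ (i, j)"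
      using assms by (cases i; cases j)
        (auto simp: C_def P_def R_def S_def scalar_prod_def)
  qed (auto simp: C_def P_def R_def S_def)
  also have "\<dots> = four_block_mat (1\<^sub>m (Suc 0)) (0\<^sub>m (Suc 0) n) C (1\<^sub>m n) * four_block_mat P R (0\<^sub>m n (Suc 0)) S"
    by (subst mult_four_block_mat[where ?n1.0 = "Suc 0" and ?n2.0 = n and ?nr1.0 = "Suc 0" and ?nr2.0 = n and ?nc1.0 = "Suc 0" and ?nc2.0 = n])
      (simp_all add: left_mult_one_mat[OF carriers(2)] left_mult_one_mat[OF carriers(3)] left_mult_one_mat[OF carriers(4)]
        left_mult_zero_mat[OF carriers(4)] right_add_zero_mat[OF carriers(2)] right_add_zero_mat[OF carriers(3)]
        right_add_zero_mat[OF mult_carrier_mat[OF carriers(1,2)]])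
  also have "Determinant.det \<dots> = Determinant.det (four_block_mat (1\<^sub>m (Suc 0)) (0\<^sub>m (Suc 0) n) C (1\<^sub>m n)) *
     Determinant.det (four_block_mat P R (0\<^sub>m n (Suc 0)) S)"
    by (rule det_mult[where n = "Suc 0 + n"]; rule four_block_carrier_mat) auto
  also have "Determinant.det (four_block_mat (1\<^sub>m (Suc 0)) (0\<^sub>m (Suc 0) n) C (1\<^sub>m n)) = (1 :: real)"
    by (subst det_four_block_mat_upper_right_zero[where n = "Suc 0" and m = n]) auto
  also have "Determinant.det (four_block_mat P R (0\<^sub>m n (Suc 0)) S) = Determinant.det P * Determinant.det S"
    by (rule det_four_block_mat_lower_left_zero[where n = "Suc 0" and m = n]) auto
  also have "Determinant.det P = h 0 0"
    by (subst det_single) (auto simp: P_def)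
  finally show ?thesis unfolding S_def by simp
qed

text \<open>
  Sylvester's identity: the two sides are the determinants of two block triangular
  factorizations of the same matrix.
\<close>

lemma det_one_plus_mult_commute:
  fixes A B :: "real mat"
  assumes A: "A \<in> carrier_mat n m" and B: "B \<in> carrier_mat m n"
  shows "Determinant.det (1\<^sub>m n + A * B) = Determinant.det (1\<^sub>m m + B * A)"
proof -
  let ?L = "four_block_mat (1\<^sub>m n) (0\<^sub>m n m) B (1\<^sub>m m)"
  have detL: "Determinant.det ?L = 1"
    using A B by (subst det_four_block_mat_upper_right_zero[where n = n and m = m]) auto
  have L: "?L \<in> carrier_mat (n + m) (n + m)" using B by (intro four_block_carrier_mat) auto
  have "?L * four_block_mat (1\<^sub>m n) (- A) (0\<^sub>m m n) (1\<^sub>m m + B * A) = four_block_mat (1\<^sub>m n) (- A) B (1\<^sub>m m)"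
    using A B by (subst mult_four_block_mat[where ?n1.0 = n and ?n2.0 = m and ?nr1.0 = n and ?nr2.0 = m and ?nc1.0 = n and ?nc2.0 = m])
      (auto intro!: arg_cong2[where f = "four_block_mat (1\<^sub>m n) (- A)"] eq_matI)
  moreover have "four_block_mat (1\<^sub>m n + A * B) (- A) (0\<^sub>m m n) (1\<^sub>m m) * ?L = four_block_mat (1\<^sub>m n) (- A) B (1\<^sub>m m)"
  proof -
    have "1\<^sub>m n + A * B + - A * B = 1\<^sub>m n"
      using A B by (intro eq_matI) auto
    then show ?thesis
      using A B by (subst mult_four_block_mat[where ?n1.0 = n and ?n2.0 = m and ?nr1.0 = n and ?nr2.0 = m and ?nc1.0 = n and ?nc2.0 = m])
        (auto)
  qed
  ultimately have eq: "?L * four_block_mat (1\<^sub>m n) (- A) (0\<^sub>m m n) (1\<^sub>m m + B * A) = 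
    four_block_mat (1\<^sub>m n + A * B) (- A) (0\<^sub>m m n) (1\<^sub>m m) * ?L" by simp
  have "Determinant.det (?L * four_block_mat (1\<^sub>m n) (- A) (0\<^sub>m m n) (1\<^sub>m m + B * A)) = 
     Determinant.det (1\<^sub>m m + B * A)"
    using A B L by (subst det_mult[where n = "n + m"]) (auto simp: detL intro!: four_block_carrier_mat
      trans[OF det_four_block_mat_lower_left_zero[where n = n and m = m]])
  moreover have "Determinant.det (four_block_mat (1\<^sub>m n + A * B) (- A) (0\<^sub>m m n) (1\<^sub>m m) * ?L) = 
     Determinant.det (1\<^sub>m n + A * B)"
    using A B L by (subst det_mult[where n = "n + m"]) (auto simp: detL intro!: four_block_carrier_mat
      trans[OF det_four_block_mat_lower_left_zero[where n = n and m = m]])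
  ultimately show ?thesis using eq by simp
qed

lemma nn_integral_gamma_density:
  fixes b c :: real
  assumes "0 < b" "0 < c"
  shows "(\<integral>\<^sup>+x. ennreal (indicator {0..} x * x powr (b - 1) / Gamma b) * ennreal (exp (- c * x)) \<partial>lborel)
    = ennreal ((1 / c) powr b)"
proof -
  have Gamma_neq: "Gamma b \<noteq> 0" using Gamma_real_pos[OF assms(1)] by simp
  have "(\<integral>\<^sup>+x. ennreal (indicator {0..} x * x powr (b - 1) / Gamma b) * ennreal (exp (- c * x)) \<partial>lborel)
    = ennreal (1 / c) * (\<integral>\<^sup>+x. ennreal (indicator {0..} (x / c) * (x / c) powr (b - 1) / Gamma b) * ennreal (exp (- c * (x / c))) \<partial>lborel)"
    using assms by (subst nn_integral_real_affine[where c = "1 / c" and t = 0]) auto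
  also have "\<dots> = ennreal (1 / c) * (\<integral>\<^sup>+x. ennreal ((1 / c) powr (b - 1) / Gamma b) * ennreal (indicator {0..} x * x powr (b - 1) / exp x) \<partial>lborel)"
    using assms
    by (intro arg_cong[where f = "(*) (ennreal (1 / c))"] nn_integral_cong)
      (auto split: split_indicator simp: ennreal_mult'[symmetric] Gamma_real_pos Gamma_neq powr_divide exp_minus field_simps)
  also have "\<dots> = ennreal (1 / c) * (ennreal ((1 / c) powr (b - 1) / Gamma b) * ennreal (Gamma b))"
    using Gamma_conv_nn_integral_real[OF assms(1)] by (subst nn_integral_cmult) auto
  also have "\<dots> = ennreal (1 / c * ((1 / c) powr (b - 1)))"
    using assms Gamma_neq by (simp add: ennreal_mult'[symmetric] Gamma_real_pos less_imp_le)
  also have "1 / c * ((1 / c) powr (b - 1)) = (1 / c) powr b"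
    using assms by (simp add: powr_diff)
  finally show ?thesis .
qed

text \<open>
  Only the shape parameters of the gamma variables vary in a mixture: their rates are \<open>d\<^sub>i\<close>, and all
  shapes are at least \<open>\<alpha>\<close>, so that the gamma densities exist.
\<close>

locale gamma_mixtures =
  fixes N :: nat and \<alpha> :: real and d :: "nat \<Rightarrow> real"
  assumes \<alpha>: "0 < \<alpha>" and d: "\<And>i. i < N \<Longrightarrow> 0 < d i"
begin

definition orthant :: "(nat \<Rightarrow> real) set"
  where "orthant = {s. \<forall>i<N. 0 \<le> s i}"

definition laplace :: "((nat \<Rightarrow> real) \<Rightarrow> ennreal) \<Rightarrow> (nat \<Rightarrow> real) \<Rightarrow> ennreal"
  where "laplace p s = (\<integral>\<^sup>+x. p x * ennreal (exp (- (\<Sum>i<N. s i * x i))) \<partial>(\<Pi>\<^sub>M i\<in>{..<N}. lborel))"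

text \<open>
  Densities with respect to Lebesgue measure stand in for measures because they can be added and
  summed pointwise.
\<close>

definition is_laplace :: "((nat \<Rightarrow> real) \<Rightarrow> real) \<Rightarrow> bool"
  where "is_laplace \<phi> \<longleftrightarrow> (\<exists>p\<in>borel_measurable (\<Pi>\<^sub>M i\<in>{..<N}. lborel).
    (\<forall>x. p x \<noteq> 0 \<longrightarrow> x \<in> orthant) \<and> (\<forall>s\<in>orthant. ennreal (\<phi> s) = laplace p s))"

text \<open>
  A function with this property stands for a power series in the numbers \<open>1 / (d\<^sub>i + s\<^sub>i)\<close> with
  nonnegative coefficients. Quantifying over all shapes \<open>b\<close> builds multiplication by a single
  \<open>1 / (d\<^sub>i + s\<^sub>i)\<close> into the definition, as it only shifts \<open>b\<^sub>i\<close> by one.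
\<close>

definition mixture :: "((nat \<Rightarrow> real) \<Rightarrow> real) \<Rightarrow> bool"
  where "mixture \<psi> \<longleftrightarrow> (\<forall>s\<in>orthant. 0 \<le> \<psi> s) \<and>
    (\<forall>b. (\<forall>i<N. \<alpha> \<le> b i) \<longrightarrow> is_laplace (\<lambda>s. \<psi> s * (\<Prod>i<N. (1 / (d i + s i)) powr b i)))"

text \<open>
  Nonnegative power series are closed under products, but convolving the densities in
  \<open>mixture\<close> would be laborious. For multipliers, products are compositions and cost nothing.
\<close>

definition multiplier :: "((nat \<Rightarrow> real) \<Rightarrow> real) \<Rightarrow> bool"
  where "multiplier \<phi> \<longleftrightarrow> (\<forall>s\<in>orthant. 0 \<le> \<phi> s) \<and> (\<forall>\<psi>. mixture \<psi> \<longrightarrow> mixture (\<lambda>s. \<phi> s * \<psi> s))"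

lemma component_measurable:
  "i < N \<Longrightarrow> (\<lambda>x. x i) \<in> borel_measurable (\<Pi>\<^sub>M i\<in>{..<N}. lborel :: real measure)"
  using measurable_component_singleton[of i "{..<N}" "\<lambda>_. lborel :: real measure"] by simp

lemma exp_measurable [measurable]:
  fixes s :: "nat \<Rightarrow> real"
  shows "(\<lambda>x. exp (- (\<Sum>i<N. s i * x i))) \<in> borel_measurable (\<Pi>\<^sub>M i\<in>{..<N}. lborel)"
proof -
  have "(\<lambda>x. - (\<Sum>i<N. s i * x i)) \<in> borel_measurable (\<Pi>\<^sub>M i\<in>{..<N}. lborel)"
    by (intro borel_measurable_uminus borel_measurable_sum borel_measurable_times
        borel_measurable_const component_measurable) auto
  from measurable_compose[OF this borel_measurable_exp] show ?thesis .
qed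

lemma is_laplace_cong:
  "(\<And>s. s \<in> orthant \<Longrightarrow> \<phi> s = \<psi> s) \<Longrightarrow> is_laplace \<phi> \<longleftrightarrow> is_laplace \<psi>"
  unfolding is_laplace_def by (intro bex_cong refl conj_cong ball_cong) auto

lemma is_laplace_sums:
  assumes "\<And>n. is_laplace (\<phi> n)" and "\<And>n s. s \<in> orthant \<Longrightarrow> 0 \<le> \<phi> n s"
    and "\<And>s. s \<in> orthant \<Longrightarrow> (\<lambda>n::nat. \<phi> n s) sums \<psi> s"
  shows "is_laplace \<psi>"
proof -
  from assms(1) obtain p where p: "\<And>n. p n \<in> borel_measurable (\<Pi>\<^sub>M i\<in>{..<N}. lborel)"
    "\<And>n x. p n x \<noteq> 0 \<Longrightarrow> x \<in> orthant" "\<And>n s. s \<in> orthant \<Longrightarrow> ennreal (\<phi> n s) = laplace (p n) s"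
    unfolding is_laplace_def by metis
  note p(1)[measurable]
  have "ennreal (\<psi> s) = laplace (\<lambda>x. \<Sum>n. p n x) s" if s: "s \<in> orthant" for s
  proof -
    have "ennreal (\<psi> s) = (\<Sum>n. ennreal (\<phi> n s))"
      using assms(2,3)[OF s] by (simp add: suminf_ennreal2 sums_iff)
    also have "\<dots> = (\<Sum>n. laplace (p n) s)"
      using p(3)[OF s] by simp
    also have "\<dots> = laplace (\<lambda>x. \<Sum>n. p n x) s"
      unfolding laplace_def by (subst nn_integral_suminf[symmetric]) auto
    finally show ?thesis .
  qed
  moreover have "x \<in> orthant" if "(\<Sum>n. p n x) \<noteq> 0" for x
  proof (rule ccontr)
    assume "x \<notin> orthant"
    then have "p n x = 0" for n using p(2) by blast
    with that show False by simp
  qed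
  ultimately show ?thesis
    unfolding is_laplace_def by (intro bexI[of _ "\<lambda>x. \<Sum>n. p n x"]) auto
qed

lemma is_laplace_cmult:
  assumes "is_laplace \<phi>" "0 \<le> c" shows "is_laplace (\<lambda>s. c * \<phi> s)"
proof -
  from assms(1) obtain p where [measurable]: "p \<in> borel_measurable (\<Pi>\<^sub>M i\<in>{..<N}. lborel)"
    and p: "\<And>x. p x \<noteq> 0 \<Longrightarrow> x \<in> orthant" "\<And>s. s \<in> orthant \<Longrightarrow> ennreal (\<phi> s) = laplace p s"
    unfolding is_laplace_def by metis
  have "ennreal (c * \<phi> s) = laplace (\<lambda>x. ennreal c * p x) s" if "s \<in> orthant" for s
    using assms(2) p(2)[OF that] unfolding laplace_def
    by (simp add: ennreal_mult' mult.assoc nn_integral_cmult)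
  then show ?thesis
    unfolding is_laplace_def using p(1)
    by (intro bexI[of _ "\<lambda>x. ennreal c * p x"]) auto
qed

lemma mixture_nonneg: "mixture \<psi> \<Longrightarrow> s \<in> orthant \<Longrightarrow> 0 \<le> \<psi> s"
  unfolding mixture_def by auto

lemma multiplier_nonneg: "multiplier \<phi> \<Longrightarrow> s \<in> orthant \<Longrightarrow> 0 \<le> \<phi> s"
  unfolding multiplier_def by auto

lemma mixture_sums:
  assumes "\<And>n. mixture (\<phi> n)" and "\<And>s. s \<in> orthant \<Longrightarrow> (\<lambda>n::nat. \<phi> n s) sums \<psi> s"
  shows "mixture \<psi>"
  unfolding mixture_def
proof (intro conjI ballI allI impI)
  fix s assume "s \<in> orthant"
  then show "0 \<le> \<psi> s"
    using assms mixture_nonneg by (metis sums_iff suminf_nonneg)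
next
  fix b assume b: "\<forall>i<N. \<alpha> \<le> b i"
  have z: "0 \<le> (\<Prod>i<N. (1 / (d i + s i)) powr b i)" for s
    by (intro prod_nonneg) auto
  show "is_laplace (\<lambda>s. \<psi> s * (\<Prod>i<N. (1 / (d i + s i)) powr b i))"
  proof (rule is_laplace_sums)
    show "is_laplace (\<lambda>s. \<phi> n s * (\<Prod>i<N. (1 / (d i + s i)) powr b i))" for n
      using assms(1) b unfolding mixture_def by auto
    show "0 \<le> \<phi> n s * (\<Prod>i<N. (1 / (d i + s i)) powr b i)" if "s \<in> orthant" for n s
      using z[of s] mixture_nonneg[OF assms(1) that] by simp
    show "(\<lambda>n. \<phi> n s * (\<Prod>i<N. (1 / (d i + s i)) powr b i)) sums (\<psi> s * (\<Prod>i<N. (1 / (d i + s i)) powr b i))"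
      if "s \<in> orthant" for s
      by (intro sums_mult2 assms that)
  qed
qed

lemma multiplier_sums:
  assumes "\<And>n. multiplier (\<phi> n)" and "\<And>s. s \<in> orthant \<Longrightarrow> (\<lambda>n::nat. \<phi> n s) sums \<psi> s"
  shows "multiplier \<psi>"
  unfolding multiplier_def
proof (intro conjI ballI allI impI)
  fix s assume "s \<in> orthant"
  then show "0 \<le> \<psi> s"
    using assms multiplier_nonneg by (metis sums_iff suminf_nonneg)
next
  fix \<zeta> assume "mixture \<zeta>"
  then have "mixture (\<lambda>s. \<phi> n s * \<zeta> s)" for n
    using assms(1)[of n] unfolding multiplier_def by blast
  then show "mixture (\<lambda>s. \<psi> s * \<zeta> s)"
    by (rule mixture_sums) (rule sums_mult2[OF assms(2)])
qed

lemma multiplier_mult: "multiplier \<phi> \<Longrightarrow> multiplier \<psi> \<Longrightarrow> multiplier (\<lambda>s. \<phi> s * \<psi> s)"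
  unfolding multiplier_def by (auto simp: mult.assoc)

lemma multiplier_const:
  assumes "0 \<le> c" shows "multiplier (\<lambda>_. c)"
  unfolding multiplier_def mixture_def
  using assms by (auto simp: mult.assoc intro!: is_laplace_cmult)

lemma multiplier_power: "multiplier \<phi> \<Longrightarrow> multiplier (\<lambda>s. \<phi> s ^ n)"
  by (induction n) (auto intro: multiplier_const multiplier_mult)

lemma multiplier_add:
  assumes "multiplier \<phi>" "multiplier \<psi>" shows "multiplier (\<lambda>s. \<phi> s + \<psi> s)"
proof (rule multiplier_sums)
  show "multiplier (if n = 0 then \<phi> else if n = 1 then \<psi> else (\<lambda>_. 0))" for n :: nat
    using assms by (auto intro: multiplier_const)
  fix s
  have "(\<lambda>n::nat. (if n = 0 then \<phi> else if n = 1 then \<psi> else (\<lambda>_. 0)) s) sums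
     (\<Sum>n\<in>{0, 1::nat}. (if n = 0 then \<phi> else if n = 1 then \<psi> else (\<lambda>_. 0)) s)"
    by (rule sums_finite) auto
  then show "(\<lambda>n::nat. (if n = 0 then \<phi> else if n = 1 then \<psi> else (\<lambda>_. 0)) s) sums (\<phi> s + \<psi> s)"
    by simp
qed

lemma multiplier_coordinate:
  assumes i: "i < N" shows "multiplier (\<lambda>s. 1 / (d i + s i))"
  unfolding multiplier_def
proof (intro conjI ballI allI impI)
  fix s assume "s \<in> orthant"
  then show "0 \<le> 1 / (d i + s i)"
    using d[OF i] i by (auto simp: orthant_def)
next
  fix \<psi> assume psi: "mixture \<psi>"
  show "mixture (\<lambda>s. 1 / (d i + s i) * \<psi> s)"
    unfolding mixture_def
  proof (intro conjI ballI allI impI)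
    fix s assume "s \<in> orthant"
    then show "0 \<le> 1 / (d i + s i) * \<psi> s"
      using d[OF i] i mixture_nonneg[OF psi] by (auto simp: orthant_def)
  next
    fix b assume b: "\<forall>i<N. \<alpha> \<le> b i"
    let ?b = "b(i := b i + 1)"
    have "is_laplace (\<lambda>s. \<psi> s * (\<Prod>j<N. (1 / (d j + s j)) powr ?b j))"
      using psi b unfolding mixture_def by (auto simp: add_increasing2)
    also have "?this \<longleftrightarrow> is_laplace (\<lambda>s. 1 / (d i + s i) * \<psi> s * (\<Prod>j<N. (1 / (d j + s j)) powr b j))"
    proof (rule is_laplace_cong)
      fix s assume "s \<in> orthant"
      then have "0 < d i + s i"
        using d[OF i] i by (auto simp: orthant_def add_pos_nonneg)
      then have "(1 / (d i + s i)) powr ?b i = 1 / (d i + s i) * (1 / (d i + s i)) powr b i"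
        by (simp add: powr_add)
      then show "\<psi> s * (\<Prod>j<N. (1 / (d j + s j)) powr ?b j) =
         1 / (d i + s i) * \<psi> s * (\<Prod>j<N. (1 / (d j + s j)) powr b j)"
        using i by (simp add: prod.remove[where x = i and A = "{..<N}"] del: fun_upd_apply)
          (simp cong: prod.cong_simp)
    qed
    finally show "is_laplace (\<lambda>s. 1 / (d i + s i) * \<psi> s * (\<Prod>j<N. (1 / (d j + s j)) powr b j))" .
  qed
qed

text \<open>
  The base case: a product of independent gamma densities.
\<close>

lemma mixture_one: "mixture (\<lambda>_. 1)"
  unfolding mixture_def
proof (intro conjI ballI allI impI)
  fix b assume b: "\<forall>i<N. \<alpha> \<le> b i"
  define g where "g i x = ennreal (indicator {0..} x * x powr (b i - 1) / Gamma (b i)) * ennreal (exp (- d i * x))" for i x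
  define p where "p x = (\<Prod>i<N. g i (x i))" for x :: "nat \<Rightarrow> real"
  have [measurable]: "g i \<in> borel_measurable borel" for i unfolding g_def by measurable
  have "(\<lambda>x. g i (x i)) \<in> borel_measurable (\<Pi>\<^sub>M i\<in>{..<N}. lborel)" if "i < N" for i
    using measurable_compose[OF component_measurable[OF that], of "g i" borel] by simp
  then have "p \<in> borel_measurable (\<Pi>\<^sub>M i\<in>{..<N}. lborel)"
    unfolding p_def by (intro borel_measurable_prod_ennreal) auto
  moreover have "x \<in> orthant" if "p x \<noteq> 0" for x
  proof (rule ccontr)
    assume "x \<notin> orthant"
    then obtain i where i: "i < N" "x i < 0" unfolding orthant_def by force
    then have "g i (x i) = 0" unfolding g_def by simp
    then have "p x = 0" unfolding p_def using i by (intro prod_zero) auto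
    with that show False by simp
  qed
  moreover have "ennreal (1 * (\<Prod>i<N. (1 / (d i + s i)) powr b i)) = laplace p s" if s: "s \<in> orthant" for s
  proof -
    interpret product_sigma_finite "\<lambda>_::nat. lborel :: real measure" by standard
    have "laplace p s = (\<integral>\<^sup>+x. (\<Prod>i<N. g i (x i) * ennreal (exp (- (s i * x i)))) \<partial>(\<Pi>\<^sub>M i\<in>{..<N}. lborel))"
      unfolding laplace_def p_def
      by (auto simp: exp_sum sum_negf[symmetric] prod_ennreal[symmetric] prod.distrib intro!: nn_integral_cong)
    also have "\<dots> = (\<Prod>i<N. \<integral>\<^sup>+x. g i x * ennreal (exp (- (s i * x))) \<partial>lborel)"
      by (rule product_nn_integral_prod) auto
    also have "\<dots> = (\<Prod>i<N. ennreal ((1 / (d i + s i)) powr b i))"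
    proof (intro prod.cong refl)
      fix i assume "i \<in> {..<N}"
      then have i: "0 < d i + s i" "0 < b i"
        using d s b \<alpha> by (fastforce simp: orthant_def add_pos_nonneg)+
      have "(\<integral>\<^sup>+x. g i x * ennreal (exp (- (s i * x))) \<partial>lborel) =
        (\<integral>\<^sup>+x. ennreal (indicator {0..} x * x powr (b i - 1) / Gamma (b i)) * ennreal (exp (- (d i + s i) * x)) \<partial>lborel)"
      proof (rule nn_integral_cong)
        fix x :: real
        have "exp (- d i * x) * exp (- (s i * x)) = exp (- (d i + s i) * x)"
          by (simp add: exp_add[symmetric] algebra_simps)
        then have "ennreal (exp (- d i * x)) * ennreal (exp (- (s i * x))) = ennreal (exp (- (d i + s i) * x))"
          by (metis ennreal_mult' exp_ge_zero)
        then show "g i x * ennreal (exp (- (s i * x))) =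
          ennreal (indicator {0..} x * x powr (b i - 1) / Gamma (b i)) * ennreal (exp (- (d i + s i) * x))"
          unfolding g_def by (simp only: mult.assoc)
      qed
      then show "(\<integral>\<^sup>+x. g i x * ennreal (exp (- (s i * x))) \<partial>lborel) = ennreal ((1 / (d i + s i)) powr b i)"
        using nn_integral_gamma_density[OF i(2,1)] by simp
    qed
    finally show ?thesis by (simp add: prod_ennreal)
  qed
  ultimately show "is_laplace (\<lambda>s. 1 * (\<Prod>i<N. (1 / (d i + s i)) powr b i))"
    unfolding is_laplace_def by blast
qed auto

lemma multiplier_is_laplace:
  assumes "multiplier \<phi>"
  shows "is_laplace (\<lambda>s. (\<Prod>i<N. (1 / (d i + s i)) powr \<alpha>) * \<phi> s)"
proof -
  have "mixture (\<lambda>s. \<phi> s * 1)"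
    using assms mixture_one unfolding multiplier_def by blast
  then show ?thesis
    unfolding mixture_def by (auto simp: mult.commute dest!: spec[of _ "\<lambda>_. \<alpha>"])
qed

lemma multiplier_geometric:
  assumes "multiplier \<phi>" and lt: "\<And>s. s \<in> orthant \<Longrightarrow> \<phi> s < 1"
  shows "multiplier (\<lambda>s. 1 / (1 - \<phi> s))"
proof (rule multiplier_sums[where \<phi> = "\<lambda>n s. \<phi> s ^ n"])
  fix s assume s: "s \<in> orthant"
  show "(\<lambda>n. \<phi> s ^ n) sums (1 / (1 - \<phi> s))"
    using lt[OF s] multiplier_nonneg[OF assms(1) s] by (intro geometric_sums) auto
qed (rule multiplier_power[OF assms(1)])

text \<open>
  The coefficients \<open>\<alpha>(\<alpha> + 1)\<cdots>(\<alpha> + n - 1) / n!\<close> of \<open>(1 - w)\<^sup>-\<^sup>\<alpha>\<close> are positive; this is where every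
  exponent \<open>\<alpha> > 0\<close> becomes admissible.
\<close>

lemma multiplier_negative_binomial:
  assumes "multiplier \<phi>" and lt: "\<And>s. s \<in> orthant \<Longrightarrow> \<phi> s < 1"
  shows "multiplier (\<lambda>s. (1 - \<phi> s) powr (- \<alpha>))"
proof (rule multiplier_sums[where \<phi> = "\<lambda>n s. (pochhammer \<alpha> n / fact n) * \<phi> s ^ n"])
  show "multiplier (\<lambda>s. (pochhammer \<alpha> n / fact n) * \<phi> s ^ n)" for n
    using \<alpha> by (intro multiplier_mult multiplier_const multiplier_power assms) (auto intro!: divide_nonneg_nonneg less_imp_le[OF pochhammer_pos])
  fix s assume s: "s \<in> orthant"
  have "(\<lambda>n. ((- \<alpha>) gchoose n) * (- \<phi> s) ^ n) sums (1 + - \<phi> s) powr (- \<alpha>)"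
    using lt[OF s] multiplier_nonneg[OF assms(1) s] by (intro gen_binomial_real) auto
  moreover have "((- \<alpha>) gchoose n) * (- \<phi> s) ^ n = (pochhammer \<alpha> n / fact n) * \<phi> s ^ n" for n
    by (subst gbinomial_pochhammer, subst power_minus) (simp add: power_add[symmetric] mult.assoc[symmetric])
  ultimately show "(\<lambda>n. (pochhammer \<alpha> n / fact n) * \<phi> s ^ n) sums (1 - \<phi> s) powr (- \<alpha>)"
    by simp
qed

text \<open>
  Gaussian elimination on \<open>D - G\<close>. Eliminating the first coordinate with pivot
  \<open>p = D\<^sub>0 - G\<^sub>0\<^sub>0 = D\<^sub>0(1 - w)\<close> leaves \<open>D\<close> unchanged and replaces \<open>G\<^sub>i\<^sub>j\<close> by \<open>G\<^sub>i\<^sub>j + G\<^sub>i\<^sub>0 G\<^sub>0\<^sub>j / p\<close>, where \<open>1/p\<close>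
  is a geometric series in \<open>w\<close>; so the shape of the matrix is preserved, and the pivot contributes
  the factor \<open>p\<^sup>-\<^sup>\<alpha> = D\<^sub>0\<^sup>-\<^sup>\<alpha> (1 - w)\<^sup>-\<^sup>\<alpha>\<close>. The positive vector \<open>x\<close> with \<open>(D - G)x > 0\<close> survives the
  step and keeps all pivots positive.
\<close>

lemma det_powr_multiplier:
  assumes "\<And>i s. i < n \<Longrightarrow> s \<in> orthant \<Longrightarrow> 0 < D i s"
    and "\<And>i. i < n \<Longrightarrow> multiplier (\<lambda>s. 1 / D i s)"
    and "\<And>i j. i < n \<Longrightarrow> j < n \<Longrightarrow> multiplier (G i j)"
    and "\<And>i. i < n \<Longrightarrow> 0 < x i"
    and "\<And>i s. i < n \<Longrightarrow> s \<in> orthant \<Longrightarrow> (\<Sum>j<n. G i j s * x j) < D i s * x i"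
  shows "\<exists>\<phi>. multiplier \<phi> \<and> (\<forall>s\<in>orthant.
    0 < Determinant.det (Matrix.mat n n (\<lambda>(i, j). (if i = j then D i s else 0) - G i j s)) \<and>
    Determinant.det (Matrix.mat n n (\<lambda>(i, j). (if i = j then D i s else 0) - G i j s)) powr (- \<alpha>)
      = (\<Prod>i<n. (1 / D i s) powr \<alpha>) * \<phi> s)"
  using assms
proof (induction n arbitrary: D G x)
  case 0
  have "multiplier (\<lambda>_. 1)" by (rule multiplier_const) auto
  then show ?case by (intro exI[of _ "\<lambda>_. 1"]) auto
next
  case (Suc n)
  define p where "p s = D 0 s - G 0 0 s" for s
  define w where "w s = 1 / D 0 s * G 0 0 s" for s
  define G' where "G' i j s = G (Suc i) (Suc j) s + G (Suc i) 0 s * G 0 (Suc j) s * (1 / D 0 s * (1 / (1 - w s)))" for i j s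
  have G_nn: "0 \<le> G i j s" if "i < Suc n" "j < Suc n" "s \<in> orthant" for i j s
    using multiplier_nonneg[OF Suc.prems(3)] that by auto
  have p_pos: "0 < p s" if s: "s \<in> orthant" for s
  proof -
    have "0 \<le> (\<Sum>j<n. G 0 (Suc j) s * x (Suc j))"
      using Suc.prems(4) G_nn s by (intro sum_nonneg mult_nonneg_nonneg) (auto intro: less_imp_le)
    then have "G 0 0 s * x 0 < D 0 s * x 0"
      using Suc.prems(5)[of 0 s] s unfolding sum.lessThan_Suc_shift by auto
    then show ?thesis unfolding p_def using Suc.prems(4)[of 0] by (simp add: mult_less_cancel_right)
  qed
  have D0: "0 < D 0 s" if "s \<in> orthant" for s using Suc.prems(1) that by auto
  have p_w: "p s = D 0 s * (1 - w s)" if "s \<in> orthant" for s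
    unfolding p_def w_def using D0[OF that] by (simp add: field_simps)
  have w_lt: "w s < 1" if "s \<in> orthant" for s
    using p_pos[OF that] D0[OF that] unfolding p_w[OF that] by (simp add: zero_less_mult_iff)
  have w: "multiplier w"
    unfolding w_def by (intro multiplier_mult Suc.prems) auto
  have G': "multiplier (G' i j)" if "i < n" "j < n" for i j
    unfolding G'_def using that
    by (intro multiplier_add multiplier_mult multiplier_geometric w w_lt Suc.prems) auto
  have G'_eq: "G' i j s = G (Suc i) (Suc j) s + G (Suc i) 0 s * G 0 (Suc j) s / p s" if "s \<in> orthant" for i j s
    unfolding G'_def p_w[OF that] by simp
  have "(\<Sum>j<n. G' i j s * x (Suc j)) < D (Suc i) s * x (Suc i)" if i: "i < n" and s: "s \<in> orthant" for i s
  proof -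
    have *: "(\<Sum>j<n. G 0 (Suc j) s * x (Suc j)) \<le> p s * x 0"
      using Suc.prems(5)[of 0 s] s unfolding sum.lessThan_Suc_shift p_def by (auto simp: algebra_simps)
    have "(\<Sum>j<n. G' i j s * x (Suc j)) = (\<Sum>j<n. G (Suc i) (Suc j) s * x (Suc j)) +
       G (Suc i) 0 s / p s * (\<Sum>j<n. G 0 (Suc j) s * x (Suc j))"
      unfolding G'_eq[OF s] by (simp add: sum.distrib distrib_right sum_distrib_left mult.assoc)
    also have "\<dots> \<le> (\<Sum>j<n. G (Suc i) (Suc j) s * x (Suc j)) + G (Suc i) 0 s / p s * (p s * x 0)"
      using p_pos[OF s] G_nn[of "Suc i" 0 s] i s by (intro add_left_mono mult_left_mono *) auto
    also have "\<dots> = (\<Sum>j<Suc n. G (Suc i) j s * x j)"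
      unfolding sum.lessThan_Suc_shift using p_pos[OF s] by simp
    also have "\<dots> < D (Suc i) s * x (Suc i)"
      using Suc.prems(5) i s by auto
    finally show ?thesis .
  qed
  with Suc.IH[of "\<lambda>i. D (Suc i)" G' "\<lambda>i. x (Suc i)"] Suc.prems G'
  obtain \<phi> where phi: "multiplier \<phi>" and phi_det: "\<And>s. s \<in> orthant \<Longrightarrow>
    0 < Determinant.det (Matrix.mat n n (\<lambda>(i, j). (if i = j then D (Suc i) s else 0) - G' i j s)) \<and>
    Determinant.det (Matrix.mat n n (\<lambda>(i, j). (if i = j then D (Suc i) s else 0) - G' i j s)) powr (- \<alpha>)
      = (\<Prod>i<n. (1 / D (Suc i) s) powr \<alpha>) * \<phi> s"
    by auto
  have det: "Determinant.det (Matrix.mat (Suc n) (Suc n) (\<lambda>(i, j). (if i = j then D i s else 0) - G i j s)) =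
    p s * Determinant.det (Matrix.mat n n (\<lambda>(i, j). (if i = j then D (Suc i) s else 0) - G' i j s))"
    if s: "s \<in> orthant" for s
    using p_pos[OF s]
    by (subst det_schur_pivot) 
      (auto simp: p_def G'_eq[OF s] intro!: arg_cong[where f = Determinant.det] arg_cong[where f = "(*) (p s)"] eq_matI)
  show ?case
  proof (intro exI[of _ "\<lambda>s. (1 - w s) powr (- \<alpha>) * \<phi> s"] conjI ballI)
    show "multiplier (\<lambda>s. (1 - w s) powr (- \<alpha>) * \<phi> s)"
      by (intro multiplier_mult phi multiplier_negative_binomial w w_lt)
    fix s assume s: "s \<in> orthant"
    show "0 < Determinant.det (Matrix.mat (Suc n) (Suc n) (\<lambda>(i, j). (if i = j then D i s else 0) - G i j s))"
      unfolding det[OF s] using phi_det[OF s] p_pos[OF s] by simp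
    have "p s powr (- \<alpha>) = (1 / D 0 s) powr \<alpha> * (1 - w s) powr (- \<alpha>)"
      unfolding p_w[OF s] using D0[OF s] w_lt[OF s]
      by (simp add: powr_mult powr_minus_divide powr_divide)
    then show "Determinant.det (Matrix.mat (Suc n) (Suc n) (\<lambda>(i, j). (if i = j then D i s else 0) - G i j s)) powr (- \<alpha>)
      = (\<Prod>i<Suc n. (1 / D i s) powr \<alpha>) * ((1 - w s) powr (- \<alpha>) * \<phi> s)"
      unfolding det[OF s] using phi_det[OF s] p_pos[OF s]
      by (simp add: powr_mult prod.lessThan_Suc_shift del: prod.lessThan_Suc)
  qed
qed

end

text \<open>
  With \<open>B = K\<^sup>-\<^sup>1\<close> one has \<open>|I + KS| = |B + S| / |B|\<close>. The vector of row sums of \<open>K\<close> is positive and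
  \<open>B\<close> maps it to \<open>1\<close>, as the elimination requires. At \<open>s = 0\<close> the transform is 1, so the mixture of
  gamma laws is a probability.
\<close>

lemma inverse_M_matrix_permanental:
  fixes K B :: "nat \<Rightarrow> nat \<Rightarrow> real"
  assumes \<alpha>: "0 < \<alpha>"
    and BK: "\<And>i j. i < n \<Longrightarrow> j < n \<Longrightarrow> (\<Sum>k<n. B i k * K k j) = (if i = j then 1 else 0)"
    and off: "\<And>i j. i < n \<Longrightarrow> j < n \<Longrightarrow> i \<noteq> j \<Longrightarrow> B i j \<le> 0"
    and K: "\<And>i j. i < n \<Longrightarrow> j < n \<Longrightarrow> 0 < K i j"
  shows "\<exists>(M :: (nat \<Rightarrow> real) measure) Y. prob_space M \<and>
    (\<forall>i<n. Y i \<in> borel_measurable M \<and> (\<forall>\<omega>. 0 \<le> Y i \<omega>)) \<and>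
    (\<forall>s. (\<forall>i<n. 0 \<le> s i) \<longrightarrow> (\<integral>\<omega>. exp (- (\<Sum>i<n. s i * Y i \<omega>)) \<partial>M) =
        Determinant.det (1\<^sub>m n + Matrix.mat n n (\<lambda>(i, j). K i j) * mat_diag n s) powr (- \<alpha>))"
proof -
  define x where "x i = (\<Sum>j<n. K i j)" for i
  have x: "0 < x i" if "i < n" for i
    unfolding x_def using K that by (intro sum_pos) auto
  have Bx: "(\<Sum>j<n. B i j * x j) = 1" if "i < n" for i
  proof -
    have "(\<Sum>k<n. B i k * x k) = (\<Sum>j<n. \<Sum>k<n. B i k * K k j)"
      unfolding x_def sum_distrib_left by (rule sum.swap)
    also have "\<dots> = 1" using BK that by (simp add: sum.delta)
    finally show ?thesis .
  qed
  define G where "G i j = (if i = j then 0 else - B i j)" for i j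
  have Gx: "(\<Sum>j<n. G i j * x j) = B i i * x i - 1" if "i < n" for i
  proof -
    have "(\<Sum>j<n. G i j * x j) = (\<Sum>j<n. - (B i j * x j) + (if j = i then B i i * x i else 0))"
      by (intro sum.cong) (auto simp: G_def)
    then show ?thesis using Bx[OF that] that by (simp add: sum.distrib sum_negf sum_subtractf)
  qed
  have G: "0 \<le> G i j" if "i < n" "j < n" for i j
    using off that unfolding G_def by auto
  have diag: "0 < B i i" if "i < n" for i
  proof -
    have "0 \<le> (\<Sum>j<n. G i j * x j)"
      using G x that by (intro sum_nonneg mult_nonneg_nonneg) (auto intro: less_imp_le)
    then show ?thesis using Gx[OF that] x[OF that] by (metis add_pos_nonneg diff_add_cancel less_add_one not_less mult_nonpos_nonneg less_imp_le diff_ge_0_iff_ge not_one_le_zero order_trans)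
  qed
  interpret gamma_mixtures n \<alpha> "\<lambda>i. B i i"
    by standard (use \<alpha> diag in auto)
  have "\<exists>\<phi>. multiplier \<phi> \<and> (\<forall>s\<in>orthant.
    0 < Determinant.det (Matrix.mat n n (\<lambda>(i, j). (if i = j then B i i + s i else 0) - G i j)) \<and>
    Determinant.det (Matrix.mat n n (\<lambda>(i, j). (if i = j then B i i + s i else 0) - G i j)) powr (- \<alpha>)
      = (\<Prod>i<n. (1 / (B i i + s i)) powr \<alpha>) * \<phi> s)"
  proof (rule det_powr_multiplier[where x = x])
    fix i s assume i: "i < n" and s: "s \<in> orthant"
    show "(\<Sum>j<n. G i j * x j) < (B i i + s i) * x i"
    proof -
      have "0 \<le> s i * x i" using s i x[OF i] by (simp add: orthant_def)
      then show ?thesis unfolding Gx[OF i] by (simp add: distrib_right)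
    qed
  qed (use diag x G in \<open>auto intro!: multiplier_coordinate multiplier_const simp: orthant_def add_pos_nonneg\<close>)
  then obtain \<phi> where phi: "multiplier \<phi>" and det_phi: "\<And>s. s \<in> orthant \<Longrightarrow>
    0 < Determinant.det (Matrix.mat n n (\<lambda>(i, j). (if i = j then B i i + s i else 0) - G i j)) \<and>
    Determinant.det (Matrix.mat n n (\<lambda>(i, j). (if i = j then B i i + s i else 0) - G i j)) powr (- \<alpha>)
      = (\<Prod>i<n. (1 / (B i i + s i)) powr \<alpha>) * \<phi> s" by blast
  define BS where "BS s = Matrix.mat n n (\<lambda>(i, j). (if i = j then B i i + s i else 0) - G i j)" for s
  define KM where "KM = Matrix.mat n n (\<lambda>(i, j). K i j)"
  have BS: "BS s = BS (\<lambda>_. 0) + mat_diag n s" for s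
    unfolding BS_def mat_diag_def by (intro eq_matI) (auto simp: G_def)
  have [simp]: "BS s \<in> carrier_mat n n" "KM \<in> carrier_mat n n" "mat_diag n s \<in> carrier_mat n n" for s
    unfolding BS_def KM_def mat_diag_def by auto
  have BS_0: "BS (\<lambda>_. 0) = Matrix.mat n n (\<lambda>(i, j). B i j)"
    unfolding BS_def by (intro eq_matI) (auto simp: G_def)
  have B0K: "BS (\<lambda>_. 0) * KM = 1\<^sub>m n"
  proof (rule eq_matI)
    fix i j assume "i < dim_row (1\<^sub>m n :: real mat)" "j < dim_col (1\<^sub>m n :: real mat)"
    then show "(BS (\<lambda>_. 0) * KM) $$ (i, j) = (1\<^sub>m n :: real mat) $$ (i, j)"
      using BK[of i j] unfolding BS_0 KM_def
      by (simp add: scalar_prod_def atLeast0LessThan)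
  qed (auto simp: BS_def KM_def)
  have KB0: "KM * BS (\<lambda>_. 0) = 1\<^sub>m n"
    using mat_mult_left_right_inverse[OF _ _ B0K] by simp
  have det: "Determinant.det (1\<^sub>m n + KM * mat_diag n s) = Determinant.det (BS s) / Determinant.det (BS (\<lambda>_. 0))" for s
  proof -
    have "1\<^sub>m n + KM * mat_diag n s = KM * BS s"
      unfolding BS[of s] KB0[symmetric] by (rule mult_add_distrib_mat[symmetric, where nr = n and n = n and nc = n]) auto
    then have "Determinant.det (1\<^sub>m n + KM * mat_diag n s) = Determinant.det KM * Determinant.det (BS s)"
      by (simp add: det_mult[where n = n])
    moreover have "Determinant.det (BS (\<lambda>_. 0)) * Determinant.det KM = 1"
      using arg_cong[OF B0K, of Determinant.det] by (simp add: det_mult[where n = n])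
    moreover from this have "Determinant.det (BS (\<lambda>_. 0)) \<noteq> 0" by auto
    ultimately show ?thesis by (simp add: field_simps)
  qed
  have zero: "(\<lambda>_. 0) \<in> orthant" unfolding orthant_def by auto
  have det0: "0 < Determinant.det (BS (\<lambda>_. 0))"
    using det_phi[OF zero] unfolding BS_def by blast
  define c where "c = Determinant.det (BS (\<lambda>_. 0)) powr \<alpha>"
  have "is_laplace (\<lambda>s. c * ((\<Prod>i<n. (1 / (B i i + s i)) powr \<alpha>) * \<phi> s))"
    by (intro is_laplace_cmult multiplier_is_laplace phi) (auto simp: c_def)
  also have "?this \<longleftrightarrow> is_laplace (\<lambda>s. Determinant.det (1\<^sub>m n + KM * mat_diag n s) powr (- \<alpha>))"
  proof (rule is_laplace_cong)
    fix s assume s: "s \<in> orthant"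
    then have "0 < Determinant.det (BS s)" using det_phi unfolding BS_def by blast
    then show "c * ((\<Prod>i<n. (1 / (B i i + s i)) powr \<alpha>) * \<phi> s) = Determinant.det (1\<^sub>m n + KM * mat_diag n s) powr (- \<alpha>)"
    proof -
      have "(Determinant.det (BS s) / Determinant.det (BS (\<lambda>_. 0))) powr (- \<alpha>) = c * Determinant.det (BS s) powr (- \<alpha>)"
        using \<open>0 < Determinant.det (BS s)\<close> det0 unfolding c_def by (simp add: powr_divide powr_minus_divide)
      then show ?thesis
        using det_phi[OF s] unfolding det BS_def[symmetric] by simp
    qed
  qed
  finally obtain p where [measurable]: "p \<in> borel_measurable (\<Pi>\<^sub>M i\<in>{..<n}. lborel)"
    and p_orthant: "\<And>x. p x \<noteq> 0 \<Longrightarrow> x \<in> orthant"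
    and p: "\<And>s. s \<in> orthant \<Longrightarrow> ennreal (Determinant.det (1\<^sub>m n + KM * mat_diag n s) powr (- \<alpha>)) = laplace p s"
    unfolding is_laplace_def by blast
  let ?L = "\<Pi>\<^sub>M i\<in>{..<n}. lborel :: real measure"
  define M where "M = density ?L p"
  define Y where "Y i x = max 0 (x i)" for i and x :: "nat \<Rightarrow> real"
  have exp_Y: "(\<lambda>x. exp (- (\<Sum>i<n. s i * Y i x))) \<in> borel_measurable ?L" for s
  proof -
    have "(\<lambda>x. - (\<Sum>i<n. s i * Y i x)) \<in> borel_measurable ?L"
      unfolding Y_def
      by (intro borel_measurable_uminus borel_measurable_sum borel_measurable_times
          borel_measurable_const borel_measurable_max component_measurable) auto
    from measurable_compose[OF this borel_measurable_exp] show ?thesis .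
  qed
  have exp_M: "(\<integral>\<^sup>+\<omega>. ennreal (exp (- (\<Sum>i<n. s i * Y i \<omega>))) \<partial>M) = laplace p s" for s
  proof -
    have "(\<integral>\<^sup>+\<omega>. ennreal (exp (- (\<Sum>i<n. s i * Y i \<omega>))) \<partial>M) = 
      (\<integral>\<^sup>+\<omega>. p \<omega> * ennreal (exp (- (\<Sum>i<n. s i * Y i \<omega>))) \<partial>?L)"
      unfolding M_def using exp_Y[of s] by (subst nn_integral_density) auto
    also have "\<dots> = laplace p s"
      unfolding laplace_def
    proof (intro nn_integral_cong)
      fix x
      show "p x * ennreal (exp (- (\<Sum>i<n. s i * Y i x))) = p x * ennreal (exp (- (\<Sum>i<n. s i * x i)))"
        using p_orthant[of x] by (cases "p x = 0") (auto simp: Y_def orthant_def max_def intro!: sum.cong)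
    qed
    finally show ?thesis .
  qed
  have "emeasure M (space M) = (\<integral>\<^sup>+\<omega>. ennreal (exp (- (\<Sum>i<n. 0 * Y i \<omega>))) \<partial>M)"
    by simp
  also have "\<dots> = 1"
    using exp_M[of "\<lambda>_. 0"] p[OF zero] det0 by (simp add: det)
  finally have M: "prob_space M" by (rule prob_spaceI)
  have Y: "Y i \<in> borel_measurable M" if "i < n" for i
  proof -
    show ?thesis
      using component_measurable[OF that] unfolding Y_def M_def by simp
  qed
  have "(\<integral>\<omega>. exp (- (\<Sum>i<n. s i * Y i \<omega>)) \<partial>M) = Determinant.det (1\<^sub>m n + KM * mat_diag n s) powr (- \<alpha>)"
    if "\<forall>i<n. 0 \<le> s i" for s
  proof -
    have "s \<in> orthant" using that by (simp add: orthant_def)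
    then have "(\<integral>\<^sup>+\<omega>. ennreal (exp (- (\<Sum>i<n. s i * Y i \<omega>))) \<partial>M) = ennreal (Determinant.det (1\<^sub>m n + KM * mat_diag n s) powr (- \<alpha>))"
      using exp_M[of s] p[of s] by simp
    moreover have "(\<lambda>\<omega>. exp (- (\<Sum>i<n. s i * Y i \<omega>))) \<in> borel_measurable M"
      using exp_Y[of s] unfolding M_def by simp
    ultimately show ?thesis
      by (subst integral_eq_nn_integral) auto
  qed
  with M Y show ?thesis
    unfolding KM_def by (intro exI[of _ M] exI[of _ Y]) (auto simp: Y_def)
qed

section \<open>Binary digits and measures on digit sequences\<close>

definition binary_digit :: "nat \<Rightarrow> real \<Rightarrow> real"
  where "binary_digit k y = of_int (\<lfloor>2 ^ Suc k * y\<rfloor> mod 2)"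

lemma binary_digit_cases: "binary_digit k y = 0 \<or> binary_digit k y = 1"
proof -
  have "\<lfloor>2 ^ Suc k * y\<rfloor> mod 2 = 0 \<or> \<lfloor>2 ^ Suc k * y\<rfloor> mod 2 = 1" by presburger
  then show ?thesis unfolding binary_digit_def by auto
qed

lemma binary_digit_measurable [measurable]: "binary_digit k \<in> borel_measurable borel"
  unfolding binary_digit_def by measurable

lemma binary_truncation:
  assumes "0 \<le> y" "y < 1"
  shows "(\<Sum>k<L. binary_digit k y / 2 ^ Suc k) = of_int \<lfloor>2 ^ L * y\<rfloor> / 2 ^ L"
proof (induction L)
  case 0
  have "\<lfloor>y\<rfloor> = 0" using assms by (simp add: floor_eq_iff)
  then show ?case by simp
next
  case (Suc L)
  have "\<lfloor>2 ^ Suc L * y / of_int 2\<rfloor> = \<lfloor>2 ^ Suc L * y\<rfloor> div 2"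
    by (rule floor_divide_real_eq_div) simp
  then have "\<lfloor>2 ^ L * y\<rfloor> = \<lfloor>2 ^ Suc L * y\<rfloor> div 2"
    by (simp add: mult.assoc)
  then have "\<lfloor>2 ^ Suc L * y\<rfloor> = 2 * \<lfloor>2 ^ L * y\<rfloor> + \<lfloor>2 ^ Suc L * y\<rfloor> mod 2"
    by presburger
  then have "real_of_int \<lfloor>2 ^ Suc L * y\<rfloor> = 2 * real_of_int \<lfloor>2 ^ L * y\<rfloor> + binary_digit L y"
    unfolding binary_digit_def by (metis of_int_add of_int_mult of_int_numeral)
  then show ?case using Suc by (simp add: add_divide_distrib)
qed

lemma binary_truncation_close:
  assumes "0 \<le> y" "y < 1"
  shows "\<bar>(\<Sum>k<L. binary_digit k y / 2 ^ Suc k) - y\<bar> \<le> 1 / 2 ^ L"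
proof -
  have "\<bar>real_of_int \<lfloor>2 ^ L * y\<rfloor> - 2 ^ L * y\<bar> \<le> 1" by linarith
  then have "\<bar>real_of_int \<lfloor>2 ^ L * y\<rfloor> - 2 ^ L * y\<bar> / 2 ^ L \<le> 1 / 2 ^ L"
    by (intro divide_right_mono) auto
  then have "\<bar>(real_of_int \<lfloor>2 ^ L * y\<rfloor> - 2 ^ L * y) / 2 ^ L\<bar> \<le> 1 / 2 ^ L"
    by simp
  then show ?thesis unfolding binary_truncation[OF assms] by (simp add: diff_divide_distrib)
qed

text \<open>
  Reading every value other than 1 as the digit 0 makes sums of digits bounded on the whole
  product space, and not only almost surely.
\<close>

definition unit_bit :: "real \<Rightarrow> real"
  where "unit_bit x = (if x = 1 then 1 else 0)"

definition truncated :: "nat \<Rightarrow> ('t \<times> nat \<Rightarrow> real) \<Rightarrow> 't \<Rightarrow> real"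
  where "truncated L x t = (\<Sum>k<L. unit_bit (x (t, k)) / 2 ^ Suc k)"

definition bits_value :: "('t \<times> nat \<Rightarrow> real) \<Rightarrow> 't \<Rightarrow> real"
  where "bits_value x t = (\<Sum>k. unit_bit (x (t, k)) / 2 ^ Suc k)"

lemma unit_bit_measurable [measurable]: "unit_bit \<in> borel_measurable borel"
  unfolding unit_bit_def by measurable

lemma half_power_sums: "(\<lambda>k. 1 / 2 ^ Suc k :: real) sums 1"
  using sums_mult[OF geometric_sums[of "1 / 2 :: real"], of "1 / 2"] by (simp add: power_divide)

lemma bits_summable: "summable (\<lambda>k. unit_bit (x (t, k)) / 2 ^ Suc k)"
  by (rule summable_comparison_test'[OF sums_summable[OF half_power_sums], of 0])
    (auto simp: unit_bit_def)

lemma truncated_tendsto: "(\<lambda>L. truncated L x t) \<longlonglongrightarrow> bits_value x t"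
  unfolding truncated_def bits_value_def by (rule summable_LIMSEQ[OF bits_summable])

lemma truncated_bounds: "0 \<le> truncated L x t" "truncated L x t \<le> 1"
proof -
  show "0 \<le> truncated L x t"
    unfolding truncated_def by (intro sum_nonneg) (auto simp: unit_bit_def)
  have "truncated L x t \<le> (\<Sum>k<L. 1 / 2 ^ Suc k)"
    unfolding truncated_def by (intro sum_mono) (auto simp: unit_bit_def)
  also have "\<dots> \<le> (\<Sum>k. 1 / 2 ^ Suc k)"
    by (intro sum_le_suminf sums_summable[OF half_power_sums]) auto
  also have "\<dots> = 1" using half_power_sums by (rule sums_unique[symmetric])
  finally show "truncated L x t \<le> 1" .
qed

lemma bits_value_bounds: "0 \<le> bits_value x t" "bits_value x t \<le> 1"
  using truncated_bounds[of _ x t]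
  by (auto intro!: always_eventually tendsto_lowerbound[OF truncated_tendsto] tendsto_upperbound[OF truncated_tendsto])

lemma abs_prod_diff_le_sum:
  fixes a b :: "'i \<Rightarrow> real"
  assumes "\<And>i. i \<in> I \<Longrightarrow> 0 \<le> a i \<and> a i \<le> 1" "\<And>i. i \<in> I \<Longrightarrow> 0 \<le> b i \<and> b i \<le> 1"
  shows "\<bar>(\<Prod>i\<in>I. a i) - (\<Prod>i\<in>I. b i)\<bar> \<le> (\<Sum>i\<in>I. \<bar>a i - b i\<bar>)"
  using norm_prod_diff[of I a b] assms by auto

lemma powr_uniformly_continuous:
  fixes s \<epsilon> :: real assumes "0 < s" "0 < \<epsilon>"
  shows "\<exists>\<delta>>0. \<forall>a\<in>{0..1}. \<forall>b\<in>{0..1}. \<bar>a - b\<bar> < \<delta> \<longrightarrow> \<bar>a powr s - b powr s\<bar> < \<epsilon>"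
proof -
  have "continuous_on {0..1} (\<lambda>a::real. a powr s)"
    using assms by (intro continuous_on_powr' continuous_intros) auto
  then have "uniformly_continuous_on {0..1} (\<lambda>a::real. a powr s)"
    by (rule compact_uniformly_continuous) simp
  then show ?thesis
    using assms unfolding uniformly_continuous_on_def dist_real_def by (metis abs_minus_commute)
qed

lemma compact_cube: "compact {q :: 'c \<Rightarrow> real. \<forall>A. q A \<in> {0..1}}"
proof -
  have "compactin (product_topology (\<lambda>_. euclidean) UNIV) (PiE (UNIV :: 'c set) (\<lambda>_. {0..1::real}))"
    unfolding compactin_PiE by simp
  then have "compact (PiE (UNIV :: 'c set) (\<lambda>_. {0..1::real}))"
    unfolding euclidean_product_topology by simp
  also have "PiE (UNIV :: 'c set) (\<lambda>_. {0..1::real}) = {q. \<forall>A. q A \<in> {0..1}}"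
    by (auto simp: PiE_def Pi_def)
  finally show ?thesis .
qed

text \<open>
  Tychonoff: a family of functions into \<open>[0, 1]\<close> converges pointwise along a finer filter.
\<close>

lemma cluster_filter:
  fixes q :: "'l \<Rightarrow> 'c \<Rightarrow> real"
  assumes "\<Phi> \<noteq> bot" and "\<And>l A. q l A \<in> {0..1}"
  obtains \<Psi> p where "\<Psi> \<le> \<Phi>" "\<Psi> \<noteq> bot" "\<And>A. ((\<lambda>l. q l A) \<longlongrightarrow> p A) \<Psi>" 
proof -
  have "filtermap q \<Phi> \<noteq> bot" using assms(1) by (simp add: filtermap_bot_iff)
  moreover have "eventually (\<lambda>x. x \<in> {q. \<forall>A. q A \<in> {0..1}}) (filtermap q \<Phi>)"
    using assms(2) by (simp add: eventually_filtermap)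
  ultimately obtain p where p: "inf (nhds p) (filtermap q \<Phi>) \<noteq> bot"
    using compact_cube unfolding compact_filter by metis
  let ?\<Psi> = "inf \<Phi> (filtercomap q (nhds p))"
  have "?\<Psi> \<noteq> bot"
  proof
    assume "?\<Psi> = bot"
    then have "eventually (\<lambda>_. False) ?\<Psi>" by simp
    then obtain P Q where PQ: "eventually P \<Phi>" "eventually Q (filtercomap q (nhds p))" "\<And>x. P x \<Longrightarrow> Q x \<Longrightarrow> False"
      unfolding eventually_inf by blast
    then obtain R where R: "eventually R (nhds p)" "\<And>x. R (q x) \<Longrightarrow> Q x"
      unfolding eventually_filtercomap by blast
    have "eventually (\<lambda>z. \<not> R z) (filtermap q \<Phi>)"
      unfolding eventually_filtermap using PQ(1) by eventually_elim (use PQ(3) R(2) in blast)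
    then have "eventually (\<lambda>_. False) (inf (nhds p) (filtermap q \<Phi>))"
      unfolding eventually_inf using R(1) by blast
    with p show False by (simp add: trivial_limit_def)
  qed
  moreover have "(q \<longlongrightarrow> p) ?\<Psi>"
    by (rule filterlim_mono[OF filterlim_filtercomap order_refl]) simp
  then have "((\<lambda>l. q l A) \<longlongrightarrow> p A) ?\<Psi>" for A
    using continuous_on_tendsto_compose[OF continuous_on_product_coordinates[of A]] by fastforce
  ultimately show thesis by (intro that[of ?\<Psi> p]) auto
qed

lemma det_tendsto:
  fixes A :: "'l \<Rightarrow> nat \<Rightarrow> nat \<Rightarrow> real"
  assumes "\<And>i j. i < n \<Longrightarrow> j < n \<Longrightarrow> ((\<lambda>l. A l i j) \<longlongrightarrow> B i j) F"
  shows "((\<lambda>l. Determinant.det (Matrix.mat n n (\<lambda>(i, j). A l i j))) \<longlongrightarrow>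
    Determinant.det (Matrix.mat n n (\<lambda>(i, j). B i j))) F"
proof -
  have det: "Determinant.det (Matrix.mat n n (\<lambda>(i, j). C i j)) =
      (\<Sum>p\<in>{p. p permutes {0..<n}}. signof p * (\<Prod>i = 0..<n. C i (p i)))" for C :: "nat \<Rightarrow> nat \<Rightarrow> real"
  proof -
    have "(\<Prod>i = 0..<n. Matrix.mat n n (\<lambda>(i, j). C i j) $$ (i, p i)) = (\<Prod>i = 0..<n. C i (p i))"
      if "p permutes {0..<n}" for p
      using permutes_in_image[OF that] by (intro prod.cong) auto
    then show ?thesis unfolding Determinant.det_def by simp
  qed
  show ?thesis
    unfolding det
  proof (intro tendsto_sum tendsto_mult tendsto_const tendsto_prod assms)
    fix p i assume "p \<in> {p. p permutes {0..<n}}" "i \<in> {0..<n}"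
    then show "i < n" "p i < n" using permutes_in_image[of p "{0..<n}" i] by auto
  qed
qed

definition bit_strings :: "'j set \<Rightarrow> ('j \<Rightarrow> real) set"
  where "bit_strings J = PiE J (\<lambda>_. {0, 1})"

definition cylinder :: "'j set \<Rightarrow> ('j \<Rightarrow> real) \<Rightarrow> ('j \<Rightarrow> real) set"
  where "cylinder J \<sigma> = {x. \<forall>j\<in>J. x j = \<sigma> j}"

lemma finite_bit_strings: "finite J \<Longrightarrow> finite (bit_strings J)"
  unfolding bit_strings_def by (intro finite_PiE) auto

lemma cylinder_iff_restrict: "\<sigma> \<in> bit_strings J \<Longrightarrow> x \<in> cylinder J \<sigma> \<longleftrightarrow> restrict x J = \<sigma>"
  unfolding cylinder_def bit_strings_def by (auto simp: PiE_iff extensional_def restrict_def fun_eq_iff)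

text \<open>
  Expectations of functions of finitely many digits are finite linear combinations of cylinder
  probabilities, so they pass to limits of these probabilities.
\<close>

lemma expectation_of_bits:
  fixes b :: "'w \<Rightarrow> 'j \<Rightarrow> real" and h :: "('j \<Rightarrow> real) \<Rightarrow> real"
  assumes "prob_space N" and "finite J"
    and b: "\<And>j. j \<in> J \<Longrightarrow> (\<lambda>\<omega>. b \<omega> j) \<in> borel_measurable N" "\<And>\<omega> j. b \<omega> j = 0 \<or> b \<omega> j = 1"
    and h: "\<And>x. h x = h (restrict x J)"
  shows "(\<integral>\<omega>. h (b \<omega>) \<partial>N) = (\<Sum>\<sigma>\<in>bit_strings J. h \<sigma> * measure N {\<omega>\<in>space N. b \<omega> \<in> cylinder J \<sigma>})"
proof -
  interpret prob_space N by fact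
  have meas: "{\<omega>\<in>space N. b \<omega> \<in> cylinder J \<sigma>} \<in> sets N" for \<sigma>
  proof -
    have "{\<omega>\<in>space N. \<forall>j\<in>J. b \<omega> j = \<sigma> j} \<in> sets N"
    proof (rule sets.sets_Collect_finite_All[OF _ \<open>finite J\<close>])
      fix j assume "j \<in> J"
      from b(1)[OF this] show "{\<omega>\<in>space N. b \<omega> j = \<sigma> j} \<in> sets N" by measurable
    qed
    then show ?thesis unfolding cylinder_def by simp
  qed
  have "h (b \<omega>) = (\<Sum>\<sigma>\<in>bit_strings J. h \<sigma> * indicator {\<omega>\<in>space N. b \<omega> \<in> cylinder J \<sigma>} \<omega>)" if "\<omega> \<in> space N" for \<omega>
  proof -
    have mem: "restrict (b \<omega>) J \<in> bit_strings J"
    proof -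
      have "b \<omega> j \<in> {0, 1}" for j using b(2)[of \<omega> j] by blast
      then show ?thesis unfolding bit_strings_def by auto
    qed
    have "(\<Sum>\<sigma>\<in>bit_strings J. h \<sigma> * indicator {\<omega>\<in>space N. b \<omega> \<in> cylinder J \<sigma>} \<omega>) =
      (\<Sum>\<sigma>\<in>bit_strings J. if restrict (b \<omega>) J = \<sigma> then h \<sigma> else 0)"
      using that by (intro sum.cong refl) (auto simp: cylinder_iff_restrict indicator_def)
    also have "\<dots> = h (restrict (b \<omega>) J)"
      using mem finite_bit_strings[OF \<open>finite J\<close>] by (simp add: sum.delta')
    finally show ?thesis using h by metis
  qed
  then have "(\<integral>\<omega>. h (b \<omega>) \<partial>N) = (\<integral>\<omega>. (\<Sum>\<sigma>\<in>bit_strings J. h \<sigma> * indicator {\<omega>\<in>space N. b \<omega> \<in> cylinder J \<sigma>} \<omega>) \<partial>N)"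
    by (intro Bochner_Integration.integral_cong) auto
  also have "\<dots> = (\<Sum>\<sigma>\<in>bit_strings J. h \<sigma> * measure N {\<omega>\<in>space N. b \<omega> \<in> cylinder J \<sigma>})"
    using meas by (subst Bochner_Integration.integral_sum)
      (auto intro!: integrable_mult_right integrable_real_indicator simp: less_top[symmetric])
  finally show ?thesis .
qed

definition consistent_weights :: "(('j \<Rightarrow> real) set \<Rightarrow> real) \<Rightarrow> bool"
  where "consistent_weights p \<longleftrightarrow> (\<forall>A. 0 \<le> p A) \<and>
    (\<forall>J. finite J \<longrightarrow> (\<Sum>\<sigma>\<in>bit_strings J. p (cylinder J \<sigma>)) = 1) \<and>
    (\<forall>J H \<sigma>. J \<subseteq> H \<longrightarrow> finite H \<longrightarrow> \<sigma> \<in> bit_strings J \<longrightarrow>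
      p (cylinder J \<sigma>) = (\<Sum>\<tau>\<in>{\<tau>\<in>bit_strings H. restrict \<tau> J = \<sigma>}. p (cylinder H \<tau>)))"

text \<open>
  Kolmogorov's extension theorem, with finite-dimensional laws carried by the finitely many bit
  strings.
\<close>

lemma measure_of_consistent_weights:
  fixes p :: "('j \<Rightarrow> real) set \<Rightarrow> real"
  assumes cw: "consistent_weights p"
  obtains M :: "('j \<Rightarrow> real) measure" where "prob_space M" "sets M = sets (PiM UNIV (\<lambda>_. borel))"
    "\<And>J h. finite J \<Longrightarrow> h \<in> borel_measurable (PiM J (\<lambda>_. borel)) \<Longrightarrow>
      (\<integral>x. h (restrict x J) \<partial>M) = (\<Sum>\<sigma>\<in>bit_strings J. h \<sigma> * p (cylinder J \<sigma>))"
proof -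
  define P where "P J = distr (point_measure (bit_strings J) (\<lambda>\<sigma>. ennreal (p (cylinder J \<sigma>)))) (PiM J (\<lambda>_. borel)) (\<lambda>x. x)" for J
  have p_nn: "0 \<le> p A" for A using cw unfolding consistent_weights_def by auto
  have sub: "bit_strings J \<subseteq> space (PiM J (\<lambda>_. borel :: real measure))" for J :: "'j set"
    unfolding bit_strings_def space_PiM by (auto simp: PiE_iff)
  have id: "(\<lambda>x. x) \<in> point_measure (bit_strings J) f \<rightarrow>\<^sub>M PiM J (\<lambda>_. borel)" for J :: "'j set" and f :: "_ \<Rightarrow> ennreal"
    using sub[of J] by auto
  have emeasure_P: "emeasure (P J) X = (\<Sum>\<sigma>\<in>bit_strings J \<inter> X. ennreal (p (cylinder J \<sigma>)))"
    if "finite J" "X \<in> sets (PiM J (\<lambda>_. borel))" for J X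
    unfolding P_def using that finite_bit_strings[OF that(1)]
    by (subst emeasure_distr[OF id that(2)])
      (auto simp: emeasure_point_measure_finite space_point_measure Int_commute)
  interpret polish_projective UNIV P
  proof (unfold polish_projective_def, rule projective_family.intro)
    fix J H :: "'j set" assume JH: "J \<subseteq> H" "finite H" "H \<subseteq> UNIV"
    then have fin: "finite J" by (auto intro: finite_subset)
    have res: "(\<lambda>f. restrict f J) \<in> P H \<rightarrow>\<^sub>M PiM J (\<lambda>_. borel)"
      unfolding P_def using measurable_restrict_subset[OF JH(1)] by simp
    show "P J = distr (P H) (PiM J (\<lambda>_. borel)) (\<lambda>f. restrict f J)"
    proof (rule measure_eqI)
      fix X assume "X \<in> sets (P J)"
      then have X: "X \<in> sets (PiM J (\<lambda>_. borel))" by (simp add: P_def)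
      let ?X = "(\<lambda>f. restrict f J) -` X \<inter> space (P H)"
      have spH: "space (P H) = space (PiM H (\<lambda>_. borel))" by (simp add: P_def)
      have X': "?X \<in> sets (PiM H (\<lambda>_. borel))"
        using measurable_sets[OF res X] by (simp add: P_def)
      have "emeasure (P J) X = (\<Sum>\<sigma>\<in>bit_strings J \<inter> X. \<Sum>\<tau>\<in>{\<tau>\<in>bit_strings H. restrict \<tau> J = \<sigma>}. ennreal (p (cylinder H \<tau>)))"
        unfolding emeasure_P[OF fin X]
      proof (intro sum.cong refl)
        fix \<sigma> assume "\<sigma> \<in> bit_strings J \<inter> X"
        then have "p (cylinder J \<sigma>) = (\<Sum>\<tau>\<in>{\<tau>\<in>bit_strings H. restrict \<tau> J = \<sigma>}. p (cylinder H \<tau>))"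
          using cw JH unfolding consistent_weights_def by blast
        then show "ennreal (p (cylinder J \<sigma>)) = (\<Sum>\<tau>\<in>{\<tau>\<in>bit_strings H. restrict \<tau> J = \<sigma>}. ennreal (p (cylinder H \<tau>)))"
          using p_nn by (simp add: sum_ennreal)
      qed
      also have "\<dots> = (\<Sum>\<tau>\<in>bit_strings H \<inter> ?X. ennreal (p (cylinder H \<tau>)))"
      proof -
        have img: "(\<lambda>f. restrict f J) ` (bit_strings H \<inter> ?X) \<subseteq> bit_strings J \<inter> X"
          using JH(1) unfolding bit_strings_def by (auto simp: PiE_iff)
        have "(\<Sum>\<tau>\<in>bit_strings H \<inter> ?X. ennreal (p (cylinder H \<tau>))) =
          (\<Sum>\<sigma>\<in>bit_strings J \<inter> X. \<Sum>\<tau>\<in>{\<tau>\<in>bit_strings H \<inter> ?X. restrict \<tau> J = \<sigma>}. ennreal (p (cylinder H \<tau>)))"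
          using finite_bit_strings[OF fin] finite_bit_strings[OF JH(2)] img
          by (intro sum.group[symmetric]) auto
        also have "\<dots> = (\<Sum>\<sigma>\<in>bit_strings J \<inter> X. \<Sum>\<tau>\<in>{\<tau>\<in>bit_strings H. restrict \<tau> J = \<sigma>}. ennreal (p (cylinder H \<tau>)))"
          using sub[of H] unfolding spH by (intro sum.cong refl) auto
        finally show ?thesis by simp
      qed
      also have "\<dots> = emeasure (distr (P H) (PiM J (\<lambda>_. borel)) (\<lambda>f. restrict f J)) X"
        by (subst emeasure_distr[OF res X]) (rule emeasure_P[OF JH(2) X', symmetric])
      finally show "emeasure (P J) X = emeasure (distr (P H) (PiM J (\<lambda>_. borel)) (\<lambda>f. restrict f J)) X" .
    qed (simp add: P_def)
  next
    fix J :: "'j set" assume J: "finite J"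
    show "prob_space (P J)"
    proof (rule prob_spaceI)
      have "emeasure (P J) (space (P J)) = emeasure (P J) (space (PiM J (\<lambda>_. borel)))"
        by (simp add: P_def)
      also have "\<dots> = (\<Sum>\<sigma>\<in>bit_strings J. ennreal (p (cylinder J \<sigma>)))"
        using sub[of J] by (subst emeasure_P[OF J]) (auto intro!: sum.cong)
      also have "\<dots> = 1"
        using cw J p_nn unfolding consistent_weights_def by (subst sum_ennreal) auto
      finally show "emeasure (P J) (space (P J)) = 1" .
    qed
  qed
  show thesis
  proof (rule that[of lim])
    show "prob_space lim" by (rule P.prob_space_axioms)
    show "sets lim = sets (PiM UNIV (\<lambda>_. borel))" by simp
    fix J and h :: "('j \<Rightarrow> real) \<Rightarrow> real"
    assume J: "finite J" and h: "h \<in> borel_measurable (PiM J (\<lambda>_. borel))"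
    have res: "(\<lambda>x. restrict x J) \<in> lim \<rightarrow>\<^sub>M PiM J (\<lambda>_. borel)"
    proof -
      have "sets lim = sets (PiM UNIV (\<lambda>_. borel :: real measure))" by simp
      from measurable_cong_sets[OF this refl] show ?thesis
        using measurable_restrict_subset[of J UNIV "\<lambda>_. borel"] by blast
    qed
    have distr: "distr lim (PiM J (\<lambda>_. borel)) (\<lambda>x. restrict x J) = P J"
    proof (rule measure_eqI)
      fix X assume "X \<in> sets (distr lim (PiM J (\<lambda>_. borel)) (\<lambda>x. restrict x J))"
      then have X: "X \<in> sets (PiM J (\<lambda>_. borel))" by simp
      have "emeasure (distr lim (PiM J (\<lambda>_. borel)) (\<lambda>x. restrict x J)) X = emeasure lim (emb UNIV J X)"
        by (subst emeasure_distr[OF res X]) (simp add: prod_emb_def space_PiM)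
      also have "\<dots> = emeasure (P J) X" by (rule emeasure_lim_emb[OF _ J X]) simp
      finally show "emeasure (distr lim (PiM J (\<lambda>_. borel)) (\<lambda>x. restrict x J)) X = emeasure (P J) X" .
    qed (simp add: P_def)
    have "(\<integral>x. h (restrict x J) \<partial>lim) = (\<integral>x. h x \<partial>P J)"
      unfolding distr[symmetric] by (rule integral_distr[symmetric, OF res h])
    also have "\<dots> = (\<integral>x. h x \<partial>point_measure (bit_strings J) (\<lambda>\<sigma>. ennreal (p (cylinder J \<sigma>))))"
      unfolding P_def by (rule integral_distr[OF id h])
    also have "\<dots> = (\<Sum>\<sigma>\<in>bit_strings J. p (cylinder J \<sigma>) *\<^sub>R h \<sigma>)"
      using p_nn by (intro lebesgue_integral_point_measure_finite finite_bit_strings J) auto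
    finally show "(\<integral>x. h (restrict x J) \<partial>lim) = (\<Sum>\<sigma>\<in>bit_strings J. h \<sigma> * p (cylinder J \<sigma>))"
      by (simp add: mult.commute)
  qed
qed

section \<open>Limits of permanental kernels\<close>

lemma one_plus_mult_diag:
  "1\<^sub>m n + Matrix.mat n n (\<lambda>(i, j). f i j) * mat_diag n s =
    Matrix.mat n n (\<lambda>(i, j). (if i = j then 1 else 0) + f i j * (s j :: real))"
  by (subst mat_diag_mult_right[where nr = n and n = n]) (auto intro!: eq_matI)

text \<open>
  Repeating or omitting points does not leave the class of determinants \<open>|I + KS|\<close>: the variables
  \<open>s\<^sub>i\<close> of equal points add up, and omitted points get the variable 0. This is Sylvester's identity
  for the incidence matrix of \<open>\<tau>\<close>.
\<close>

lemma det_reindex: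
  fixes K :: "nat \<Rightarrow> nat \<Rightarrow> real"
  assumes \<tau>: "\<And>i. i < n \<Longrightarrow> \<tau> i < d"
  shows "Determinant.det (1\<^sub>m n + Matrix.mat n n (\<lambda>(i, j). K (\<tau> i) (\<tau> j)) * mat_diag n s) =
    Determinant.det (1\<^sub>m d + Matrix.mat d d (\<lambda>(i, j). K i j) * mat_diag d (\<lambda>a. \<Sum>i | i < n \<and> \<tau> i = a. s i))"
proof -
  define A where "A = Matrix.mat n d (\<lambda>(i, b). K (\<tau> i) b)"
  define B where "B = Matrix.mat d n (\<lambda>(a, j). if \<tau> j = a then s j else 0)"
  define s' where "s' a = (\<Sum>i | i < n \<and> \<tau> i = a. s i)" for a
  define KM where "KM = Matrix.mat d d (\<lambda>(i, j). K i j)"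
  have [simp]: "A \<in> carrier_mat n d" "B \<in> carrier_mat d n" "KM \<in> carrier_mat d d" "mat_diag d s' \<in> carrier_mat d d"
    unfolding A_def B_def KM_def mat_diag_def by auto
  have "Matrix.mat n n (\<lambda>(i, j). K (\<tau> i) (\<tau> j)) * mat_diag n s = A * B"
  proof (subst mat_diag_mult_right[where nr = n and n = n])
    show "Matrix.mat n n (\<lambda>(i, j). Matrix.mat n n (\<lambda>(i, j). K (\<tau> i) (\<tau> j)) $$ (i, j) * s j) = A * B"
    proof (rule eq_matI)
      fix i j assume "i < dim_row (A * B)" "j < dim_col (A * B)"
      then have ij: "i < n" "j < n" by (auto simp: A_def B_def)
      have "(A * B) $$ (i, j) = (\<Sum>a<d. K (\<tau> i) a * (if \<tau> j = a then s j else 0))"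
        using ij by (simp add: A_def B_def scalar_prod_def atLeast0LessThan)
      also have "\<dots> = (\<Sum>a<d. if \<tau> j = a then K (\<tau> i) a * s j else 0)"
        by (intro sum.cong) auto
      also have "\<dots> = K (\<tau> i) (\<tau> j) * s j"
        using \<tau>[OF ij(2)] by (simp add: sum.delta')
      finally show "Matrix.mat n n (\<lambda>(i, j). Matrix.mat n n (\<lambda>(i, j). K (\<tau> i) (\<tau> j)) $$ (i, j) * s j) $$ (i, j) = (A * B) $$ (i, j)"
        using ij by simp
    qed (auto simp: A_def B_def)
  qed auto
  moreover have "B * A = mat_diag d s' * KM"
  proof (subst mat_diag_mult_left[where nr = d and n = d])
    show "B * A = Matrix.mat d d (\<lambda>(i, j). s' i * KM $$ (i, j))"
    proof (rule eq_matI)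
      fix a b assume "a < dim_row (Matrix.mat d d (\<lambda>(i, j). s' i * KM $$ (i, j)))" "b < dim_col (Matrix.mat d d (\<lambda>(i, j). s' i * KM $$ (i, j)))"
      then have ab: "a < d" "b < d" by auto
      have "(B * A) $$ (a, b) = (\<Sum>j<n. (if \<tau> j = a then s j else 0) * K (\<tau> j) b)"
        using ab by (simp add: A_def B_def scalar_prod_def atLeast0LessThan)
      also have "\<dots> = (\<Sum>j<n. if \<tau> j = a then s j * K a b else 0)"
        by (intro sum.cong) auto
      also have "\<dots> = (\<Sum>j | j < n \<and> \<tau> j = a. s j * K a b)"
        by (subst sum.inter_filter[symmetric]) (auto intro!: sum.cong)
      also have "\<dots> = s' a * K a b"
        unfolding s'_def by (simp add: sum_distrib_right)
      finally show "(B * A) $$ (a, b) = Matrix.mat d d (\<lambda>(i, j). s' i * KM $$ (i, j)) $$ (a, b)"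
        using ab by (simp add: KM_def)
    qed (auto simp: A_def B_def)
  qed auto
  ultimately have "Determinant.det (1\<^sub>m n + Matrix.mat n n (\<lambda>(i, j). K (\<tau> i) (\<tau> j)) * mat_diag n s) =
      Determinant.det (1\<^sub>m d + mat_diag d s' * KM)"
    using det_one_plus_mult_commute[of A n d B] by simp
  also have "\<dots> = Determinant.det (1\<^sub>m d + KM * mat_diag d s')"
    by (rule det_one_plus_mult_commute) auto
  finally show ?thesis unfolding KM_def s'_def .
qed

text \<open>
  A permanental process with a finite set of times. The indices \<open>t i\<close> may repeat and need not
  exhaust \<open>T\<close>, which lets families over different \<open>T\<close> be compared. The sample space is the one on
  which the gamma mixtures live.
\<close>

definition permanental_on :: "real \<Rightarrow> 't set \<Rightarrow> ('t \<Rightarrow> 't \<Rightarrow> real) \<Rightarrow> bool"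
  where "permanental_on \<alpha> T k \<longleftrightarrow> (\<exists>(N :: (nat \<Rightarrow> real) measure) W. prob_space N \<and>
    (\<forall>t\<in>T. W t \<in> borel_measurable N) \<and> (\<forall>t \<omega>. 0 \<le> W t \<omega>) \<and>
    (\<forall>n t s. (\<forall>i<n. t i \<in> T \<and> 0 < s i) \<longrightarrow> (\<integral>\<omega>. exp (- (\<Sum>i<n. s i * W (t i) \<omega>)) \<partial>N) =
        Determinant.det (1\<^sub>m n + Matrix.mat n n (\<lambda>(i, j). k (t i) (t j)) * mat_diag n s) powr (- \<alpha>)))"

lemma permanental_on_of_inverse_M_matrix:
  fixes e :: "nat \<Rightarrow> 't" and K :: "'t \<Rightarrow> 't \<Rightarrow> real"
  assumes \<alpha>: "0 < \<alpha>" and e: "bij_betw e {..<d} T"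
    and BK: "\<And>i j. i < d \<Longrightarrow> j < d \<Longrightarrow> (\<Sum>k<d. B i k * K (e k) (e j)) = (if i = j then 1 else 0)"
    and off: "\<And>i j. i < d \<Longrightarrow> j < d \<Longrightarrow> i \<noteq> j \<Longrightarrow> B i j \<le> 0"
    and K: "\<And>i j. i < d \<Longrightarrow> j < d \<Longrightarrow> 0 < K (e i) (e j)"
  shows "permanental_on \<alpha> T K"
proof -
  have "\<exists>(N :: (nat \<Rightarrow> real) measure) Y. prob_space N \<and>
    (\<forall>i<d. Y i \<in> borel_measurable N \<and> (\<forall>\<omega>. 0 \<le> Y i \<omega>)) \<and>
    (\<forall>s. (\<forall>i<d. 0 \<le> s i) \<longrightarrow> (\<integral>\<omega>. exp (- (\<Sum>i<d. s i * Y i \<omega>)) \<partial>N) =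
        Determinant.det (1\<^sub>m d + Matrix.mat d d (\<lambda>(i, j). K (e i) (e j)) * mat_diag d s) powr (- \<alpha>))"
    by (rule inverse_M_matrix_permanental[where B = B]) (fact \<alpha> BK off K)+
  then obtain N :: "(nat \<Rightarrow> real) measure" and Y where N: "prob_space N"
    and Y': "\<forall>i<d. Y i \<in> borel_measurable N \<and> (\<forall>\<omega>. 0 \<le> Y i \<omega>)"
    and L: "\<forall>s. (\<forall>i<d. 0 \<le> s i) \<longrightarrow> (\<integral>\<omega>. exp (- (\<Sum>i<d. s i * Y i \<omega>)) \<partial>N) =
        Determinant.det (1\<^sub>m d + Matrix.mat d d (\<lambda>(i, j). K (e i) (e j)) * mat_diag d s) powr (- \<alpha>)"
    by (elim exE conjE)
  have Y: "Y i \<in> borel_measurable N" "0 \<le> Y i \<omega>" if "i < d" for i \<omega>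
    using Y' that by auto
  define r where "r = inv_into {..<d} e"
  have r: "r t < d" "e (r t) = t" if "t \<in> T" for t
    using that bij_betw_inv_into_right[OF e] inv_into_into[of t e "{..<d}"] e unfolding r_def bij_betw_def by auto
  define W where "W t \<omega> = (if t \<in> T then Y (r t) \<omega> else 0)" for t \<omega>
  have "(\<integral>\<omega>. exp (- (\<Sum>i<n. s i * W (t i) \<omega>)) \<partial>N) =
      Determinant.det (1\<^sub>m n + Matrix.mat n n (\<lambda>(i, j). K (t i) (t j)) * mat_diag n s) powr (- \<alpha>)"
    if ts: "\<forall>i<n. t i \<in> T \<and> 0 < s i" for n t s
  proof -
    let ?s = "\<lambda>a. \<Sum>i | i < n \<and> r (t i) = a. s i"
    have "(\<Sum>i<n. s i * W (t i) \<omega>) = (\<Sum>a<d. ?s a * Y a \<omega>)" for \<omega>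
    proof -
      have "(\<Sum>i<n. s i * W (t i) \<omega>) = (\<Sum>i<n. s i * Y (r (t i)) \<omega>)"
        using ts unfolding W_def by (intro sum.cong) auto
      also have "\<dots> = (\<Sum>a<d. \<Sum>i\<in>{i\<in>{..<n}. r (t i) = a}. s i * Y (r (t i)) \<omega>)"
        using ts r by (intro sum.group[symmetric]) auto
      also have "\<dots> = (\<Sum>a<d. ?s a * Y a \<omega>)"
        by (intro sum.cong refl) (auto simp: sum_distrib_right intro!: sum.cong)
      finally show ?thesis .
    qed
    moreover have "\<forall>a<d. 0 \<le> ?s a"
      using ts by (intro allI impI sum_nonneg less_imp_le) auto
    ultimately have "(\<integral>\<omega>. exp (- (\<Sum>i<n. s i * W (t i) \<omega>)) \<partial>N) =
        Determinant.det (1\<^sub>m d + Matrix.mat d d (\<lambda>(i, j). K (e i) (e j)) * mat_diag d ?s) powr (- \<alpha>)"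
      using L[rule_format, of ?s] by simp
    also have "Determinant.det (1\<^sub>m d + Matrix.mat d d (\<lambda>(i, j). K (e i) (e j)) * mat_diag d ?s) =
       Determinant.det (1\<^sub>m n + Matrix.mat n n (\<lambda>(i, j). K (e (r (t i))) (e (r (t j)))) * mat_diag n s)"
      using ts r by (intro det_reindex[symmetric]) auto
    also have "Matrix.mat n n (\<lambda>(i, j). K (e (r (t i))) (e (r (t j)))) = Matrix.mat n n (\<lambda>(i, j). K (t i) (t j))"
      using ts r by (intro eq_matI) auto
    finally show ?thesis .
  qed
  moreover have "\<forall>t\<in>T. W t \<in> borel_measurable N" "\<forall>t \<omega>. 0 \<le> W t \<omega>"
    using Y r unfolding W_def by auto
  ultimately show ?thesis unfolding permanental_on_def using N by blast
qed

lemma truncated_bits: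
  assumes "\<And>k. x (t, k) = binary_digit k y" "0 \<le> y" "y < 1"
  shows "\<bar>truncated L x t - y\<bar> \<le> 1 / 2 ^ L"
proof -
  have "unit_bit (binary_digit k y) = binary_digit k y" for k
    using binary_digit_cases[of k y] by (auto simp: unit_bit_def)
  then show ?thesis
    using binary_truncation_close[OF assms(2,3)] unfolding truncated_def assms(1) by simp
qed

lemma truncated_measurable:
  assumes "\<And>k. k < L \<Longrightarrow> (\<lambda>\<omega>. f \<omega> (t, k)) \<in> borel_measurable M"
  shows "(\<lambda>\<omega>. truncated L (f \<omega>) t) \<in> borel_measurable M"
  unfolding truncated_def
  using assms by (intro borel_measurable_sum borel_measurable_divide borel_measurable_const
      measurable_compose[OF _ unit_bit_measurable]) auto

text \<open>
  With \<open>y\<^sub>t = 1 - exp(-Z\<^sub>t)\<close>, the Laplace transform \<open>exp(-\<Sum>s\<^sub>i Z(t\<^sub>i))\<close> is the product of the powers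
  \<open>(1 - y(t\<^sub>i))\<^bsup>s\<^sub>i\<^esup>\<close>; here \<open>y\<close> is truncated to \<open>L\<close> binary digits.
\<close>

definition laplace_trunc :: "nat \<Rightarrow> nat \<Rightarrow> (nat \<Rightarrow> 't) \<Rightarrow> (nat \<Rightarrow> real) \<Rightarrow> ('t \<times> nat \<Rightarrow> real) \<Rightarrow> real"
  where "laplace_trunc L n t s x = (\<Prod>i<n. (1 - truncated L x (t i)) powr s i)"

lemma one_minus_powr_bounds: "0 \<le> a \<Longrightarrow> a \<le> 1 \<Longrightarrow> 0 < (s::real) \<Longrightarrow> 0 \<le> (1 - a) powr s \<and> (1 - a) powr s \<le> (1::real)"
  by (auto intro: powr_le1)

text \<open>
  The approximations are indexed by a finite set of times and a precision, and any two finite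
  sets are dominated by a third; along this filter the laws of the digits of
  \<open>y\<^sub>t = 1 - exp(-Z\<^sub>t) \<in> [0, 1)\<close> have a cluster point. Since \<open>(1 - y)\<^sup>s\<close> is continuous on the compact
  interval \<open>[0, 1]\<close>, truncation to \<open>L\<close> digits changes Laplace transforms by an amount that is small
  uniformly in the approximation, and so the limit process has the limits of the Laplace transforms.
  No mass escapes to \<open>y = 1\<close>, that is to \<open>Z = \<infinity>\<close>, because \<open>|1 + k(t,t)s|\<^sup>-\<^sup>\<alpha> \<rightarrow> 1\<close> as \<open>s \<rightarrow> 0\<close>.
\<close>

theorem permanental_process_of_approximations:
  fixes k :: "'t \<Rightarrow> 't \<Rightarrow> real"
  assumes \<alpha>: "0 < \<alpha>"
    and approx: "\<And>T \<delta>. finite T \<Longrightarrow> 0 < \<delta> \<Longrightarrow>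
      \<exists>k'. (\<forall>x\<in>T. \<forall>y\<in>T. \<bar>k' x y - k x y\<bar> < \<delta>) \<and> permanental_on \<alpha> T k'"
  shows "permanental_process_kernel \<alpha> k"
proof -
  \<comment> \<open>The filter eventually avoids infinite index sets; they stand for the empty set.\<close>
  define F where "F l = (if finite (fst l) then fst l else {})" for l :: "'t set \<times> nat"
  define good where "good l k' N W \<longleftrightarrow> (\<forall>x\<in>F l. \<forall>y\<in>F l. \<bar>k' x y - k x y\<bar> < 1 / real (Suc (snd l))) \<and>
    prob_space N \<and> (\<forall>t\<in>F l. W t \<in> borel_measurable N) \<and> (\<forall>t \<omega>. 0 \<le> W t \<omega>) \<and>
    (\<forall>n t s. (\<forall>i<n. t i \<in> F l \<and> 0 < s i) \<longrightarrow> (\<integral>\<omega>. exp (- (\<Sum>i<n. s i * W (t i) \<omega>)) \<partial>N) =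
        Determinant.det (1\<^sub>m n + Matrix.mat n n (\<lambda>(i, j). k' (t i) (t j)) * mat_diag n s) powr (- \<alpha>))"
    for l k' and N :: "(nat \<Rightarrow> real) measure" and W
  have "\<exists>k' N W. good l k' N W" for l
  proof -
    have "finite (F l)" "0 < 1 / real (Suc (snd l))" unfolding F_def by auto
    from approx[OF this] show ?thesis unfolding good_def permanental_on_def by blast
  qed
  then have "\<forall>l. \<exists>z. good l (fst z) (fst (snd z)) (snd (snd z))" by (metis fst_conv snd_conv)
  from choice[OF this] obtain z where z: "\<And>l. good l (fst (z l)) (fst (snd (z l))) (snd (snd (z l)))" by blast
  define k' where "k' l = fst (z l)" for l
  define N where "N l = fst (snd (z l))" for l
  define W where "W l = snd (snd (z l))" for l
  have good: "good l (k' l) (N l) (W l)" for l unfolding k'_def N_def W_def by (rule z)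
  have k': "\<bar>k' l x y - k x y\<bar> < 1 / real (Suc (snd l))" if "x \<in> F l" "y \<in> F l" for l x y
    using good[of l] that unfolding good_def by blast
  have N: "prob_space (N l)" for l
    using good[of l] unfolding good_def by blast
  have W: "t \<in> F l \<Longrightarrow> W l t \<in> borel_measurable (N l)" "0 \<le> W l t \<omega>" for l t \<omega>
    using good[of l] unfolding good_def by blast+
  have laplace: "(\<integral>\<omega>. exp (- (\<Sum>i<n. s i * W l (t i) \<omega>)) \<partial>N l) =
        Determinant.det (1\<^sub>m n + Matrix.mat n n (\<lambda>(i, j). k' l (t i) (t j)) * mat_diag n s) powr (- \<alpha>)"
    if "\<forall>i<n. t i \<in> F l \<and> 0 < s i" for l n t s
    using good[of l] that unfolding good_def by blast
  define \<Phi> where "\<Phi> = (finite_subsets_at_top (UNIV :: 't set) \<times>\<^sub>F sequentially)"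
  have \<Phi>: "\<Phi> \<noteq> bot" unfolding \<Phi>_def by (simp add: prod_filter_eq_bot)
  have ev_F: "eventually (\<lambda>l. G \<subseteq> F l) \<Phi>" if "finite G" for G
    unfolding \<Phi>_def eventually_prod_filter
  proof (intro exI conjI allI impI)
    show "eventually (\<lambda>T. finite T \<and> G \<subseteq> T) (finite_subsets_at_top UNIV)"
      unfolding eventually_finite_subsets_at_top using that by blast
    show "eventually (\<lambda>_. True) sequentially" by simp
  qed (simp add: F_def)
  have ev_m: "eventually (\<lambda>l. 1 / real (Suc (snd l)) < \<epsilon>) \<Phi>" if "0 < \<epsilon>" for \<epsilon>
    unfolding \<Phi>_def eventually_prod_filter
  proof (intro exI conjI allI impI)
    show "eventually (\<lambda>_. True) (finite_subsets_at_top UNIV)" by simp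
    show "eventually (\<lambda>m. 1 / real (Suc m) < \<epsilon>) sequentially"
      using order_tendstoD(2)[OF LIMSEQ_Suc[OF lim_1_over_n] that] .
  qed simp
  define y where "y l t \<omega> = 1 - exp (- W l t \<omega>)" for l t \<omega>
  have y: "0 \<le> y l t \<omega>" "y l t \<omega> < 1" for l t \<omega>
    unfolding y_def using W(2)[of l t \<omega>] by auto
  define b where "b l \<omega> j = (if fst j \<in> F l then binary_digit (snd j) (y l (fst j) \<omega>) else 0)" for l \<omega> j
  have b01: "b l \<omega> j = 0 \<or> b l \<omega> j = 1" for l \<omega> j
    unfolding b_def using binary_digit_cases by auto
  have b_meas: "(\<lambda>\<omega>. b l \<omega> j) \<in> borel_measurable (N l)" for l j
  proof (cases "fst j \<in> F l")
    case True
    note W(1)[OF True, measurable]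
    show ?thesis unfolding b_def y_def using True by simp
  qed (simp add: b_def)
  define q where "q l A = measure (N l) {\<omega>\<in>space (N l). b l \<omega> \<in> A}" for l A
  have q01: "q l A \<in> {0..1}" for l A
    unfolding q_def using prob_space.prob_le_1[OF N] by simp
  have E_b: "(\<integral>\<omega>. h (b l \<omega>) \<partial>N l) = (\<Sum>\<sigma>\<in>bit_strings J. h \<sigma> * q l (cylinder J \<sigma>))"
    if "finite J" "\<And>x. h x = h (restrict x J)" for l J h
    unfolding q_def using that b_meas b01 by (intro expectation_of_bits N) auto
  obtain \<Psi> p where \<Psi>: "\<Psi> \<le> \<Phi>" "\<Psi> \<noteq> bot" and p: "\<And>A. ((\<lambda>l. q l A) \<longlongrightarrow> p A) \<Psi>"
    by (rule cluster_filter[OF \<Phi> q01]) (rule that)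
  have lim_sum: "((\<lambda>l. \<Sum>\<sigma>\<in>S. h \<sigma> * q l (C \<sigma>)) \<longlongrightarrow> (\<Sum>\<sigma>\<in>S. h \<sigma> * p (C \<sigma>))) \<Psi>" for S h C
    by (intro tendsto_sum tendsto_mult tendsto_const p)
  have "consistent_weights p"
    unfolding consistent_weights_def
  proof (intro conjI allI impI)
    show "0 \<le> p A" for A
      using q01 by (intro tendsto_lowerbound[OF p[of A] _ \<Psi>(2)] always_eventually allI) auto
  next
    fix J :: "('t \<times> nat) set" assume J: "finite J"
    have "(\<Sum>\<sigma>\<in>bit_strings J. 1 * q l (cylinder J \<sigma>)) = 1" for l
      using E_b[OF J, of "\<lambda>_. 1" l] prob_space.prob_space[OF N[of l]] by simp
    then have "((\<lambda>l. 1) \<longlongrightarrow> (\<Sum>\<sigma>\<in>bit_strings J. 1 * p (cylinder J \<sigma>))) \<Psi>"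
      using lim_sum[of "\<lambda>_. 1" "cylinder J" "bit_strings J"] by simp
    from tendsto_unique[OF \<Psi>(2) this tendsto_const]
    show "(\<Sum>\<sigma>\<in>bit_strings J. p (cylinder J \<sigma>)) = 1" by simp
  next
    fix J H :: "('t \<times> nat) set" and \<sigma> assume JH: "J \<subseteq> H" "finite H" "\<sigma> \<in> bit_strings J"
    let ?S = "{\<tau>\<in>bit_strings H. restrict \<tau> J = \<sigma>}"
    have "q l (cylinder J \<sigma>) = (\<Sum>\<tau>\<in>?S. q l (cylinder H \<tau>))" for l
    proof -
      interpret prob_space "N l" by (rule N)
      have "(\<integral>\<omega>. indicator (cylinder J \<sigma>) (b l \<omega>) \<partial>N l) = (\<integral>\<omega>. indicator {\<omega>\<in>space (N l). b l \<omega> \<in> cylinder J \<sigma>} \<omega> \<partial>N l)"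
        by (intro Bochner_Integration.integral_cong) (auto simp: indicator_def)
      also have "\<dots> = q l (cylinder J \<sigma>)"
        unfolding q_def by (simp add: Int_def conj_commute)
      finally have "q l (cylinder J \<sigma>) = (\<integral>\<omega>. indicator (cylinder J \<sigma>) (b l \<omega>) \<partial>N l)" by simp
      also have "\<dots> = (\<Sum>\<tau>\<in>bit_strings H. indicator (cylinder J \<sigma>) \<tau> * q l (cylinder H \<tau>))"
      proof (rule E_b[OF JH(2)])
        fix x :: "'t \<times> nat \<Rightarrow> real"
        show "(indicator (cylinder J \<sigma>) x :: real) = indicator (cylinder J \<sigma>) (restrict x H)"
          using JH(1) by (auto simp: cylinder_def indicator_def)
      qed
      also have "\<dots> = (\<Sum>\<tau>\<in>bit_strings H. if restrict \<tau> J = \<sigma> then q l (cylinder H \<tau>) else 0)"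
        using cylinder_iff_restrict[OF JH(3)] by (intro sum.cong) (auto simp: indicator_def)
      also have "\<dots> = (\<Sum>\<tau>\<in>?S. q l (cylinder H \<tau>))"
        using finite_bit_strings[OF JH(2)] by (simp add: sum.inter_filter)
      finally show ?thesis .
    qed
    then have "((\<lambda>l. q l (cylinder J \<sigma>)) \<longlongrightarrow> (\<Sum>\<tau>\<in>?S. 1 * p (cylinder H \<tau>))) \<Psi>"
      using lim_sum[of "\<lambda>_. 1" "cylinder H" ?S] by simp
    from tendsto_unique[OF \<Psi>(2) p this]
    show "p (cylinder J \<sigma>) = (\<Sum>\<tau>\<in>?S. p (cylinder H \<tau>))" by simp
  qed
  from this obtain M :: "('t \<times> nat \<Rightarrow> real) measure" where M: "prob_space M"
    and sets_M: "sets M = sets (PiM UNIV (\<lambda>_. borel))"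
    and E_M: "\<And>J h. finite J \<Longrightarrow> h \<in> borel_measurable (PiM J (\<lambda>_. borel)) \<Longrightarrow>
      (\<integral>x. h (restrict x J) \<partial>M) = (\<Sum>\<sigma>\<in>bit_strings J. h \<sigma> * p (cylinder J \<sigma>))"
    by (rule measure_of_consistent_weights) (rule that)
  interpret M: prob_space M by (rule M)
  have comp: "(\<lambda>x. x j) \<in> borel_measurable M" for j
    using measurable_component_singleton[of j UNIV "\<lambda>_. borel :: real measure"]
    by (simp add: measurable_cong_sets[OF sets_M refl])
  have trunc_meas [measurable]: "(\<lambda>x. truncated L x t) \<in> borel_measurable M" for L t
    by (intro truncated_measurable comp)
  have value_meas [measurable]: "(\<lambda>x. bits_value x t) \<in> borel_measurable M" for t
    by (rule borel_measurable_LIMSEQ_real[OF truncated_tendsto trunc_meas])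
  define D where "D n t s = Determinant.det (1\<^sub>m n + Matrix.mat n n (\<lambda>(i, j). k (t i) (t j)) * mat_diag n s)" for n t s
  have lim_laplace: "((\<lambda>l. \<integral>\<omega>. exp (- (\<Sum>i<n. s i * W l (t i) \<omega>)) \<partial>N l) \<longlongrightarrow> D n t s powr (- \<alpha>)) \<Psi>"
    if s: "\<And>i. i < n \<Longrightarrow> 0 < s i" for n t s
  proof -
    let ?E = "\<lambda>l. \<integral>\<omega>. exp (- (\<Sum>i<n. s i * W l (t i) \<omega>)) \<partial>N l"
    let ?D = "\<lambda>l. Determinant.det (1\<^sub>m n + Matrix.mat n n (\<lambda>(i, j). k' l (t i) (t j)) * mat_diag n s)"
    have evF: "eventually (\<lambda>l. t ` {..<n} \<subseteq> F l) \<Psi>"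
      by (rule filter_leD[OF \<Psi>(1)], rule ev_F) simp
    have lim_k: "((\<lambda>l. k' l (t i) (t j)) \<longlongrightarrow> k (t i) (t j)) \<Psi>" if ij: "i < n" "j < n" for i j
    proof (rule tendstoI)
      fix \<epsilon> :: real assume "0 < \<epsilon>"
      from filter_leD[OF \<Psi>(1) ev_m[OF this]] evF
      show "eventually (\<lambda>l. dist (k' l (t i) (t j)) (k (t i) (t j)) < \<epsilon>) \<Psi>"
      proof eventually_elim
        case (elim l)
        then have "\<bar>k' l (t i) (t j) - k (t i) (t j)\<bar> < 1 / real (Suc (snd l))"
          using ij by (intro k') auto
        with elim show ?case by (simp add: dist_real_def)
      qed
    qed
    have lim_D: "(?D \<longlongrightarrow> D n t s) \<Psi>"
      unfolding D_def one_plus_mult_diag by (intro det_tendsto tendsto_intros lim_k)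
    have ev_E: "eventually (\<lambda>l. ?E l = ?D l powr (- \<alpha>)) \<Psi>"
      using evF by eventually_elim (rule laplace, use s in auto)
    \<comment> \<open>The power \<open>-\<alpha>\<close> is continuous away from 0. The approximating determinants stay away from 0
      since their powers are Laplace transforms, with values in \<open>(0, 1]\<close>.\<close>
    have "eventually (\<lambda>l. 1 \<le> \<bar>?D l\<bar>) \<Psi>"
      using evF ev_E
    proof eventually_elim
      case (elim l)
      interpret prob_space "N l" by (rule N)
      let ?e = "\<lambda>\<omega>. exp (- (\<Sum>i<n. s i * W l (t i) \<omega>))"
      have "(\<lambda>\<omega>. \<Sum>i<n. s i * W l (t i) \<omega>) \<in> borel_measurable (N l)"
        using elim(1) by (intro borel_measurable_sum borel_measurable_times borel_measurable_const W(1)) auto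
      then have meas: "?e \<in> borel_measurable (N l)" by measurable
      have le1: "?e \<omega> \<le> 1" for \<omega>
      proof -
        have "0 \<le> (\<Sum>i<n. s i * W l (t i) \<omega>)"
          by (intro sum_nonneg mult_nonneg_nonneg W(2) less_imp_le[OF s]) auto
        then show ?thesis by simp
      qed
      have int: "integrable (N l) ?e"
        using meas le1 by (intro integrable_const_bound[where B = 1]) auto
      have "?E l \<le> 1"
        using integral_le_const[OF int, of 1] le1 by simp
      moreover have "0 < ?E l"
      proof -
        have ne: "?E l \<noteq> 0"
        proof
          assume "?E l = 0"
          then have "AE \<omega> in N l. ?e \<omega> = 0"
            using integral_nonneg_eq_0_iff_AE[OF int] by simp
          then show False by simp
        qed
        have nn: "0 \<le> ?E l" by (rule Bochner_Integration.integral_nonneg) simp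
        show ?thesis by (rule le_neq_trans[OF nn ne[symmetric]])
      qed
      ultimately have *: "0 < ?D l powr (- \<alpha>)" "?D l powr (- \<alpha>) \<le> 1" using elim(2) by auto
      show "1 \<le> \<bar>?D l\<bar>"
      proof (rule ccontr)
        assume "\<not> 1 \<le> \<bar>?D l\<bar>"
        moreover have "?D l \<noteq> 0" using *(1) by auto
        ultimately have "1 < \<bar>?D l\<bar> powr (- \<alpha>)"
          using \<alpha> powr_less_mono2_neg[of "- \<alpha>" "\<bar>?D l\<bar>" 1] by simp
        moreover have "\<bar>?D l\<bar> powr (- \<alpha>) = ?D l powr (- \<alpha>)"
          by (auto simp: powr_def abs_if ln_minus)
        ultimately show False using *(2) by simp
      qed
    qed
    then have "1 \<le> \<bar>D n t s\<bar>"
      by (intro tendsto_lowerbound[OF tendsto_rabs[OF lim_D] _ \<Psi>(2)])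
    then have "((\<lambda>l. ?D l powr (- \<alpha>)) \<longlongrightarrow> D n t s powr (- \<alpha>)) \<Psi>"
      by (intro tendsto_powr lim_D tendsto_const) auto
    then show ?thesis
      using tendsto_cong[OF ev_E] by blast
  qed
  have laplace_M: "(\<integral>x. (\<Prod>i<n. (1 - bits_value x (t i)) powr s i) \<partial>M) = D n t s powr (- \<alpha>)"
    if s: "\<And>i. i < n \<Longrightarrow> 0 < s i" for n t s
  proof -
    define h where "h L = laplace_trunc L n t s" for L
    have h_factor: "0 \<le> (1 - truncated L x (t i)) powr s i \<and> (1 - truncated L x (t i)) powr s i \<le> 1" if "i < n" for L x i
      by (intro one_minus_powr_bounds truncated_bounds s that)
    have h_bound: "\<bar>h L x\<bar> \<le> 1" for L x
    proof -
      have "0 \<le> h L x" "h L x \<le> 1" unfolding h_def laplace_trunc_def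
        using h_factor by (auto intro!: prod_nonneg prod_le_1)
      then show ?thesis by simp
    qed
    have h_meas [measurable]: "h L \<in> borel_measurable M" for L
      unfolding h_def laplace_trunc_def by measurable
    have lim_h: "(\<lambda>L. \<integral>x. h L x \<partial>M) \<longlonglongrightarrow> (\<integral>x. (\<Prod>i<n. (1 - bits_value x (t i)) powr s i) \<partial>M)"
    proof (rule integral_dominated_convergence[where w = "\<lambda>_. 1"])
      show "AE x in M. (\<lambda>L. h L x) \<longlonglongrightarrow> (\<Prod>i<n. (1 - bits_value x (t i)) powr s i)"
        unfolding h_def laplace_trunc_def
        using s truncated_bounds
        by (intro AE_I2 tendsto_prod tendsto_powr' tendsto_diff tendsto_const truncated_tendsto)
          (auto intro!: always_eventually)
      show "AE x in M. norm (h L x) \<le> 1" for L using h_bound by simp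
    qed measurable
    have close: "\<bar>(\<integral>x. h L x \<partial>M) - D n t s powr (- \<alpha>)\<bar> \<le> real n * \<epsilon>"
      if "0 < \<delta>" and \<delta>: "\<And>i a b. i < n \<Longrightarrow> a \<in> {0..1} \<Longrightarrow> b \<in> {0..1} \<Longrightarrow> \<bar>a - b\<bar> < \<delta> \<Longrightarrow> \<bar>a powr s i - b powr s i\<bar> < \<epsilon>"
        and L: "1 / 2 ^ L < \<delta>" for L \<delta> \<epsilon>
    proof -
      let ?J = "t ` {..<n} \<times> {..<L}"
      have J: "finite ?J" by simp
      have h_restrict: "h L x = h L (restrict x ?J)" for x
        unfolding h_def laplace_trunc_def truncated_def by (intro prod.cong refl) simp
      have h_J: "h L \<in> borel_measurable (PiM ?J (\<lambda>_. borel))"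
      proof -
        have "(\<lambda>x. truncated L x (t i)) \<in> borel_measurable (PiM ?J (\<lambda>_. borel))" if "i < n" for i
          using that by (intro truncated_measurable measurable_component_singleton) auto
        then show ?thesis unfolding h_def laplace_trunc_def
          by (intro borel_measurable_prod powr_real_measurable borel_measurable_diff borel_measurable_const) auto
      qed
      have "(\<integral>x. h L x \<partial>M) = (\<integral>x. h L (restrict x ?J) \<partial>M)"
        by (rule Bochner_Integration.integral_cong[OF refl h_restrict])
      also have "\<dots> = (\<Sum>\<sigma>\<in>bit_strings ?J. h L \<sigma> * p (cylinder ?J \<sigma>))"
        by (rule E_M[OF J h_J])
      finally have "((\<lambda>l. \<integral>\<omega>. h L (b l \<omega>) \<partial>N l) \<longlongrightarrow> (\<integral>x. h L x \<partial>M)) \<Psi>"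
        using lim_sum[of "h L" "cylinder ?J" "bit_strings ?J"] E_b[OF J, of "h L"] h_restrict by simp
      from tendsto_rabs[OF tendsto_diff[OF this lim_laplace[of n s t]]] s
      have lim: "((\<lambda>l. \<bar>(\<integral>\<omega>. h L (b l \<omega>) \<partial>N l) - (\<integral>\<omega>. exp (- (\<Sum>i<n. s i * W l (t i) \<omega>)) \<partial>N l)\<bar>)
          \<longlongrightarrow> \<bar>(\<integral>x. h L x \<partial>M) - D n t s powr (- \<alpha>)\<bar>) \<Psi>" by simp
      have "eventually (\<lambda>l. t ` {..<n} \<subseteq> F l) \<Psi>"
        by (rule filter_leD[OF \<Psi>(1)], rule ev_F) simp
      then have "eventually (\<lambda>l. \<bar>(\<integral>\<omega>. h L (b l \<omega>) \<partial>N l) - (\<integral>\<omega>. exp (- (\<Sum>i<n. s i * W l (t i) \<omega>)) \<partial>N l)\<bar> \<le> real n * \<epsilon>) \<Psi>"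
      proof eventually_elim
        case (elim l)
        interpret prob_space "N l" by (rule N)
        let ?e = "\<lambda>\<omega>. exp (- (\<Sum>i<n. s i * W l (t i) \<omega>))"
        have "(\<lambda>\<omega>. \<Sum>i<n. s i * W l (t i) \<omega>) \<in> borel_measurable (N l)"
          using elim(1) by (intro borel_measurable_sum borel_measurable_times borel_measurable_const W(1)) auto
        then have e_meas: "?e \<in> borel_measurable (N l)" by measurable
        have e_le1: "?e \<omega> \<le> 1" for \<omega>
      proof -
        have "0 \<le> (\<Sum>i<n. s i * W l (t i) \<omega>)"
          by (intro sum_nonneg mult_nonneg_nonneg W(2) less_imp_le[OF s]) auto
        then show ?thesis by simp
      qed
        have int_e: "integrable (N l) ?e"
          using e_meas e_le1 by (intro integrable_const_bound[where B = 1]) auto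
        have tr_meas: "(\<lambda>\<omega>. truncated L (b l \<omega>) (t i)) \<in> borel_measurable (N l)" for i
          by (intro truncated_measurable b_meas)
        have "(\<lambda>\<omega>. h L (b l \<omega>)) \<in> borel_measurable (N l)"
          unfolding h_def laplace_trunc_def
          by (intro borel_measurable_prod powr_real_measurable borel_measurable_diff borel_measurable_const tr_meas)
        then have int_h: "integrable (N l) (\<lambda>\<omega>. h L (b l \<omega>))"
          using h_bound by (intro integrable_const_bound[where B = 1]) auto
        have pointwise: "\<bar>h L (b l \<omega>) - ?e \<omega>\<bar> \<le> real n * \<epsilon>" for \<omega>
        proof -
          have y_factor: "0 \<le> (1 - y l (t i) \<omega>) powr s i \<and> (1 - y l (t i) \<omega>) powr s i \<le> 1" if "i < n" for i
            using y[of l "t i" \<omega>] s[OF that] by (intro one_minus_powr_bounds) auto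
          have e_prod: "?e \<omega> = (\<Prod>i<n. (1 - y l (t i) \<omega>) powr s i)"
            unfolding y_def by (simp add: exp_sum sum_negf[symmetric] powr_def mult.commute)
          have "\<bar>h L (b l \<omega>) - ?e \<omega>\<bar> \<le> (\<Sum>i<n. \<bar>(1 - truncated L (b l \<omega>) (t i)) powr s i - (1 - y l (t i) \<omega>) powr s i\<bar>)"
            unfolding e_prod unfolding h_def laplace_trunc_def
            by (rule abs_prod_diff_le_sum) (use h_factor y_factor in auto)
          also have "\<dots> \<le> (\<Sum>i<n. \<epsilon>)"
          proof (intro sum_mono less_imp_le \<delta>)
            fix i assume i: "i \<in> {..<n}"
            have "\<bar>truncated L (b l \<omega>) (t i) - y l (t i) \<omega>\<bar> \<le> 1 / 2 ^ L"
              using elim i y by (intro truncated_bits) (auto simp: b_def)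
            then show "\<bar>(1 - truncated L (b l \<omega>) (t i)) - (1 - y l (t i) \<omega>)\<bar> < \<delta>" using L by simp
            show "1 - truncated L (b l \<omega>) (t i) \<in> {0..1}" "1 - y l (t i) \<omega> \<in> {0..1}"
              using truncated_bounds[of L "b l \<omega>" "t i"] y[of l "t i" \<omega>] by auto
          qed simp
          finally show ?thesis by simp
        qed
        have "\<bar>(\<integral>\<omega>. h L (b l \<omega>) \<partial>N l) - (\<integral>\<omega>. ?e \<omega> \<partial>N l)\<bar> = \<bar>\<integral>\<omega>. h L (b l \<omega>) - ?e \<omega> \<partial>N l\<bar>"
          using int_e int_h by simp
        also have "\<dots> \<le> (\<integral>\<omega>. \<bar>h L (b l \<omega>) - ?e \<omega>\<bar> \<partial>N l)" by (rule integral_abs_bound)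
        also have "\<dots> \<le> real n * \<epsilon>"
          using pointwise int_e int_h by (intro integral_le_const) auto
        finally show ?case .
      qed
      then show ?thesis by (rule tendsto_upperbound[OF lim _ \<Psi>(2)])
    qed
    have bound: "\<bar>(\<integral>x. (\<Prod>i<n. (1 - bits_value x (t i)) powr s i) \<partial>M) - D n t s powr (- \<alpha>)\<bar> \<le> real n * \<epsilon>" if "0 < \<epsilon>" for \<epsilon>
    proof -
      have "\<exists>\<delta>>0. i < n \<longrightarrow> (\<forall>a\<in>{0..1}. \<forall>b\<in>{0..1}. \<bar>a - b\<bar> < \<delta> \<longrightarrow> \<bar>a powr s i - b powr s i\<bar> < \<epsilon>)" for i
      proof (cases "i < n")
        case True
        from powr_uniformly_continuous[OF s[OF True] that] show ?thesis by blast
      next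
        case False
        then show ?thesis by (intro exI[of _ 1]) simp
      qed
      then obtain \<delta> where \<delta>: "\<And>i. 0 < \<delta> i" "\<And>i a b. i < n \<Longrightarrow> a \<in> {0..1} \<Longrightarrow> b \<in> {0..1} \<Longrightarrow> \<bar>a - b\<bar> < \<delta> i \<Longrightarrow> \<bar>a powr s i - b powr s i\<bar> < \<epsilon>"
        by metis
      define d where "d = Min (insert 1 (\<delta> ` {..<n}))"
      have d: "0 < d" unfolding d_def using \<delta>(1) by (subst Min_gr_iff) auto
      have d_le: "d \<le> \<delta> i" if "i < n" for i unfolding d_def using that by (intro Min_le) auto
      have "(\<lambda>L. 1 / 2 ^ L :: real) \<longlonglongrightarrow> 0"
        using LIMSEQ_power_zero[of "1 / 2 :: real"] by (simp add: power_divide)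
      then have "eventually (\<lambda>L. 1 / 2 ^ L < d) sequentially" using d by (rule order_tendstoD)
      then have "eventually (\<lambda>L. \<bar>(\<integral>x. h L x \<partial>M) - D n t s powr (- \<alpha>)\<bar> \<le> real n * \<epsilon>) sequentially"
      proof eventually_elim
        case (elim L)
        show ?case
          by (rule close[OF d _ elim]) (use \<delta>(2) d_le in \<open>meson order_less_le_trans\<close>)
      qed
      then show ?thesis
        by (intro tendsto_upperbound[OF tendsto_rabs[OF tendsto_diff[OF lim_h tendsto_const]]]) auto
    qed
    have "\<bar>(\<integral>x. (\<Prod>i<n. (1 - bits_value x (t i)) powr s i) \<partial>M) - D n t s powr (- \<alpha>)\<bar> \<le> 0"
    proof (rule field_le_epsilon)
      fix \<epsilon> :: real assume "0 < \<epsilon>"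
      then have "real n * (\<epsilon> / (real n + 1)) \<le> \<epsilon>" by (simp add: field_simps)
      with bound[of "\<epsilon> / (real n + 1)"] \<open>0 < \<epsilon>\<close>
      show "\<bar>(\<integral>x. (\<Prod>i<n. (1 - bits_value x (t i)) powr s i) \<partial>M) - D n t s powr (- \<alpha>)\<bar> \<le> 0 + \<epsilon>"
        by simp
    qed
    then show ?thesis by simp
  qed
  have finite_value: "AE x in M. bits_value x t < 1" for t
  proof -
    let ?s = "\<lambda>m. 1 / real (Suc m)"
    have s0: "?s \<longlonglongrightarrow> 0" using LIMSEQ_Suc[OF lim_1_over_n] .
    have D1: "D 1 (\<lambda>_. t) (\<lambda>_. r) = 1 + k t t * r" for r
      unfolding D_def one_plus_mult_diag by (subst det_single) auto
    have eq: "(\<integral>x. (1 - bits_value x t) powr ?s m \<partial>M) = (1 + k t t * ?s m) powr (- \<alpha>)" for m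
      using laplace_M[of 1 "\<lambda>_. ?s m" "\<lambda>_. t"] unfolding D1 by simp
    have "(\<lambda>m. (1 + k t t * ?s m) powr (- \<alpha>)) \<longlonglongrightarrow> (1 + k t t * 0) powr (- \<alpha>)"
      by (intro tendsto_powr tendsto_add tendsto_mult tendsto_const s0) simp
    moreover have "(\<lambda>m. \<integral>x. (1 - bits_value x t) powr ?s m \<partial>M) \<longlonglongrightarrow> (\<integral>x. (if bits_value x t < 1 then 1 else 0) \<partial>M)"
    proof (rule integral_dominated_convergence[where w = "\<lambda>_. 1"])
      show "AE x in M. (\<lambda>m. (1 - bits_value x t) powr ?s m) \<longlonglongrightarrow> (if bits_value x t < 1 then 1 else 0)"
      proof (rule AE_I2)
        fix x
        show "(\<lambda>m. (1 - bits_value x t) powr ?s m) \<longlonglongrightarrow> (if bits_value x t < 1 then 1 else 0)"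
        proof (cases "bits_value x t < 1")
          case True
          then have "(\<lambda>m. (1 - bits_value x t) powr ?s m) \<longlonglongrightarrow> (1 - bits_value x t) powr 0"
            by (intro tendsto_powr tendsto_const s0) auto
          then show ?thesis using True by simp
        next
          case False
          then have "bits_value x t = 1" using bits_value_bounds(2)[of x t] by simp
          then show ?thesis by simp
        qed
      qed
      show "AE x in M. norm ((1 - bits_value x t) powr ?s m) \<le> 1" for m
      proof (rule AE_I2)
        fix x
        have "0 \<le> (1 - bits_value x t) powr ?s m \<and> (1 - bits_value x t) powr ?s m \<le> 1"
          by (intro one_minus_powr_bounds bits_value_bounds) simp
        then show "norm ((1 - bits_value x t) powr ?s m) \<le> 1" by simp
      qed
    qed measurable
    ultimately have one: "(\<integral>x. (if bits_value x t < 1 then 1 else 0) \<partial>M) = (1::real)"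
      unfolding eq using LIMSEQ_unique by fastforce
    have "(\<integral>x. (if bits_value x t < 1 then 1 else 0) \<partial>M) = (\<integral>x. indicator {x\<in>space M. bits_value x t < 1} x \<partial>M)"
      by (intro Bochner_Integration.integral_cong) (auto simp: indicator_def)
    also have "\<dots> = M.prob {x\<in>space M. bits_value x t < 1}"
      by (simp add: Int_def conj_commute)
    finally have "M.prob {x\<in>space M. bits_value x t < 1} = 1" using one by simp
    then show ?thesis by (subst (asm) M.prob_Collect_eq_1) auto
  qed
  define Z where "Z x t = - ln (1 - bits_value x t)" for x :: "'t \<times> nat \<Rightarrow> real" and t :: 't
  have Z_meas: "Z \<in> M \<rightarrow>\<^sub>M PiM UNIV (\<lambda>_. borel)"
    unfolding Z_def by (intro measurable_PiM_single') (auto simp: PiE_def)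
  define R where "R = distr M (PiM UNIV (\<lambda>_. borel)) Z"
  \<comment> \<open>Coordinates of arbitrary functions may be negative; on the range of \<open>Z\<close> they are not.\<close>
  define V where "V t z = max 0 (z t)" for t and z :: "'t \<Rightarrow> real"
  have V_meas [measurable]: "V t \<in> borel_measurable (PiM UNIV (\<lambda>_. borel))" for t
    unfolding V_def by measurable
  show ?thesis
    unfolding permanental_process_kernel_def
  proof (intro exI[of _ R] exI[of _ V] allI)
    fix n and t :: "nat \<Rightarrow> 't"
    show "permanental_vector \<alpha> R n (\<lambda>i. V (t i)) (Matrix.mat n n (\<lambda>(i, j). k (t i) (t j)))"
      unfolding permanental_vector_def
    proof (intro conjI allI impI ballI)
      show "prob_space R" unfolding R_def by (rule M.prob_space_distr[OF Z_meas])
      show "Matrix.mat n n (\<lambda>(i, j). k (t i) (t j)) \<in> carrier_mat n n" by simp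
      show "V (t i) \<in> borel_measurable R" for i unfolding R_def by simp
      show "0 \<le> V (t i) \<omega>" for i \<omega> unfolding V_def by simp
      fix s :: "nat \<Rightarrow> real" assume s: "\<forall>i<n. 0 < s i"
      have "(\<integral>z. exp (- (\<Sum>i<n. s i * V (t i) z)) \<partial>R) = (\<integral>x. exp (- (\<Sum>i<n. s i * V (t i) (Z x))) \<partial>M)"
        unfolding R_def by (rule integral_distr[OF Z_meas]) measurable
      also have "\<dots> = (\<integral>x. (\<Prod>i<n. (1 - bits_value x (t i)) powr s i) \<partial>M)"
      proof (rule integral_cong_AE)
        have "AE x in M. \<forall>i<n. bits_value x (t i) < 1"
          using finite_value by (simp add: AE_all_countable)
        then show "AE x in M. exp (- (\<Sum>i<n. s i * V (t i) (Z x))) = (\<Prod>i<n. (1 - bits_value x (t i)) powr s i)"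
        proof eventually_elim
          case (elim x)
          have "V (t i) (Z x) = - ln (1 - bits_value x (t i))" if "i < n" for i
            unfolding V_def Z_def using elim that bits_value_bounds[of x "t i"] by simp
          then show ?case
            using elim by (auto simp: exp_sum sum_negf[symmetric] powr_def intro!: prod.cong)
        qed
        show "(\<lambda>x. exp (- (\<Sum>i<n. s i * V (t i) (Z x)))) \<in> borel_measurable M"
          by (rule measurable_compose[OF Z_meas]) measurable
      qed measurable
      also have "\<dots> = D n t s powr (- \<alpha>)" using s by (intro laplace_M) auto
      finally show "(\<integral>\<omega>. exp (- (\<Sum>i<n. s i * V (t i) \<omega>)) \<partial>R) =
        Determinant.det (1\<^sub>m n + Matrix.mat n n (\<lambda>(i, j). k (t i) (t j)) * mat_diag n s) powr - \<alpha>"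
        unfolding D_def .
    qed
  qed
qed

section \<open>Potential densities perturbed by excessive functions\<close>

context continuous_potential_density
begin

lemma dominates_potential:
  assumes g: "g \<in> borel_measurable borel" "\<And>y. g y < \<infinity>" "\<And>x. resolvent 0 g x < \<infinity>" and c: "0 \<le> c"
  shows "dominates n (\<lambda>i j. u (t i) (t j)) (\<lambda>i. c + enn2real (resolvent 0 g (t i)))"
  unfolding dominates_def using point_domination[OF g c] by blast

lemma dominates_const:
  assumes "0 \<le> c" shows "dominates n (\<lambda>i j. u (t i) (t j)) (\<lambda>_. c)"
proof -
  have "resolvent 0 (\<lambda>_. 0) x = 0" for x by (simp add: resolvent_def transition_def)
  then show ?thesis
    using dominates_potential[of "\<lambda>_. 0" c n t] assms by simp
qed

text \<open>
  On \<open>T\<close> replace \<open>f\<close> by a potential \<open>G\<close> and add \<open>\<eta>\<close> on the diagonal; the resulting kernel is an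
  inverse M-matrix. Its row sums are positive because \<open>u\<close> is.
\<close>

lemma approximate_by_permanental:
  assumes \<alpha>: "0 < \<alpha>" and sym: "\<And>x y. u x y = u y x"
    and f: "(\<lambda>x. ennreal (f x)) \<in> borel_measurable borel" "\<And>x. 0 \<le> f x"
    and h: "h \<in> borel_measurable borel" "\<And>x. 0 < resolvent 0 h x" "\<And>x. resolvent 0 h x < \<infinity>"
    and sup: "\<And>l x. 0 < l \<Longrightarrow> ennreal l * resolvent l (\<lambda>x. ennreal (f x)) x \<le> ennreal (f x)"
    and reg: "\<And>x. (\<lambda>n. ennreal (real (Suc n)) * resolvent (real (Suc n)) (\<lambda>x. ennreal (f x)) x) \<longlonglongrightarrow> ennreal (f x)"
    and T: "finite T" and \<delta>: "0 < \<delta>"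
  shows "\<exists>k'. (\<forall>x\<in>T. \<forall>y\<in>T. \<bar>k' x y - (u x y + f y)\<bar> < \<delta>) \<and> permanental_on \<alpha> T k'"
proof -
  define \<eta> where "\<eta> = \<delta> / 4"
  have \<eta>: "0 < \<eta>" using \<delta> unfolding \<eta>_def by simp
  obtain g where g: "g \<in> borel_measurable borel" "\<And>x. g x < \<infinity>"
    and g_le: "\<And>x. resolvent 0 g x \<le> ennreal (f x)" and g_ge: "\<And>x. x \<in> T \<Longrightarrow> ennreal (f x) \<le> resolvent 0 g x + ennreal \<eta>"
    using excessive_approx_by_potentials[OF f(1) h(1) _ sup reg h(2,3) T \<eta>] by auto
  have g_fin: "resolvent 0 g x < \<infinity>" for x
    using g_le[of x] by (rule order_le_less_trans) simp
  define G where "G x = enn2real (resolvent 0 g x)" for x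
  have G: "resolvent 0 g x = ennreal (G x)" "0 \<le> G x" for x
    using g_fin[of x] unfolding G_def by auto
  have G_le: "G x \<le> f x" for x
    using g_le[of x] f(2)[of x] unfolding G(1) by simp
  have G_ge: "f x \<le> G x + \<eta>" if "x \<in> T" for x
    using g_ge[OF that] G(2)[of x] \<eta> unfolding G(1) by (simp add: ennreal_plus[symmetric] del: ennreal_plus)
  obtain e where e: "bij_betw e {..<card T} T"
    using ex_bij_betw_nat_finite[OF T] by (auto simp: atLeast0LessThan)
  define k' where "k' x y = u x y + (if x = y then \<eta> else 0) + G y" for x y
  obtain B where B: "\<And>i j. i < card T \<Longrightarrow> j < card T \<Longrightarrow>
      (\<Sum>k<card T. B i k * (u (e k) (e j) + (if k = j then \<eta> else 0) + G (e j))) = (if i = j then 1 else 0)"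
    "\<And>i j. i < card T \<Longrightarrow> j < card T \<Longrightarrow> i \<noteq> j \<Longrightarrow> B i j \<le> (0::real)"
  proof (rule perturbed_inverse_M_matrix[where W = "\<lambda>i j. u (e i) (e j)" and g = "\<lambda>i. G (e i)" and n = "card T"])
    show "dominates (card T) (\<lambda>i j. u (e i) (e j)) (\<lambda>i. G (e i))"
      using dominates_potential[OF g g_fin order_refl] unfolding G_def by simp
  qed (use \<eta> sym G dominates_const in auto)
  have "permanental_on \<alpha> T k'"
  proof (rule permanental_on_of_inverse_M_matrix[OF \<alpha> e])
    fix i j assume ij: "i < card T" "j < card T"
    have "(\<Sum>k<card T. B i k * k' (e k) (e j)) =
        (\<Sum>k<card T. B i k * (u (e k) (e j) + (if k = j then \<eta> else 0) + G (e j)))"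
      using bij_betw_imp_inj_on[OF e] ij(2) unfolding k'_def
      by (intro sum.cong refl) (auto dest: inj_onD)
    then show "(\<Sum>k<card T. B i k * k' (e k) (e j)) = (if i = j then 1 else 0)"
      using B(1)[OF ij] by simp
    show "0 < k' (e i) (e j)"
      unfolding k'_def using positive[of "e i" "e j"] G(2)[of "e j"] \<eta> by auto
  qed (rule B(2))
  moreover have "\<bar>k' x y - (u x y + f y)\<bar> < \<delta>" if "x \<in> T" "y \<in> T" for x y
    using G_le[of y] G_ge[OF that(2)] \<delta> unfolding k'_def \<eta>_def by auto
  ultimately show ?thesis by blast
qed

theorem excessive_perturbation_permanental:
  assumes "0 < \<alpha>" and "\<And>x y. u x y = u y x"
    and "(\<lambda>x. ennreal (f x)) \<in> borel_measurable borel" "\<And>x. 0 \<le> f x"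
    and "h \<in> borel_measurable borel" "\<And>x. 0 < resolvent 0 h x" "\<And>x. resolvent 0 h x < \<infinity>"
    and "\<And>l x. 0 < l \<Longrightarrow> ennreal l * resolvent l (\<lambda>x. ennreal (f x)) x \<le> ennreal (f x)"
    and "\<And>x. (\<lambda>n. ennreal (real (Suc n)) * resolvent (real (Suc n)) (\<lambda>x. ennreal (f x)) x) \<longlonglongrightarrow> ennreal (f x)"
  shows "permanental_process_kernel \<alpha> (\<lambda>x y. u x y + f y)"
  using permanental_process_of_approximations[OF assms(1) approximate_by_permanental[OF assms]] .

end

section \<open>The semigroup of a Borel right process\<close>

lemma space_cemetery_borel [simp]: "space cemetery_borel = UNIV"
  unfolding cemetery_borel_def by (simp add: space_measure_of_conv)

lemma sets_cemetery_borel: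
  "sets cemetery_borel = sigma_sets UNIV {U. openin (Alexandroff_compactification euclidean) U}"
  unfolding cemetery_borel_def by (rule sets_measure_of) auto

lemma Some_image_cemetery_borel:
  assumes "B \<in> sets borel" shows "Some ` B \<in> sets cemetery_borel"
proof -
  have "Some ` B \<in> sets cemetery_borel" if "B \<in> sigma_sets UNIV {S. open S}"
    using that
  proof induction
    case (Basic B)
    then show ?case unfolding sets_cemetery_borel by (intro sigma_sets.Basic) simp
  next
    case Empty
    show ?case by simp
  next
    case (Compl B)
    have "Some ` (UNIV :: 'a set) \<in> sets cemetery_borel"
      unfolding sets_cemetery_borel by (intro sigma_sets.Basic) (auto simp: open_openin[symmetric])
    with Compl.IH have "Some ` UNIV - Some ` B \<in> sets cemetery_borel" by (rule sets.Diff[rotated])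
    then show ?case by (simp add: image_set_diff)
  next
    case (Union B)
    then show ?case by (auto simp: image_UN)
  qed
  then show ?thesis using assms by (simp add: borel_def)
qed

lemma Some_measurable: "Some \<in> borel \<rightarrow>\<^sub>M cemetery_borel"
proof (rule measurable_sigma_sets[OF sets_cemetery_borel])
  fix U :: "'a option set" assume "U \<in> {U. openin (Alexandroff_compactification euclidean) U}"
  then have "openin (euclidean :: 'a topology) {x \<in> topspace euclidean. Some x \<in> U}"
    using continuous_map_Some openin_continuous_map_preimage by blast
  then show "Some -` U \<inter> space borel \<in> sets (borel :: 'a measure)"
    by (auto simp: open_openin[symmetric] vimage_def)
qed auto

lemma ext_cemetery_measurable:
  assumes "g \<in> borel_measurable borel" shows "ext_cemetery g \<in> borel_measurable cemetery_borel"
proof (rule measurableI)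
  fix A :: "ennreal set" assume A: "A \<in> sets borel"
  have "ext_cemetery g -` A = Some ` (g -` A) \<union> (if 0 \<in> A then UNIV - Some ` UNIV else {})"
    unfolding ext_cemetery_def by (auto split: option.splits) 
  moreover have "g -` A \<in> sets borel" using measurable_sets[OF assms A] by simp
  ultimately show "ext_cemetery g -` A \<inter> space cemetery_borel \<in> sets cemetery_borel"
    using Some_image_cemetery_borel[of UNIV] sets.compl_sets[of "Some ` UNIV" cemetery_borel]
    by (auto intro: Some_image_cemetery_borel)
qed simp

text \<open>
  Right-continuity in the one-point compactification says two things: if \<open>X\<^sub>t\<close> lies in an open
  set, then so does the path just after \<open>t\<close>, and if \<open>X\<^sub>t\<close> lies outside a compact set, then so does
  the path just after \<open>t\<close>. Exhausting \<open>G\<close> by interleaved open and compact sets lets both be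
  applied to the event \<open>X\<^sub>t \<in> G\<close>.
\<close>

lemma compact_exhaustion:
  fixes G :: "'a::{t2_space, second_countable_topology} set"
  assumes lc: "locally_compact_space (euclidean :: 'a topology)" and "open G"
  obtains V K :: "nat \<Rightarrow> 'a set" where "\<And>j. open (V j)" "\<And>j. compact (K j)" "\<And>j. V j \<subseteq> K j" "\<And>j. K j \<subseteq> G"
    "incseq V" "(\<Union>j. V j) = G"
proof -
  obtain \<B> :: "'a set set" where \<B>: "countable \<B>" "topological_basis \<B>"
    using ex_countable_basis by blast
  define \<C> where "\<C> = insert {} {B \<in> \<B>. \<exists>K. compact K \<and> B \<subseteq> K \<and> K \<subseteq> G}"
  have cC: "countable \<C>" "\<C> \<noteq> {}" unfolding \<C>_def using \<B>(1) by auto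
  have C: "open B \<and> (\<exists>K. compact K \<and> B \<subseteq> K \<and> K \<subseteq> G)" if "B \<in> \<C>" for B
    using that \<B>(2) unfolding \<C>_def by (auto intro: topological_basis_open)
  then obtain L where L: "\<And>B. B \<in> \<C> \<Longrightarrow> compact (L B) \<and> B \<subseteq> L B \<and> L B \<subseteq> G" by metis
  define c where "c = from_nat_into \<C>"
  have c: "c i \<in> \<C>" "range c = \<C>" for i
    unfolding c_def using cC by (auto simp: from_nat_into range_from_nat_into)
  have "G \<subseteq> \<Union>\<C>"
  proof
    fix x assume "x \<in> G"
    have "Hausdorff_space (euclidean :: 'a topology)"
      unfolding Hausdorff_space_def by (simp add: disjnt_def) (metis hausdorff)
    then have "neighbourhood_base_of (compactin euclidean) (euclidean :: 'a topology)"
      using lc locally_compact_space_neighbourhood_base by blast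
    then obtain U K where UK: "open U" "compact K" "x \<in> U" "U \<subseteq> K" "K \<subseteq> G"
      using \<open>x \<in> G\<close> \<open>open G\<close> unfolding neighbourhood_base_of by (metis compactin_euclidean_iff open_openin)
    then obtain B where "B \<in> \<B>" "x \<in> B" "B \<subseteq> U"
      using topological_basisE[OF \<B>(2)] by blast
    then show "x \<in> \<Union>\<C>" unfolding \<C>_def using UK by blast
  qed
  moreover have "\<Union>\<C> \<subseteq> G" using L by blast
  ultimately have G: "\<Union>\<C> = G" by blast
  show thesis
  proof (rule that[of "\<lambda>j. \<Union>i\<le>j. c i" "\<lambda>j. \<Union>i\<le>j. L (c i)"])
    show "open (\<Union>i\<le>j. c i)" for j using C c(1) by blast
    show "compact (\<Union>i\<le>j. L (c i))" for j using L c(1) by (intro compact_UN) auto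
    show "(\<Union>i\<le>j. c i) \<subseteq> (\<Union>i\<le>j. L (c i))" for j using L c(1) by blast
    show "(\<Union>i\<le>j. L (c i)) \<subseteq> G" for j using L c(1) by blast
    show "incseq (\<lambda>j. \<Union>i\<le>j. c i)" by (auto simp: incseq_def intro: order_trans)
    show "(\<Union>j. \<Union>i\<le>j. c i) = G" using G c(2) by auto
  qed
qed

text \<open>
  The next point of the grid with mesh \<open>1 / (k + 1)\<close> strictly to the right of \<open>t\<close>. It takes countably
  many values, which gives joint measurability from measurability at fixed times.
\<close>

definition grid_above :: "nat \<Rightarrow> real \<Rightarrow> real"
  where "grid_above k t = (of_int \<lfloor>real (Suc k) * t\<rfloor> + 1) / real (Suc k)"

lemma grid_above_greater: "t < grid_above k t"
proof -
  have "real (Suc k) * t < of_int \<lfloor>real (Suc k) * t\<rfloor> + 1" by linarith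
  then show ?thesis unfolding grid_above_def by (simp add: field_simps)
qed

lemma grid_above_le: "grid_above k t \<le> t + 1 / real (Suc k)"
proof -
  have "of_int \<lfloor>real (Suc k) * t\<rfloor> + 1 \<le> real (Suc k) * t + 1" by linarith
  then have "(of_int \<lfloor>real (Suc k) * t\<rfloor> + 1) / real (Suc k) \<le> (real (Suc k) * t + 1) / real (Suc k)"
    by (rule divide_right_mono) simp
  then show ?thesis unfolding grid_above_def by (simp add: add_divide_distrib)
qed

lemma grid_above_tendsto:
  assumes "0 \<le> t"
  shows "filterlim (\<lambda>k. ennreal (grid_above k t)) (at_right (ennreal t)) sequentially"
proof -
  have lim: "(\<lambda>k. t + 1 / real (Suc k)) \<longlonglongrightarrow> t + 0"
    by (intro tendsto_add tendsto_const LIMSEQ_Suc[OF lim_1_over_n])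
  have "(\<lambda>k. grid_above k t) \<longlonglongrightarrow> t"
  proof (rule tendsto_sandwich[OF _ _ tendsto_const])
    show "eventually (\<lambda>k. t \<le> grid_above k t) sequentially"
      by (intro always_eventually allI less_imp_le grid_above_greater)
    show "eventually (\<lambda>k. grid_above k t \<le> t + 1 / real (Suc k)) sequentially"
      by (intro always_eventually allI grid_above_le)
    show "(\<lambda>k. t + 1 / real (Suc k)) \<longlonglongrightarrow> t" using lim by simp
  qed
  then have "(\<lambda>k. ennreal (grid_above k t)) \<longlonglongrightarrow> ennreal t" by (rule tendsto_ennrealI)
  moreover have "ennreal t < ennreal (grid_above k t)" for k
    using grid_above_greater[of t k] assms by (intro ennreal_lessI) auto
  ultimately show ?thesis by (auto simp: filterlim_at less_imp_neq[symmetric])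
qed

context borel_right_process
begin

lemma space_P [simp]: "space (P y) = \<Omega>"
  using sets_eq_imp_space_eq[OF sets_P[of y]] space_F by simp

lemma X_measurable [measurable]: "X t \<in> P y \<rightarrow>\<^sub>M cemetery_borel"
proof (rule measurableI)
  fix A :: "'a option set" assume "A \<in> sets cemetery_borel"
  from measurable_sets[OF adapted this, of t] have "X t -` A \<inter> \<Omega> \<in> sets (F t)" by (simp add: space_F)
  then show "X t -` A \<inter> space (P y) \<in> sets (P y)"
    using sets_F_mono[of t \<infinity>] sets_P[of y] by auto
qed simp

lemma right_continuous_Some:
  assumes "\<omega> \<in> \<Omega>" "0 \<le> t" "open V" "X (ennreal t) \<omega> \<in> Some ` V"
  shows "eventually (\<lambda>k. X (ennreal (grid_above k t)) \<omega> \<in> Some ` V) sequentially"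
proof -
  have "eventually (\<lambda>s. X s \<omega> \<in> Some ` V) (at_right (ennreal t))"
    using paths_right_continuous[OF assms(1), of "ennreal t"] assms(3,4)
    by (intro limitinD) (auto simp: open_openin[symmetric])
  from eventually_compose_filterlim[OF this grid_above_tendsto[OF assms(2)]] show ?thesis .
qed

lemma right_continuous_compact:
  assumes "\<omega> \<in> \<Omega>" "0 \<le> t" "compact K" "X (ennreal t) \<omega> \<notin> Some ` K"
  shows "eventually (\<lambda>k. X (ennreal (grid_above k t)) \<omega> \<notin> Some ` K) sequentially"
proof -
  have "closedin (Alexandroff_compactification euclidean) (Some ` K)"
    using assms(3) compact_imp_closed[OF assms(3)] by (simp add: closed_closedin[symmetric])
  then have "openin (Alexandroff_compactification euclidean) (UNIV - Some ` K)"
    unfolding closedin_def by (simp add: UNIV_option_conv[symmetric])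
  then have "eventually (\<lambda>s. X s \<omega> \<in> UNIV - Some ` K) (at_right (ennreal t))"
    using paths_right_continuous[OF assms(1), of "ennreal t"] assms(4) by (intro limitinD) auto
  from eventually_compose_filterlim[OF this grid_above_tendsto[OF assms(2)]] show ?thesis by simp
qed

lemma X_grid_measurable:
  "(\<lambda>z. X (ennreal (grid_above k (max 0 (fst z)))) (snd z)) \<in> borel \<Otimes>\<^sub>M P y \<rightarrow>\<^sub>M cemetery_borel"
proof -
  have "(\<lambda>z. (\<lambda>i z. X (ennreal ((of_int i + 1) / real (Suc k))) (snd z)) (\<lfloor>real (Suc k) * max 0 (fst z)\<rfloor>) z)
      \<in> borel \<Otimes>\<^sub>M P y \<rightarrow>\<^sub>M cemetery_borel"
    by (rule measurable_compose_countable) measurable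
  then show ?thesis unfolding grid_above_def by simp
qed

text \<open>
  By right-continuity, \<open>X\<^sub>t \<in> G\<close> holds exactly if for some \<open>j\<close> the process lies in \<open>V\<^sub>j\<close> at all but
  finitely many of the grid times approximating \<open>t\<close>. For negative \<open>t\<close> the time \<^term>\<open>ennreal t\<close> is 0.
\<close>

lemma X_jointly_measurable:
  assumes lc: "locally_compact_space (euclidean :: 'a topology)"
  shows "(\<lambda>z. X (ennreal (fst z)) (snd z)) \<in> borel \<Otimes>\<^sub>M P y \<rightarrow>\<^sub>M cemetery_borel"
proof -
  let ?N = "borel \<Otimes>\<^sub>M P y :: (real \<times> 'w) measure"
  have spN: "space ?N = UNIV \<times> \<Omega>" by (simp add: space_pair_measure)
  have open_sets: "{z\<in>space ?N. X (ennreal (fst z)) (snd z) \<in> Some ` G} \<in> sets ?N" if op: "open G" for G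
  proof -
    obtain V K :: "nat \<Rightarrow> 'a set" where VK: "\<And>j. open (V j)" "\<And>j. compact (K j)" "\<And>j. V j \<subseteq> K j" "\<And>j. K j \<subseteq> G"
      "incseq V" "(\<Union>j. V j) = G"
      by (rule compact_exhaustion[OF lc op]) (rule that)
    let ?Y = "\<lambda>k z. X (ennreal (grid_above k (max 0 (fst z)))) (snd z)"
    have "X (ennreal (fst z)) (snd z) \<in> Some ` G \<longleftrightarrow> (\<exists>j m. \<forall>k\<in>{m..}. ?Y k z \<in> Some ` V j)" if z: "z \<in> space ?N" for z
    proof -
      let ?t = "max 0 (fst z)"
      have t: "ennreal (fst z) = ennreal ?t" "0 \<le> ?t" by auto
      have w: "snd z \<in> \<Omega>" using z unfolding spN by auto
      show ?thesis
      proof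
        assume "X (ennreal (fst z)) (snd z) \<in> Some ` G"
        then have "X (ennreal ?t) (snd z) \<in> Some ` G" unfolding t(1) .
        then obtain j where "X (ennreal ?t) (snd z) \<in> Some ` V j" using VK(6) by blast
        from right_continuous_Some[OF w t(2) VK(1) this]
        show "\<exists>j m. \<forall>k\<in>{m..}. ?Y k z \<in> Some ` V j" unfolding eventually_sequentially by auto
      next
        assume "\<exists>j m. \<forall>k\<in>{m..}. ?Y k z \<in> Some ` V j"
        then obtain j where "eventually (\<lambda>k. ?Y k z \<in> Some ` V j) sequentially" unfolding eventually_sequentially by auto
        then have "eventually (\<lambda>k. ?Y k z \<in> Some ` K j) sequentially"
          by eventually_elim (use VK(3) in blast)
        then have "X (ennreal ?t) (snd z) \<in> Some ` K j"
          using right_continuous_compact[OF w t(2) VK(2)] by (metis (mono_tags, lifting) eventually_conj_iff eventually_happens' sequentially_bot)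
        then show "X (ennreal (fst z)) (snd z) \<in> Some ` G" unfolding t(1) using VK(4) by blast
      qed
    qed
    then have "{z\<in>space ?N. X (ennreal (fst z)) (snd z) \<in> Some ` G} = {z\<in>space ?N. \<exists>j m. \<forall>k\<in>{m..}. ?Y k z \<in> Some ` V j}"
      by blast
    also have "\<dots> = (\<Union>j. \<Union>m. \<Inter>k\<in>{m..}. ?Y k -` (Some ` V j) \<inter> space ?N)"
    proof (rule equalityI; rule subsetI)
      fix z assume "z \<in> {z\<in>space ?N. \<exists>j m. \<forall>k\<in>{m..}. ?Y k z \<in> Some ` V j}"
      then obtain j m where "z \<in> space ?N" "\<forall>k\<in>{m..}. ?Y k z \<in> Some ` V j" by blast
      then have "z \<in> (\<Inter>k\<in>{m..}. ?Y k -` (Some ` V j) \<inter> space ?N)" by simp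
      then show "z \<in> (\<Union>j. \<Union>m. \<Inter>k\<in>{m..}. ?Y k -` (Some ` V j) \<inter> space ?N)" by blast
    next
      fix z assume "z \<in> (\<Union>j. \<Union>m. \<Inter>k\<in>{m..}. ?Y k -` (Some ` V j) \<inter> space ?N)"
      then obtain j m where jm: "z \<in> (\<Inter>k\<in>{m..}. ?Y k -` (Some ` V j) \<inter> space ?N)" by blast
      then have "\<forall>k\<in>{m..}. ?Y k z \<in> Some ` V j" by simp
      moreover have "z \<in> space ?N" using INT_D[OF jm, of m] by simp
      ultimately show "z \<in> {z\<in>space ?N. \<exists>j m. \<forall>k\<in>{m..}. ?Y k z \<in> Some ` V j}" by blast
    qed
    also have "\<dots> \<in> sets ?N"
      using VK(1) by (intro sets.countable_UN sets.countable_INT' measurable_sets[OF X_grid_measurable]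
          Some_image_cemetery_borel image_subsetI) auto
    finally show ?thesis .
  qed
  show ?thesis
  proof (rule measurable_sigma_sets[OF sets_cemetery_borel])
    fix U :: "'a option set" assume "U \<in> {U. openin (Alexandroff_compactification euclidean) U}"
    then consider G where "open G" "U = Some ` G" | C where "closed C" "U = insert None (Some ` (UNIV - C))"
      unfolding openin_Alexandroff_compactification by (auto simp: open_openin[symmetric] closed_closedin[symmetric])
    then show "(\<lambda>z. X (ennreal (fst z)) (snd z)) -` U \<inter> space ?N \<in> sets ?N"
    proof cases
      case 1
      then show ?thesis using open_sets[OF 1(1)] by (simp add: vimage_def Int_def conj_commute)
    next
      case 2
      have "(\<lambda>z. X (ennreal (fst z)) (snd z)) -` U \<inter> space ?N =
        (space ?N - {z\<in>space ?N. X (ennreal (fst z)) (snd z) \<in> Some ` UNIV}) \<union> {z\<in>space ?N. X (ennreal (fst z)) (snd z) \<in> Some ` (UNIV - C)}"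
        unfolding 2(2) by (auto simp: UNIV_option_conv)
      then show ?thesis
        using open_sets[of UNIV] open_sets[of "UNIV - C"] 2(1) by (auto simp: open_Diff)
    qed
  qed auto
qed

text \<open>
  The law of \<open>X\<^sub>t\<close> restricted to the state space, as a measure on the state space.
\<close>

definition kernel :: "real \<Rightarrow> 'a \<Rightarrow> 'a measure"
  where "kernel t x = distr (restrict_space (P (Some x)) (X (ennreal t) -` range Some)) borel (\<lambda>\<omega>. the (X (ennreal t) \<omega>))"

lemma alive_sets: "X t -` range Some \<inter> \<Omega> \<in> sets (P y)"
  using measurable_sets[OF X_measurable Some_image_cemetery_borel[of UNIV]] by simp

lemma live_position_measurable:
  "(\<lambda>\<omega>. the (X t \<omega>)) \<in> restrict_space (P y) (X t -` range Some) \<rightarrow>\<^sub>M borel"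
proof (rule measurableI)
  fix B :: "'a set" assume "B \<in> sets borel"
  from measurable_sets[OF X_measurable Some_image_cemetery_borel[OF this], of t y]
  have "X t -` Some ` B \<inter> \<Omega> \<in> sets (P y)" by simp
  moreover have "(\<lambda>\<omega>. the (X t \<omega>)) -` B \<inter> space (restrict_space (P y) (X t -` range Some)) = X t -` Some ` B \<inter> \<Omega>"
    by (auto simp: space_restrict_space)
  ultimately show "(\<lambda>\<omega>. the (X t \<omega>)) -` B \<inter> space (restrict_space (P y) (X t -` range Some)) \<in> sets (restrict_space (P y) (X t -` range Some))"
    using alive_sets[of t y] by (subst sets_restrict_space_iff) auto
qed simp

lemma sets_transition_kernel [measurable_cong, simp]: "sets (kernel t x) = sets borel"
  unfolding kernel_def by simp

lemma nn_integral_kernel: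
  assumes [measurable]: "g \<in> borel_measurable borel"
  shows "(\<integral>\<^sup>+y. g y \<partial>kernel t x) = (\<integral>\<^sup>+\<omega>. ext_cemetery g (X (ennreal t) \<omega>) \<partial>P (Some x))"
proof -
  let ?A = "X (ennreal t) -` range Some"
  have "(\<integral>\<^sup>+y. g y \<partial>kernel t x) = (\<integral>\<^sup>+\<omega>. g (the (X (ennreal t) \<omega>)) \<partial>restrict_space (P (Some x)) ?A)"
    unfolding kernel_def by (rule nn_integral_distr[OF live_position_measurable]) simp
  also have "\<dots> = (\<integral>\<^sup>+\<omega>. g (the (X (ennreal t) \<omega>)) * indicator ?A \<omega> \<partial>P (Some x))"
    using alive_sets by (intro nn_integral_restrict_space) simp
  also have "\<dots> = (\<integral>\<^sup>+\<omega>. ext_cemetery g (X (ennreal t) \<omega>) \<partial>P (Some x))"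
    by (intro nn_integral_cong) (auto simp: ext_cemetery_def indicator_def split: option.splits)
  finally show ?thesis .
qed

lemma emeasure_kernel:
  assumes "B \<in> sets borel"
  shows "emeasure (kernel t x) B = emeasure (P (Some x)) {\<omega>\<in>\<Omega>. X (ennreal t) \<omega> \<in> Some ` B}"
proof -
  have meas: "{\<omega>\<in>\<Omega>. X (ennreal t) \<omega> \<in> Some ` B} \<in> sets (P (Some x))"
    using measurable_sets[OF X_measurable Some_image_cemetery_borel[OF assms], of "ennreal t" "Some x"]
    by (simp add: vimage_def Int_def conj_commute)
  have "emeasure (kernel t x) B = (\<integral>\<^sup>+y. indicator B y \<partial>kernel t x)"
    using assms by simp
  also have "\<dots> = (\<integral>\<^sup>+\<omega>. ext_cemetery (indicator B) (X (ennreal t) \<omega>) \<partial>P (Some x))"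
    using assms by (intro nn_integral_kernel) simp
  also have "\<dots> = (\<integral>\<^sup>+\<omega>. indicator {\<omega>\<in>\<Omega>. X (ennreal t) \<omega> \<in> Some ` B} \<omega> \<partial>P (Some x))"
    by (intro nn_integral_cong) (auto simp: ext_cemetery_def indicator_def split: option.splits)
  finally show ?thesis using meas by simp
qed

lemma subprob_transition_kernel: "subprob_space (kernel t x)"
proof
  interpret prob_space "P (Some x)" by (rule prob_P)
  show "emeasure (kernel t x) (space (kernel t x)) \<le> 1"
    using emeasure_kernel[of UNIV t x] emeasure_le_1 by (simp add: kernel_def)
  show "space (kernel t x) \<noteq> {}" by (simp add: kernel_def)
qed

text \<open>
  The counterpart for probabilities of the description of \<open>X\<^sub>t \<in> G\<close> by grid times. Fatou's lemma
  for the open sets \<open>V\<^sub>j\<close> gives one inequality, and the reverse Fatou lemma for the compact sets \<open>K\<^sub>j\<close>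
  the other. It expresses \<open>P\<^sup>x(X\<^sub>t \<in> G)\<close> through transition probabilities at grid times only.
\<close>

lemma kernel_open_limit:
  assumes "open G" "0 \<le> t"
    and VK: "\<And>j. open (V j)" "\<And>j. compact (K j)" "\<And>j. V j \<subseteq> K j" "\<And>j. K j \<subseteq> G" "incseq V" "(\<Union>j. V j) = G"
  shows "emeasure (kernel t x) G = (SUP j. liminf (\<lambda>k. emeasure (kernel (grid_above k t) x) (V j)))"
proof (rule antisym)
  interpret prob_space "P (Some x)" by (rule prob_P)
  let ?e = "\<lambda>s B. emeasure (P (Some x)) {\<omega>\<in>\<Omega>. X (ennreal s) \<omega> \<in> Some ` B}"
  have sets: "{\<omega>\<in>\<Omega>. X s \<omega> \<in> Some ` B} \<in> sets (P (Some x))" if "B \<in> sets borel" for s B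
    using measurable_sets[OF X_measurable Some_image_cemetery_borel[OF that], of s "Some x"]
    by (simp add: vimage_def Int_def conj_commute)
  have ind: "(\<integral>\<^sup>+\<omega>. indicator (Some ` B) (X (ennreal s) \<omega>) \<partial>P (Some x)) = ?e s B" if "B \<in> sets borel" for s B
  proof -
    have "(\<integral>\<^sup>+\<omega>. indicator (Some ` B) (X (ennreal s) \<omega>) \<partial>P (Some x)) = (\<integral>\<^sup>+\<omega>. indicator {\<omega>\<in>\<Omega>. X (ennreal s) \<omega> \<in> Some ` B} \<omega> \<partial>P (Some x))"
      by (intro nn_integral_cong) (auto simp: indicator_def)
    then show ?thesis using sets[OF that] by simp
  qed
  have ind_meas: "(\<lambda>\<omega>. indicator (Some ` B) (X s \<omega>) :: ennreal) \<in> borel_measurable (P (Some x))" if "B \<in> sets borel" for s B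
    using measurable_compose[OF X_measurable borel_measurable_indicator[OF Some_image_cemetery_borel[OF that]]] .
  have Vb: "V j \<in> sets borel" and Kb: "K j \<in> sets borel" for j using VK(1,2) by (auto intro: borel_compact)
  show "emeasure (kernel t x) G \<le> (SUP j. liminf (\<lambda>k. emeasure (kernel (grid_above k t) x) (V j)))"
  proof -
    have "emeasure (kernel t x) G = (SUP j. emeasure (kernel t x) (V j))"
      using SUP_emeasure_incseq[of V "kernel t x"] VK(5,6) Vb by (auto simp: image_subset_iff)
    also have "\<dots> \<le> (SUP j. liminf (\<lambda>k. emeasure (kernel (grid_above k t) x) (V j)))"
    proof (intro SUP_mono bexI)
      fix j
      have "emeasure (kernel t x) (V j) \<le> (\<integral>\<^sup>+\<omega>. liminf (\<lambda>k. indicator (Some ` V j) (X (ennreal (grid_above k t)) \<omega>)) \<partial>P (Some x))"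
        unfolding emeasure_kernel[OF Vb] ind[OF Vb, symmetric]
      proof (rule nn_integral_mono)
        fix \<omega> assume w: "\<omega> \<in> space (P (Some x))"
        show "(indicator (Some ` V j) (X (ennreal t) \<omega>) :: ennreal) \<le> liminf (\<lambda>k. indicator (Some ` V j) (X (ennreal (grid_above k t)) \<omega>))"
        proof (cases "X (ennreal t) \<omega> \<in> Some ` V j")
          case True
          from right_continuous_Some[OF _ \<open>0 \<le> t\<close> VK(1) True] w
          have "eventually (\<lambda>k. (1::ennreal) \<le> indicator (Some ` V j) (X (ennreal (grid_above k t)) \<omega>)) sequentially"
            by (auto elim!: eventually_mono)
          then have "(1::ennreal) \<le> liminf (\<lambda>k. indicator (Some ` V j) (X (ennreal (grid_above k t)) \<omega>))"
            by (rule Liminf_bounded)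
          then show ?thesis using True by simp
        qed simp
      qed
      also have "\<dots> \<le> liminf (\<lambda>k. \<integral>\<^sup>+\<omega>. indicator (Some ` V j) (X (ennreal (grid_above k t)) \<omega>) \<partial>P (Some x))"
        by (rule nn_integral_liminf) (rule ind_meas[OF Vb])
      also have "\<dots> = liminf (\<lambda>k. emeasure (kernel (grid_above k t) x) (V j))"
        unfolding ind[OF Vb] emeasure_kernel[OF Vb] ..
      finally show "emeasure (kernel t x) (V j) \<le> liminf (\<lambda>k. emeasure (kernel (grid_above k t) x) (V j))" .
    qed simp
    finally show ?thesis .
  qed
  show "(SUP j. liminf (\<lambda>k. emeasure (kernel (grid_above k t) x) (V j))) \<le> emeasure (kernel t x) G"
  proof (rule SUP_least)
    fix j
    have "liminf (\<lambda>k. emeasure (kernel (grid_above k t) x) (V j)) \<le> limsup (\<lambda>k. emeasure (kernel (grid_above k t) x) (K j))"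
      using VK(3) Kb by (intro order_trans[OF Liminf_le_Limsup] Limsup_mono always_eventually allI emeasure_mono) auto
    also have "\<dots> = limsup (\<lambda>k. \<integral>\<^sup>+\<omega>. indicator (Some ` K j) (X (ennreal (grid_above k t)) \<omega>) \<partial>P (Some x))"
      unfolding ind[OF Kb] emeasure_kernel[OF Kb] ..
    also have "\<dots> \<le> (\<integral>\<^sup>+\<omega>. limsup (\<lambda>k. indicator (Some ` K j) (X (ennreal (grid_above k t)) \<omega>)) \<partial>P (Some x))"
      using emeasure_space_1
      by (intro nn_integral_limsup[where w = "\<lambda>_. 1"] ind_meas[OF Kb]) (auto simp: indicator_def)
    also have "\<dots> \<le> (\<integral>\<^sup>+\<omega>. indicator (Some ` K j) (X (ennreal t) \<omega>) \<partial>P (Some x))"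
    proof (rule nn_integral_mono)
      fix \<omega> assume w: "\<omega> \<in> space (P (Some x))"
      show "limsup (\<lambda>k. indicator (Some ` K j) (X (ennreal (grid_above k t)) \<omega>)) \<le> (indicator (Some ` K j) (X (ennreal t) \<omega>) :: ennreal)"
      proof (cases "X (ennreal t) \<omega> \<in> Some ` K j")
        case True
        then show ?thesis by (auto intro!: Limsup_bounded always_eventually simp: indicator_def)
      next
        case False
        from right_continuous_compact[OF _ \<open>0 \<le> t\<close> VK(2) False] w
        have "eventually (\<lambda>k. indicator (Some ` K j) (X (ennreal (grid_above k t)) \<omega>) \<le> (0::ennreal)) sequentially"
          by (auto elim!: eventually_mono)
        then have "limsup (\<lambda>k. indicator (Some ` K j) (X (ennreal (grid_above k t)) \<omega>)) \<le> (0::ennreal)"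
          by (rule Limsup_bounded)
        then show ?thesis using False by simp
      qed
    qed
    also have "\<dots> = emeasure (kernel t x) (K j)"
      unfolding ind[OF Kb] emeasure_kernel[OF Kb] ..
    also have "\<dots> \<le> emeasure (kernel t x) G"
      using VK(4) \<open>open G\<close> by (intro emeasure_mono) auto
    finally show "liminf (\<lambda>k. emeasure (kernel (grid_above k t) x) (V j)) \<le> emeasure (kernel t x) G" .
  qed
qed

lemma kernel_jointly_measurable:
  assumes lc: "locally_compact_space (euclidean :: 'a topology)"
  shows "(\<lambda>(t, x). kernel t x) \<in> borel \<Otimes>\<^sub>M borel \<rightarrow>\<^sub>M subprob_algebra borel"
proof -
  have at_time: "(\<lambda>x. emeasure (kernel s x) B) \<in> borel_measurable borel" if "B \<in> sets borel" for s B
    unfolding emeasure_kernel[OF that]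
    using measurable_compose[OF Some_measurable borel_semigroup[OF _ Some_image_cemetery_borel[OF that]]] by simp
  have grid: "(\<lambda>z. emeasure (kernel (grid_above k (max 0 (fst z))) (snd z)) B) \<in> borel_measurable (borel \<Otimes>\<^sub>M borel)"
    if "B \<in> sets borel" for k B
  proof -
    have "(\<lambda>z. (\<lambda>i z. emeasure (kernel ((of_int i + 1) / real (Suc k)) (snd z)) B) (\<lfloor>real (Suc k) * max 0 (fst z)\<rfloor>) z)
        \<in> borel_measurable (borel \<Otimes>\<^sub>M (borel :: 'a measure))"
      by (rule measurable_compose_countable[OF measurable_compose[OF measurable_snd at_time[OF that]]]) measurable
    then show ?thesis unfolding grid_above_def by simp
  qed
  have kernel_max: "kernel t x = kernel (max 0 t) x" for t x
    unfolding kernel_def by (simp add: max_def ennreal_neg)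
  have open_meas: "(\<lambda>z. emeasure (kernel (fst z) (snd z)) G) \<in> borel_measurable (borel \<Otimes>\<^sub>M borel)" if op: "open G" for G
  proof -
    obtain V K :: "nat \<Rightarrow> 'a set" where VK: "\<And>j. open (V j)" "\<And>j. compact (K j)" "\<And>j. V j \<subseteq> K j" "\<And>j. K j \<subseteq> G"
      "incseq V" "(\<Union>j. V j) = G"
      by (rule compact_exhaustion[OF lc op]) (rule that)
    have "(\<lambda>z. SUP j. liminf (\<lambda>k. emeasure (kernel (grid_above k (max 0 (fst z))) (snd z)) (V j))) \<in> borel_measurable (borel \<Otimes>\<^sub>M borel)"
      using VK(1) by (intro borel_measurable_SUP borel_measurable_liminf grid) auto
    also have "(\<lambda>z. SUP j. liminf (\<lambda>k. emeasure (kernel (grid_above k (max 0 (fst z))) (snd z)) (V j)))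
        = (\<lambda>z. emeasure (kernel (fst z) (snd z)) G)"
      using kernel_open_limit[OF op _ VK] by (subst (2) kernel_max) auto
    finally show ?thesis .
  qed
  have "(\<lambda>z. kernel (fst z) (snd z)) \<in> borel \<Otimes>\<^sub>M borel \<rightarrow>\<^sub>M subprob_algebra borel"
  proof (rule measurable_subprob_algebra_generated[where \<Omega> = UNIV and G = "{S. open S}"])
    show "sets borel = sigma_sets UNIV {S :: 'a set. open S}" by (simp add: borel_def)
    show "Int_stable {S :: 'a set. open S}" by (auto simp: Int_stable_def)
  qed (auto intro: subprob_transition_kernel open_meas)
  then show ?thesis by (simp add: split_beta')
qed

text \<open>
  The Markov property at the constant time \<open>s\<close>. Paths that have reached the cemetery contribute
  nothing, as the cemetery is absorbing.
\<close>

lemma kernel_semigroup: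
  assumes lc: "locally_compact_space (euclidean :: 'a topology)" and st: "0 \<le> s" "0 \<le> t"
  shows "kernel (s + t) x = kernel s x \<bind> kernel t"
proof (rule measure_eqI)
  have meas: "kernel t \<in> borel \<rightarrow>\<^sub>M subprob_algebra borel"
    using measurable_compose[OF measurable_Pair1' kernel_jointly_measurable[OF lc], of t] by simp
  then have meas': "kernel t \<in> kernel s x \<rightarrow>\<^sub>M subprob_algebra borel"
    by (simp add: measurable_cong_sets[OF sets_transition_kernel refl])
  have ne: "space (kernel s x) \<noteq> {}" by (simp add: kernel_def)
  show "sets (kernel (s + t) x) = sets (kernel s x \<bind> kernel t)"
    using sets_bind[of "kernel s x" "kernel t" borel] ne by simp
  fix B assume "B \<in> sets (kernel (s + t) x)"
  then have B: "B \<in> sets borel" by simp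
  have dead: "emeasure (P None) {\<omega>\<in>\<Omega>. X (ennreal t) \<omega> \<in> Some ` B} = 0"
  proof -
    have "AE \<omega> in P None. \<omega> \<notin> {\<omega>\<in>\<Omega>. X (ennreal t) \<omega> \<in> Some ` B}"
      using normal[of None] AE_space
    proof eventually_elim
      case (elim \<omega>)
      then have "X (ennreal t) \<omega> = None" using absorbing[of \<omega> 0 "ennreal t"] by auto
      then show ?case by auto
    qed
    then show ?thesis
      by (subst (asm) AE_iff_measurable[OF _ refl])
        (use measurable_sets[OF X_measurable Some_image_cemetery_borel[OF B], of "ennreal t" None]
         in \<open>auto simp: vimage_def Int_def conj_commute cong: conj_cong\<close>)
  qed
  have "emeasure (kernel (s + t) x) B = emeasure (P (Some x)) {\<omega>\<in>\<Omega>. X (ennreal s + ennreal t) \<omega> \<in> Some ` B}"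
    unfolding emeasure_kernel[OF B] using st by simp
  also have "\<dots> = (\<integral>\<^sup>+\<omega>\<in>\<Omega>. emeasure (P (X (ennreal s) \<omega>)) {\<omega>' \<in> \<Omega>. X (ennreal t) \<omega>' \<in> Some ` B} \<partial>P (Some x))"
  proof -
    have "\<Omega> \<in> sets (pre_sigma (\<lambda>_. ennreal s))"
      using sets.top[of "pre_sigma (\<lambda>_. ennreal s)"] by (simp add: space_pre_sigma)
    then show ?thesis
      by (intro strong_markov[where T = "\<lambda>_. ennreal s"] stopping_time_const Some_image_cemetery_borel B) auto
  qed
  also have "\<dots> = (\<integral>\<^sup>+\<omega>. ext_cemetery (\<lambda>y. emeasure (kernel t y) B) (X (ennreal s) \<omega>) \<partial>P (Some x))"
    unfolding emeasure_kernel[OF B]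
    by (intro nn_integral_cong) (auto simp: ext_cemetery_def dead split: option.splits)
  also have "\<dots> = (\<integral>\<^sup>+y. emeasure (kernel t y) B \<partial>kernel s x)"
    using measurable_compose[OF meas measurable_emeasure_subprob_algebra[OF B]]
    by (intro nn_integral_kernel[symmetric]) simp
  also have "\<dots> = emeasure (kernel s x \<bind> kernel t) B"
    by (rule emeasure_bind[symmetric, OF ne meas' B])
  finally show "emeasure (kernel (s + t) x) B = emeasure (kernel s x \<bind> kernel t) B" .
qed

lemma submarkov_semigroup_kernel:
  assumes lc: "locally_compact_space (euclidean :: 'a topology)"
  shows "submarkov_semigroup kernel"
  by standard (use kernel_jointly_measurable[OF lc] kernel_semigroup[OF lc] in auto)

lemma resolvent_eq_potential:
  assumes lc: "locally_compact_space (euclidean :: 'a topology)" and g [measurable]: "g \<in> borel_measurable borel"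
  shows "submarkov_semigroup.resolvent kernel 0 g x = potential X P g x"
proof -
  interpret S: submarkov_semigroup kernel by (rule submarkov_semigroup_kernel[OF lc])
  interpret prob_space "P (Some x)" by (rule prob_P)
  interpret pair_sigma_finite "lborel :: real measure" "P (Some x)" ..
  have [measurable]: "(\<lambda>z. ext_cemetery g (X (ennreal (fst z)) (snd z))) \<in> borel_measurable (lborel \<Otimes>\<^sub>M P (Some x))"
    using measurable_compose[OF X_jointly_measurable[OF lc] ext_cemetery_measurable[OF g], of "Some x"]
    by (simp cong: measurable_cong_sets)
  have "S.resolvent 0 g x = (\<integral>\<^sup>+t. indicator {0..} t * (\<integral>\<^sup>+\<omega>. ext_cemetery g (X (ennreal t) \<omega>) \<partial>P (Some x)) \<partial>lborel)"
    unfolding S.resolvent_def S.transition_def nn_integral_kernel[OF g]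
    by (intro nn_integral_cong) (auto simp: indicator_def)
  also have "\<dots> = (\<integral>\<^sup>+t. (\<integral>\<^sup>+\<omega>. indicator {0..} t * ext_cemetery g (X (ennreal t) \<omega>) \<partial>P (Some x)) \<partial>lborel)"
    using measurable_compose[OF X_measurable ext_cemetery_measurable[OF g]]
    by (intro nn_integral_cong nn_integral_cmult[symmetric]) auto
  also have "\<dots> = (\<integral>\<^sup>+\<omega>. (\<integral>\<^sup>+t. indicator {0..} t * ext_cemetery g (X (ennreal t) \<omega>) \<partial>lborel) \<partial>P (Some x))"
    by (rule Fubini'[symmetric]) (auto simp: split_beta')
  also have "\<dots> = potential X P g x"
    unfolding potential_def by (simp add: mult.commute)
  finally show ?thesis .
qed

end

section \<open>Potentials and excessive functions of a Borel right process\<close>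

lemma down_closed_real_borel:
  fixes S :: "real set"
  assumes down: "\<And>s t. t \<in> S \<Longrightarrow> s \<le> t \<Longrightarrow> s \<in> S"
  shows "S \<in> sets borel"
proof (cases "S = {} \<or> \<not> bdd_above S")
  case True
  moreover have "S = UNIV" if "\<not> bdd_above S"
    using that down unfolding bdd_above_def by (metis UNIV_eq_I linear)
  ultimately show ?thesis by auto
next
  case False
  have "{..<Sup S} \<subseteq> S"
  proof
    fix s assume "s \<in> {..<Sup S}"
    then obtain t where "t \<in> S" "s < t" using False by (metis lessThan_iff less_cSupD)
    then show "s \<in> S" using down by auto
  qed
  moreover have "S \<subseteq> {..Sup S}" using False by (auto intro: cSup_upper)
  ultimately have "S = {..<Sup S} \<or> S = {..Sup S}" by (force simp: less_le)
  then show ?thesis by (metis atMost_borel lessThan_borel)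
qed

text \<open>
  For an excessive \<open>f\<close> that is only universally measurable, monotonicity is what makes
  \<open>P\<^sub>t f(x)\<close> measurable in \<open>t\<close>.
\<close>

lemma antimono_borel_measurable:
  fixes q :: "real \<Rightarrow> ennreal"
  assumes "\<And>s t. s \<le> t \<Longrightarrow> q t \<le> q s"
  shows "q \<in> borel_measurable borel"
proof (rule borel_measurableI_greater)
  fix c
  have "{t. c < q t} \<in> sets borel"
    by (rule down_closed_real_borel) (auto intro: order_less_le_trans assms)
  then show "{t \<in> space borel. c < q t} \<in> sets borel" by simp
qed

context borel_right_process
begin

text \<open>
  A path started in an open set stays there for a positive time, so the potential of the open set
  does not vanish, and neither does its measure.
\<close>

lemma open_set_charged:
  assumes lc: "locally_compact_space (euclidean :: 'a topology)"
    and dens: "potential_densities X P m u" and m: "sets m = sets borel"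
    and U: "open U" "U \<noteq> {}"
  shows "0 < emeasure m U"
proof (rule ccontr)
  assume "\<not> 0 < emeasure m U"
  then have null: "emeasure m U = 0" by (simp add: zero_less_iff_neq_zero)
  obtain x where x: "x \<in> U" using U(2) by blast
  interpret prob_space "P (Some x)" by (rule prob_P)
  interpret pair_sigma_finite "P (Some x)" "lborel :: real measure" ..
  let ?g = "indicator U :: 'a \<Rightarrow> ennreal"
  have g [measurable]: "?g \<in> borel_measurable borel" using U(1) by simp
  let ?occ = "\<lambda>\<omega>. \<integral>\<^sup>+t\<in>{0..}. ext_cemetery ?g (X (ennreal t) \<omega>) \<partial>lborel"
  have Um: "U \<in> sets m" using U(1) m by simp
  have "potential X P ?g x = (\<integral>\<^sup>+y. ennreal (u x y) * ?g y \<partial>m)"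
    using dens g unfolding potential_densities_def by blast
  also have "\<dots> = 0"
  proof -
    have "AE y in m. y \<notin> U" using null Um by (intro AE_not_in) (auto simp: null_sets_def)
    then have "(\<integral>\<^sup>+y. ennreal (u x y) * ?g y \<partial>m) = (\<integral>\<^sup>+y. 0 \<partial>m)"
      by (intro nn_integral_cong_AE) (auto elim: eventually_mono)
    then show ?thesis by simp
  qed
  finally have zero: "(\<integral>\<^sup>+\<omega>. ?occ \<omega> \<partial>P (Some x)) = 0" unfolding potential_def .
  have joint: "(\<lambda>z. ext_cemetery ?g (X (ennreal (snd z)) (fst z)) * indicator {0..} (snd z)) \<in> borel_measurable (P (Some x) \<Otimes>\<^sub>M lborel)"
  proof -
    have "(\<lambda>z. (snd z, fst z)) \<in> P (Some x) \<Otimes>\<^sub>M lborel \<rightarrow>\<^sub>M borel \<Otimes>\<^sub>M P (Some x)" by measurable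
    from measurable_compose[OF this measurable_compose[OF X_jointly_measurable[OF lc] ext_cemetery_measurable[OF g]]]
    have [measurable]: "(\<lambda>z. ext_cemetery ?g (X (ennreal (snd z)) (fst z))) \<in> borel_measurable (P (Some x) \<Otimes>\<^sub>M lborel)" by simp
    show ?thesis by measurable
  qed
  have "?occ \<in> borel_measurable (P (Some x))"
    using lborel.borel_measurable_nn_integral[of "\<lambda>\<omega> t. ext_cemetery ?g (X (ennreal t) \<omega>) * indicator {0..} t" "P (Some x)"] joint
    by (simp add: split_beta')
  then have "AE \<omega> in P (Some x). ?occ \<omega> = 0"
    using zero by (simp add: nn_integral_0_iff_AE)
  moreover have "AE \<omega> in P (Some x). ?occ \<omega> \<noteq> 0"
    using normal[of "Some x"] AE_space
  proof eventually_elim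
    case (elim \<omega>)
    then have "eventually (\<lambda>s. X s \<omega> \<in> Some ` U) (at_right 0)"
      using paths_right_continuous[of \<omega> 0] U(1) x by (intro limitinD[where l = "Some x"]) (auto simp: open_openin[symmetric])
    then obtain r :: ennreal where r: "0 < r" "\<And>s. 0 < s \<Longrightarrow> s < r \<Longrightarrow> X s \<omega> \<in> Some ` U"
      using eventually_at_right[of 0 "1::ennreal"] by auto
    obtain \<epsilon> where e: "0 < \<epsilon>" "ennreal \<epsilon> \<le> r"
      using r(1) by (cases r) (auto intro: that[of 1] that)
    have "ennreal \<epsilon> = emeasure lborel {0<..<\<epsilon>}" using e(1) by simp
    also have "\<dots> = (\<integral>\<^sup>+t. indicator {0<..<\<epsilon>} t \<partial>lborel)" by simp
    also have "\<dots> \<le> ?occ \<omega>"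
    proof (rule nn_integral_mono)
      fix t :: real
      have "X (ennreal t) \<omega> \<in> Some ` U" if "0 < t" "t < \<epsilon>"
      proof (rule r(2))
        have "ennreal t < ennreal \<epsilon>" using that by (simp add: ennreal_lessI)
        then show "ennreal t < r" using e(2) by (rule order_less_le_trans)
      qed (use that in simp)
      then show "indicator {0<..<\<epsilon>} t \<le> ext_cemetery ?g (X (ennreal t) \<omega>) * indicator {0..} t"
        by (auto simp: indicator_def ext_cemetery_def)
    qed
    finally show ?case using e(1) by auto
  qed
  ultimately have "AE \<omega> in P (Some x). False" by eventually_elim simp
  then show False by simp
qed

text \<open>
  Measurability first. A universally measurable \<open>f\<close> agrees with a Borel function \<open>f'\<close> off an
  \<open>m\<close>-null set; this set has potential zero, so \<open>P\<^sub>t f(x) = P\<^sub>t f'(x)\<close> for almost every \<open>t\<close>. Hence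
  \<open>f = lim n R\<^sub>n f'\<close>, a limit of Borel functions, is Borel itself. The other two claims are averages
  over time of \<open>P\<^sub>t f \<le> f\<close> and of \<open>P\<^sub>t f \<rightarrow> f\<close>.
\<close>

lemma excessive_resolvent_properties:
  assumes lc: "locally_compact_space (euclidean :: 'a topology)"
    and dens: "potential_densities X P m u" and m: "sigma_finite_measure m" "sets m = sets borel"
    and exc: "excessive X P f"
  shows "(\<lambda>x. ennreal (f x)) \<in> borel_measurable borel"
    and "0 < l \<Longrightarrow> ennreal l * submarkov_semigroup.resolvent kernel l (\<lambda>x. ennreal (f x)) x \<le> ennreal (f x)"
    and "(\<lambda>n. ennreal (real (Suc n)) * submarkov_semigroup.resolvent kernel (real (Suc n)) (\<lambda>x. ennreal (f x)) x) \<longlonglongrightarrow> ennreal (f x)"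
proof -
  interpret S: submarkov_semigroup kernel by (rule submarkov_semigroup_kernel[OF lc])
  interpret m: sigma_finite_measure m by (rule m(1))
  have um: "universally_measurable f" using exc unfolding excessive_def by blast
  define E where "E t x = (\<integral>\<^sup>+\<omega>. ext_cemetery (\<lambda>y. ennreal (f y)) (X (ennreal t) \<omega>) \<partial>P (Some x))" for t x
  have anti: "E t x \<le> E s x" if "0 < s" "s \<le> t" for s t x
    using exc that unfolding excessive_def Let_def E_def by (auto dest!: spec[of _ x] elim!: monotone_onD)
  have lim: "((\<lambda>t. E t x) \<longlongrightarrow> ennreal (f x)) (at_right 0)" for x
    using exc unfolding excessive_def Let_def E_def by blast
  have le: "E t x \<le> ennreal (f x)" if "0 < t" for t x
  proof (rule tendsto_lowerbound[OF lim])
    show "eventually (\<lambda>s. E t x \<le> E s x) (at_right 0)"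
      using eventually_at_right_less[of 0] order_tendstoD(2)[OF tendsto_ident_at that, of "{0<..}"]
      by eventually_elim (auto intro: anti)
  qed simp
  obtain h where h: "h \<in> borel_measurable m" "integral\<^sup>N m h \<noteq> \<infinity>" "\<And>x. x \<in> space m \<Longrightarrow> 0 < h x \<and> h x < \<infinity>"
    using m.Ex_finite_integrable_function by blast
  \<comment> \<open>A finite measure with the same null sets as \<open>m\<close>.\<close>
  define \<mu> where "\<mu> = density m h"
  have "finite_measure \<mu>"
  proof
    have "emeasure \<mu> (space \<mu>) = integral\<^sup>N m h"
      unfolding \<mu>_def using h(1) by (simp add: emeasure_density cong: nn_integral_cong)
    then show "emeasure \<mu> (space \<mu>) \<noteq> \<infinity>" using h(2) by simp
  qed
  moreover have sets_\<mu>: "sets \<mu> = sets borel" unfolding \<mu>_def using m(2) by simp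
  ultimately have "f \<in> borel_measurable (completion \<mu>)" using um unfolding universally_measurable_def by blast
  from completion_ex_borel_measurable_real[OF this]
  obtain f' where f': "f' \<in> borel_measurable \<mu>" "AE x in \<mu>. f x = f' x" by blast
  have f'_borel [measurable]: "f' \<in> borel_measurable borel"
    using f'(1) by (simp add: measurable_cong_sets[OF sets_\<mu> refl])
  have "AE x in m. 0 < h x \<longrightarrow> f x = f' x"
    using f'(2) unfolding \<mu>_def AE_density[OF h(1)] .
  then have "AE x in m. f x = f' x"
    using AE_space by eventually_elim (use h(3) in blast)
  then obtain Z where Z: "{x \<in> space m. f x \<noteq> f' x} \<subseteq> Z" "Z \<in> null_sets m"
    by (auto elim!: AE_E simp: null_sets_def)
  have space_m: "space m = UNIV" using sets_eq_imp_space_eq[OF m(2)] by simp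
  have Zb [measurable]: "Z \<in> sets borel" using Z(2) m(2) by auto
  have ff': "f y = f' y" if "y \<notin> Z" for y using Z(1) that space_m by auto
  have AE_t: "AE t in lborel. 0 \<le> t \<longrightarrow> E t x = S.transition t (\<lambda>y. ennreal (f' y)) x" for x
  proof -
    have "S.resolvent 0 (indicator Z) x = (\<integral>\<^sup>+y. ennreal (u x y) * indicator Z y \<partial>m)"
      using resolvent_eq_potential[OF lc, of "indicator Z" x] dens unfolding potential_densities_def by simp
    also have "\<dots> = 0"
    proof -
      have "AE y in m. y \<notin> Z" using Z(2) by (rule AE_not_in)
      then have "(\<integral>\<^sup>+y. ennreal (u x y) * indicator Z y \<partial>m) = (\<integral>\<^sup>+y. 0 \<partial>m)"
        by (intro nn_integral_cong_AE) (auto elim: eventually_mono)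
      then show ?thesis by simp
    qed
    finally have "AE t in lborel. ennreal (exp (- 0 * t) * indicator {0..} t) * S.transition t (indicator Z) x = 0"
      unfolding S.resolvent_def by (subst (asm) nn_integral_0_iff_AE) auto
    then show ?thesis
    proof eventually_elim
      case (elim t)
      show ?case
      proof
        assume "0 \<le> t"
        then have "S.transition t (indicator Z) x = 0" using elim by simp
        then have "(\<integral>\<^sup>+\<omega>. ext_cemetery (indicator Z) (X (ennreal t) \<omega>) \<partial>P (Some x)) = 0"
          unfolding S.transition_def by (subst (asm) nn_integral_kernel) auto
        then have "AE \<omega> in P (Some x). ext_cemetery (indicator Z) (X (ennreal t) \<omega>) = 0"
          using measurable_compose[OF X_measurable ext_cemetery_measurable[OF borel_measurable_indicator[OF Zb]]]
          by (subst (asm) nn_integral_0_iff_AE)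
        then have "E t x = (\<integral>\<^sup>+\<omega>. ext_cemetery (\<lambda>y. ennreal (f' y)) (X (ennreal t) \<omega>) \<partial>P (Some x))"
          unfolding E_def
          by (intro nn_integral_cong_AE)
            (auto elim!: eventually_mono simp: ext_cemetery_def indicator_def ff' split: option.splits if_splits)
        then show "E t x = S.transition t (\<lambda>y. ennreal (f' y)) x"
          unfolding S.transition_def by (subst nn_integral_kernel) auto
      qed
    qed
  qed
  have lim_f': "(\<lambda>n. ennreal (real (Suc n)) * S.resolvent (real (Suc n)) (\<lambda>y. ennreal (f' y)) x) \<longlonglongrightarrow> ennreal (f x)" for x
  proof -
    \<comment> \<open>Extended by its upper bound to negative times, \<open>P\<^sub>t f(x)\<close> is antimonotone on the real line.\<close>
    define q where "q t = (if 0 < t then E t x else ennreal (f x))" for t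
    have q_meas [measurable]: "q \<in> borel_measurable borel"
      by (rule antimono_borel_measurable) (auto simp: q_def anti le)
    have q_lim: "(q \<longlongrightarrow> ennreal (f x)) (at_right 0)"
      by (rule Lim_transform_eventually[OF lim]) (auto simp: q_def intro: eventually_mono[OF eventually_at_right_less])
    have "(\<lambda>n. ennreal (real (Suc n)) *
        (\<integral>\<^sup>+t. ennreal (exp (- real (Suc n) * t) * indicator {0..} t) * q t \<partial>lborel)) \<longlonglongrightarrow> ennreal (f x)"
      by (rule abelian_average_tendsto[OF q_meas _ _ q_lim]) (auto simp: q_def le)
    moreover have "(\<integral>\<^sup>+t. ennreal (exp (- real (Suc n) * t) * indicator {0..} t) * q t \<partial>lborel)
        = S.resolvent (real (Suc n)) (\<lambda>y. ennreal (f' y)) x" for n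
      unfolding S.resolvent_def using AE_t[of x] AE_lborel_singleton[of "0::real"]
      by (intro nn_integral_cong_AE, eventually_elim) (auto simp: q_def indicator_def)
    ultimately show ?thesis by simp
  qed
  show f [measurable]: "(\<lambda>x. ennreal (f x)) \<in> borel_measurable borel"
    by (rule borel_measurable_LIMSEQ_order[OF lim_f']) measurable
  have trans_f: "S.transition t (\<lambda>y. ennreal (f y)) x = E t x" for t x
    unfolding S.transition_def E_def by (rule nn_integral_kernel) simp
  show "ennreal l * S.resolvent l (\<lambda>x. ennreal (f x)) x \<le> ennreal (f x)" if "0 < l"
  proof -
    have "S.resolvent l (\<lambda>x. ennreal (f x)) x \<le> (\<integral>\<^sup>+t. ennreal (exp (- l * t) * indicator {0..} t) * ennreal (f x) \<partial>lborel)"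
      unfolding S.resolvent_def trans_f using AE_lborel_singleton[of "0::real"]
      by (intro nn_integral_mono_AE, eventually_elim) (auto simp: indicator_def intro!: mult_left_mono le)
    also have "\<dots> = ennreal (1 / l) * ennreal (f x)"
      using S.nn_integral_exponential[OF that] by (subst nn_integral_multc) auto
    finally have "ennreal l * S.resolvent l (\<lambda>x. ennreal (f x)) x \<le> ennreal l * (ennreal (1 / l) * ennreal (f x))"
      by (rule mult_left_mono) simp
    also have "\<dots> = ennreal (f x)"
      using that by (simp add: mult.assoc[symmetric] ennreal_mult'[symmetric])
    finally show ?thesis .
  qed
  show "(\<lambda>n. ennreal (real (Suc n)) * S.resolvent (real (Suc n)) (\<lambda>x. ennreal (f x)) x) \<longlonglongrightarrow> ennreal (f x)"
    unfolding S.resolvent_def trans_f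
  proof (rule abelian_average_tendsto)
    show "(\<lambda>t. E t x) \<in> borel_measurable borel" unfolding trans_f[symmetric] by measurable
  qed (use le lim in auto)
qed

end

theorem theorem1p9:
  fixes \<Omega> :: "'w set"
    and F :: "ennreal \<Rightarrow> 'w measure"
    and X :: "ennreal \<Rightarrow> 'w \<Rightarrow> 'a::{t2_space, second_countable_topology} option"
    and \<theta> :: "ennreal \<Rightarrow> 'w \<Rightarrow> 'w"
    and P :: "'a option \<Rightarrow> 'w measure"
    and m :: "'a measure"
    and u :: "'a \<Rightarrow> 'a \<Rightarrow> real"
    and f :: "'a \<Rightarrow> real"
    and \<alpha> :: real
  assumes "locally_compact_space (euclidean :: 'a topology)"
    and "borel_right_process \<Omega> F X \<theta> P"
    and "transient_process X P"
    and "sigma_finite_measure m" and "sets m = sets borel"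
    and "potential_densities X P m u"
    and "continuous_on UNIV (\<lambda>(x, y). u x y)"
    and "\<And>x y. 0 < u x y"
    and "\<And>x y. u x y = u y x"
    and "excessive X P f"
    and "0 < \<alpha>"
  shows "permanental_process_kernel \<alpha> (\<lambda>x y. u x y + f y)"
proof -
  note lc = assms(1) and dens = assms(6)
  interpret borel_right_process \<Omega> F X \<theta> P by (rule assms(2))
  interpret continuous_potential_density kernel m u
  proof (intro continuous_potential_density.intro continuous_potential_density_axioms.intro submarkov_semigroup_kernel lc assms(4,5,7,8))
    show "submarkov_semigroup.resolvent kernel 0 g x = (\<integral>\<^sup>+y. ennreal (u x y) * g y \<partial>m)"
      if "g \<in> borel_measurable borel" for g x
      using resolvent_eq_potential[OF lc that] dens that unfolding potential_densities_def by simp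
    show "0 < emeasure m U" if "open U" "U \<noteq> {}" for U
      by (rule open_set_charged[OF lc dens assms(5) that])
  qed
  obtain h where h: "h \<in> borel_measurable borel" "\<And>x. 0 < potential X P h x" "\<And>x. potential X P h x < \<infinity>"
    using assms(3) unfolding transient_process_def by blast
  note f = excessive_resolvent_properties[OF lc dens assms(4,5,10)]
  show ?thesis
  proof (rule excessive_perturbation_permanental[OF assms(11,9) f(1) _ h(1) _ _ f(2,3)])
    show "0 \<le> f x" for x using assms(10) unfolding excessive_def by blast
    show "0 < resolvent 0 h x" "resolvent 0 h x < \<infinity>" for x
      unfolding resolvent_eq_potential[OF lc h(1)] by (rule h)+
  qed
qed

end
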